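(* For every $n\in\mathbb{N}$, every $\ell=n^{\Omega(1)}$, and every $\varepsilon\geq 1/\mathrm{poly}(n)$, there is a pseudorandom generator $G\colon\{0,1\}^r\to\{0,1\}^n$ with seed length $r=\ell^{2/3+o(1)}$ that $\varepsilon$-fools comparator circuits with $\ell$ wires over $n$ variables. Moreover, for every seed $z\in\{0,1\}^r$ there is a Boolean circuit $D_z$ of size $\ell^{2/3+o(1)}$ that, given as input $j\in[n]$, computes the $j$-th bit of $G(z)$.
   Context: A comparator circuit on $n$ variables consists of a set of wires, each labelled by an input literal ($x_i$ or $\neg x_i$), a sequence of gates, each an ordered pair of distinct wires $(w_i,w_j)$, and a designated output wire; on input $a$, wires are initialised with the values of their literals, each gate in order replaces the current values $(u,v)$ of its two wires by $(u\wedge v,u\vee v)$, and the output is the final value of the output wire. A generator $G\colon\{0,1\}^r\to\{0,1\}^n$ $\varepsilon$-fools a class of circuits if for every $C\colon\{0,1\}^n\to\{0,1\}$ in the class, $\left|\Pr_{z\in\{0,1\}^r}[C(G(z))=1]-\Pr_{x\in\{0,1\}^n}[C(x)=1]\right|\leq\varepsilon$. *)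

theory Defs
  imports "HOL-Probability.Probability" "HOL-Library.Landau_Symbols" "HOL-Library.Log_Nat"
begin

section \<open>Bit strings and pseudorandom generators\<close>

definition bitstrings :: "nat \<Rightarrow> bool list set" where
  "bitstrings n = {x. length x = n}"

definition accept_prob :: "nat \<Rightarrow> (bool list \<Rightarrow> bool) \<Rightarrow> real" where
  "accept_prob n f = measure_pmf.prob (pmf_of_set (bitstrings n)) {x. f x}"

definition fools ::
    "real \<Rightarrow> nat \<Rightarrow> nat \<Rightarrow> (bool list \<Rightarrow> bool list) \<Rightarrow> (bool list \<Rightarrow> bool) set \<Rightarrow> bool" where
  "fools \<epsilon> r n G \<C> \<longleftrightarrow>
     (\<forall>C\<in>\<C>. \<bar>accept_prob r (\<lambda>z. C (G z)) - accept_prob n C\<bar> \<le> \<epsilon>)"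


section \<open>Comparator circuits\<close>

datatype input_literal = Pos nat | Neg nat

primrec lit_var :: "input_literal \<Rightarrow> nat" where
  "lit_var (Pos i) = i"
| "lit_var (Neg i) = i"

primrec lit_val :: "bool list \<Rightarrow> input_literal \<Rightarrow> bool" where
  "lit_val x (Pos i) = x ! i"
| "lit_val x (Neg i) = (\<not> x ! i)"

text \<open>The wires are \<open>0, \<dots>, length (wire_labels C) - 1\<close>.\<close>

record comparator_circuit =
  wire_labels :: "input_literal list"
  cgates :: "(nat \<times> nat) list"
  output_wire :: nat

definition num_wires :: "comparator_circuit \<Rightarrow> nat" where
  "num_wires C = length (wire_labels C)"

definition wf_comparator_circuit :: "nat \<Rightarrow> comparator_circuit \<Rightarrow> bool" where
  "wf_comparator_circuit n C \<longleftrightarrow>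
     (\<forall>l\<in>set (wire_labels C). lit_var l < n) \<and>
     (\<forall>(i, j)\<in>set (cgates C). i < num_wires C \<and> j < num_wires C \<and> i \<noteq> j) \<and>
     output_wire C < num_wires C"

fun apply_cgate :: "nat \<times> nat \<Rightarrow> bool list \<Rightarrow> bool list" where
  "apply_cgate (i, j) v = v[i := v ! i \<and> v ! j, j := v ! i \<or> v ! j]"

definition eval_comparator :: "comparator_circuit \<Rightarrow> bool list \<Rightarrow> bool" where
  "eval_comparator C x =
     fold apply_cgate (cgates C) (map (lit_val x) (wire_labels C)) ! output_wire C"

definition comparator_class :: "nat \<Rightarrow> nat \<Rightarrow> (bool list \<Rightarrow> bool) set" where
  "comparator_class n l =
     {eval_comparator C | C. wf_comparator_circuit n C \<and> num_wires C = l}"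


section \<open>Boolean circuits\<close>

text \<open>
  Fan-in two circuits over the De Morgan basis with constants. On \<open>m\<close> inputs, nodes
  \<open>0, \<dots>, m - 1\<close> are the inputs and node \<open>m + k\<close> is the \<open>k\<close>-th gate, which may only read
  nodes preceding it.
\<close>

datatype bgate = Const_gate bool | Not_gate nat | And_gate nat nat | Or_gate nat nat

primrec bgate_preds :: "bgate \<Rightarrow> nat set" where
  "bgate_preds (Const_gate b) = {}"
| "bgate_preds (Not_gate i) = {i}"
| "bgate_preds (And_gate i j) = {i, j}"
| "bgate_preds (Or_gate i j) = {i, j}"

primrec bgate_val :: "bool list \<Rightarrow> bgate \<Rightarrow> bool" where
  "bgate_val v (Const_gate b) = b"
| "bgate_val v (Not_gate i) = (\<not> v ! i)"
| "bgate_val v (And_gate i j) = (v ! i \<and> v ! j)"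
| "bgate_val v (Or_gate i j) = (v ! i \<or> v ! j)"

record boolean_circuit =
  bgates :: "bgate list"
  output_node :: nat

definition wf_boolean_circuit :: "nat \<Rightarrow> boolean_circuit \<Rightarrow> bool" where
  "wf_boolean_circuit m D \<longleftrightarrow>
     (\<forall>k<length (bgates D). \<forall>i\<in>bgate_preds (bgates D ! k). i < m + k) \<and>
     output_node D < m + length (bgates D)"

definition eval_boolean :: "boolean_circuit \<Rightarrow> bool list \<Rightarrow> bool" where
  "eval_boolean D x = fold (\<lambda>g v. v @ [bgate_val v g]) (bgates D) x ! output_node D"

definition circuit_size :: "boolean_circuit \<Rightarrow> nat" where
  "circuit_size D = length (bgates D)"

text \<open>
  A position in a string of length \<open>n\<close> is given to a circuit in binary, least significant bit
  first. Positions are counted from \<open>0\<close>, so that \<open>ceillog2 n\<close> bits suffice for all of them.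
\<close>

definition index_bits :: "nat \<Rightarrow> nat \<Rightarrow> bool list" where
  "index_bits n j = map (bit j) [0..<ceillog2 n]"

definition computes_bits :: "nat \<Rightarrow> boolean_circuit \<Rightarrow> bool list \<Rightarrow> bool" where
  "computes_bits n D y \<longleftrightarrow>
     wf_boolean_circuit (ceillog2 n) D \<and> (\<forall>j<n. eval_boolean D (index_bits n j) = y ! j)"


section \<open>Asymptotic side conditions\<close>

text \<open>\<open>l = n\<^sup>\<Omega>\<^sup>(\<^sup>1\<^sup>)\<close>\<close>

definition poly_large :: "(nat \<Rightarrow> nat) \<Rightarrow> bool" where
  "poly_large l \<longleftrightarrow> (\<exists>c>0. \<forall>\<^sub>F n in sequentially. real n powr c \<le> real (l n))"

text \<open>\<open>\<epsilon> \<ge> 1/poly(n)\<close>\<close>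

definition inverse_poly_bounded :: "(nat \<Rightarrow> real) \<Rightarrow> bool" where
  "inverse_poly_bounded \<epsilon> \<longleftrightarrow>
     (\<exists>p :: real poly. \<forall>n. 0 < poly p (real n) \<and> 1 / poly p (real n) \<le> \<epsilon> n)"

text \<open>\<open>f = l\<^sup>a\<^sup>+\<^sup>o\<^sup>(\<^sup>1\<^sup>)\<close>, where \<open>o(1)\<close> refers to \<open>n \<rightarrow> \<infinity>\<close>\<close>

definition power_up_to_o1 :: "real \<Rightarrow> (nat \<Rightarrow> nat) \<Rightarrow> (nat \<Rightarrow> nat) \<Rightarrow> bool" where
  "power_up_to_o1 a l f \<longleftrightarrow>
     (\<exists>\<delta>\<in>o(\<lambda>_::nat. 1::real). \<forall>\<^sub>F n in sequentially. real (f n) = real (l n) powr (a + \<delta> n))"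

end

theory Submission
  imports Defs "HOL-Real_Asymp.Real_Asymp"
begin

text \<open>
  Hash the \<open>n\<close> positions into \<open>t \<approx> l\<^sup>2\<^sup>/\<^sup>3\<close> blocks. With high probability, after fixing the bits outside
  a block, a comparator circuit with \<open>l\<close> wires only has \<open>w \<approx> l / t\<close> wires that are not constant, up to
  branching on a constant number of variables that label many wires. A gate comparing two comparable
  functions is a renaming of wires, and every other gate decreases the number of incomparable pairs, so
  such a circuit has at most \<open>w\<^sup>2\<close> relevant gates, and there are only \<open>2\<^sup>m\<close> of them with
  \<open>m \<approx> w\<^sup>2 \<approx> l\<^sup>2\<^sup>/\<^sup>3\<close>. In each block we use the Nisan-Wigderson generator on a short independent seed.
  It fools the block if its underlying function \<open>X\<close> is uncorrelated with about \<open>2\<^sup>m\<close> predictors. Such an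
  \<open>X\<close> exists among the XORs of \<open>c\<close> tables of about \<open>m\<close> bits read at disjoint parts of the input: high
  moments of the correlation are bounded by those of a product of \<open>c\<close> random sums, which is the extremal
  case since every character has nonnegative mean. The tables are hard-wired, so circuits for single
  output bits have size about \<open>t + m\<close>. The designs and the hash function come from one linear code over
  two elements in which distinct codewords seldom agree.
\<close>

section \<open>Averages over bit strings\<close>

text \<open>The exponent 2/3 is a balance. With \<open>t\<close> blocks the seeds cost about
  \<open>t\<close> bits, and the tables must have about as many bits as the logarithm of the number
  of networks on \<open>l / t\<close> wires, which is about \<open>(l / t)^2\<close>; the two costs
  agree for \<open>t = l^(2/3)\<close>. All overheads are powers of \<open>2 ^ g\<close> with
  \<open>g\<close> about \<open>log n / B\<close> for a constant \<open>B\<close>, which is chosen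
  large once the excess in the exponent is given. So small a \<open>g\<close> is the obstacle that
  shapes the construction: the collision bound of one hashed variable, the correlation with one
  table and the agreement of two codewords in one symbol are only about \<open>n^(-1/B)\<close>, far
  above an inverse polynomial. Each is therefore raised to a constant power, by taking moments of
  order \<open>k\<close>, by XORing \<open>c\<close> tables and by asking for \<open>a\<close>
  agreements. Enlarging a single table instead would cost a factor polynomial in \<open>n\<close>,
  which may exceed every \<open>l^(o(1))\<close>.\<close>

definition avg :: "nat \<Rightarrow> (bool list \<Rightarrow> real) \<Rightarrow> real" where
  "avg n F = (\<Sum>x\<in>bitstrings n. F x) / 2 ^ n"

lemma finite_bitstrings [simp]: "finite (bitstrings n)"
  using finite_lists_length_eq[of "UNIV :: bool set" n] by (simp add: bitstrings_def)

lemma card_bitstrings [simp]: "card (bitstrings n) = 2 ^ n"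
  using card_lists_length_eq[of "UNIV :: bool set" n] by (simp add: bitstrings_def)

lemma bitstrings_nonempty [simp]: "bitstrings n \<noteq> {}"
  using card_bitstrings[of n] by (metis card.empty power_not_zero zero_neq_numeral)

lemma mem_bitstrings [simp]: "x \<in> bitstrings n \<longleftrightarrow> length x = n"
  by (simp add: bitstrings_def)

lemma accept_prob_avg: "accept_prob n f = avg n (\<lambda>x. of_bool (f x))"
proof -
  have "(\<Sum>x\<in>bitstrings n. of_bool (f x) :: real) = real (card (bitstrings n \<inter> {x. f x}))"
    by (simp add: of_bool_def sum.If_cases)
  then show ?thesis
    by (simp add: accept_prob_def avg_def measure_pmf_of_set)
qed

lemma avg_cong: "(\<And>x. length x = n \<Longrightarrow> F x = F' x) \<Longrightarrow> avg n F = avg n F'"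
  unfolding avg_def by (metis (no_types, lifting) mem_bitstrings sum.cong)

lemma avg_mono: "(\<And>x. length x = n \<Longrightarrow> F x \<le> F' x) \<Longrightarrow> avg n F \<le> avg n F'"
  unfolding avg_def by (intro divide_right_mono sum_mono) auto

lemma avg_const [simp]: "avg n (\<lambda>_. c) = c"
  by (simp add: avg_def)

lemma avg_add: "avg n (\<lambda>x. F x + F' x) = avg n F + avg n F'"
  by (simp add: avg_def sum.distrib add_divide_distrib)

lemma avg_diff: "avg n (\<lambda>x. F x - F' x) = avg n F - avg n F'"
  by (simp add: avg_def sum_subtractf diff_divide_distrib)

lemma avg_cmult: "avg n (\<lambda>x. c * F x) = c * avg n F"
  by (simp add: avg_def sum_distrib_left)

lemma avg_divide: "avg n (\<lambda>x. F x / c) = avg n F / c"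
  by (simp add: avg_def sum_divide_distrib mult.commute)

lemma avg_sum: "avg n (\<lambda>x. \<Sum>i\<in>I. F i x) = (\<Sum>i\<in>I. avg n (F i))"
  unfolding avg_def by (subst sum.swap) (simp add: sum_divide_distrib)

lemma avg_swap: "avg m (\<lambda>x. avg n (F x)) = avg n (\<lambda>y. avg m (\<lambda>x. F x y))"
  unfolding avg_def by (simp add: sum_divide_distrib [symmetric] sum.swap[of _ "bitstrings n"])

lemma avg_nonneg: "(\<And>x. length x = n \<Longrightarrow> 0 \<le> F x) \<Longrightarrow> 0 \<le> avg n F"
  using avg_mono[of n "\<lambda>_. 0" F] by simp

lemma avg_le: "(\<And>x. length x = n \<Longrightarrow> F x \<le> c) \<Longrightarrow> avg n F \<le> c"
  using avg_mono[of n F "\<lambda>_. c"] by simp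

lemma abs_avg_le: "\<bar>avg n F\<bar> \<le> avg n (\<lambda>x. \<bar>F x\<bar>)"
  unfolding avg_def by (simp add: divide_right_mono)

lemma ex_le_avg: "avg n F < c \<Longrightarrow> \<exists>x. length x = n \<and> F x < c"
proof (rule ccontr)
  assume "avg n F < c" "\<not> (\<exists>x. length x = n \<and> F x < c)"
  then have "c \<le> avg n F"
    using avg_mono[of n "\<lambda>_. c" F] by fastforce
  then show False using \<open>avg n F < c\<close> by simp
qed

lemma bitstrings_append: "bitstrings (m + n) = (\<lambda>(x, y). x @ y) ` (bitstrings m \<times> bitstrings n)"
proof -
  have "x \<in> (\<lambda>(x, y). x @ y) ` (bitstrings m \<times> bitstrings n)" if "length x = m + n" for x
    by (rule image_eqI[of _ _ "(take m x, drop m x)"]) (use that in auto)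
  then show ?thesis by auto
qed

lemma avg_append: "avg (m + n) F = avg m (\<lambda>x. avg n (\<lambda>y. F (x @ y)))"
proof -
  have "(\<Sum>x\<in>bitstrings (m + n). F x) = (\<Sum>(x, y)\<in>bitstrings m \<times> bitstrings n. F (x @ y))"
    unfolding bitstrings_append
    by (subst sum.reindex) (auto simp: inj_on_def case_prod_unfold)
  then show ?thesis
    by (simp add: avg_def sum.cartesian_product power_add sum_divide_distrib[symmetric] mult.commute)
qed

lemma avg_0 [simp]: "avg 0 F = F []"
  by (simp add: avg_def bitstrings_def)

lemma avg_Suc: "avg (Suc n) F = (avg n (\<lambda>x. F (True # x)) + avg n (\<lambda>x. F (False # x))) / 2"
proof -
  have *: "bitstrings (Suc 0) = {[True], [False]}"
    by (auto simp: bitstrings_def length_Suc_conv)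
  have "avg (1 + n) F = avg 1 (\<lambda>x. avg n (\<lambda>y. F (x @ y)))"
    by (rule avg_append)
  also have "\<dots> = (avg n (\<lambda>x. F (True # x)) + avg n (\<lambda>x. F (False # x))) / 2"
    by (subst avg_def) (simp add: *)
  finally show ?thesis by simp
qed

lemma avg_take:
  assumes "m \<le> n"
  shows "avg n (\<lambda>x. F (take m x)) = avg m F"
proof -
  have "avg (m + (n - m)) (\<lambda>x. F (take m x)) = avg m (\<lambda>x. avg (n - m) (\<lambda>y. F (take m (x @ y))))"
    by (rule avg_append)
  also have "\<dots> = avg m (\<lambda>x. F x)"
    by (intro avg_cong) simp
  finally show ?thesis using assms by simp
qed

lemma avg_prod: "avg n (\<lambda>x. \<Prod>i<n. F i (x ! i)) = (\<Prod>i<n. (F i True + F i False) / 2)"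
proof (induction n arbitrary: F)
  case (Suc n)
  show ?case
    by (simp add: avg_Suc prod.lessThan_Suc_shift del: prod.lessThan_Suc)
      (simp add: Suc.IH[of "\<lambda>i. F (Suc i)"] avg_cmult ring_distribs add_divide_distrib)
qed simp

lemma avg_flip:
  assumes "p < n"
  shows "avg n (\<lambda>x. F (x[p := \<not> x ! p])) = avg n F"
proof -
  have "(\<Sum>x\<in>bitstrings n. F (x[p := \<not> x ! p])) = (\<Sum>x\<in>bitstrings n. F x)"
    by (rule sum.reindex_bij_witness[where i = "\<lambda>x. x[p := \<not> x ! p]" and j = "\<lambda>x. x[p := \<not> x ! p]"])
      (use assms in auto)
  then show ?thesis by (simp add: avg_def)
qed

lemma avg_update:
  assumes "p < n"
  shows "avg n F = avg n (\<lambda>x. (F (x[p := True]) + F (x[p := False])) / 2)"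
proof -
  have "F (x[p := True]) + F (x[p := False]) = F x + F (x[p := \<not> x ! p])" if "length x = n" for x
  proof (cases "x ! p")
    case True
    then have "x[p := True] = x" by (metis list_update_id)
    with True show ?thesis by simp
  next
    case False
    then have "x[p := False] = x" by (metis list_update_id)
    with False show ?thesis by simp
  qed
  then have "avg n (\<lambda>x. (F (x[p := True]) + F (x[p := False])) / 2)
      = avg n (\<lambda>x. (F x + F (x[p := \<not> x ! p])) / 2)"
    by (intro avg_cong) simp
  then show ?thesis
    by (simp add: avg_divide avg_add avg_flip[OF assms])
qed

fun upds :: "'a list \<Rightarrow> nat list \<Rightarrow> 'a list \<Rightarrow> 'a list" where
  "upds z (p # ps) (b # u) = upds (z[p := b]) ps u"
| "upds z _ _ = z"

lemma length_upds [simp]: "length (upds z ps u) = length z"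
  by (induction z ps u rule: upds.induct) auto

lemma upds_nth_notin: "q \<notin> set ps \<Longrightarrow> upds z ps u ! q = z ! q"
  by (induction z ps u rule: upds.induct) auto

lemma upds_nth:
  assumes "distinct ps" "length u = length ps" "i < length ps" "\<forall>p\<in>set ps. p < length z"
  shows "upds z ps u ! (ps ! i) = u ! i"
  using assms
  by (induction z ps u arbitrary: i rule: upds.induct)
    (auto simp: nth_Cons upds_nth_notin split: nat.splits)

text \<open>Redrawing some coordinates of a uniform string leaves it uniform. This is applied to the
  seed bits read by one output bit: for every fixed choice of the other seed bits, the bits
  \<open>u\<close> that it reads are then uniform.\<close>

lemma avg_resample:
  assumes "\<forall>p\<in>set ps. p < n"
  shows "avg n F = avg n (\<lambda>z. avg (length ps) (\<lambda>u. F (upds z ps u)))"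
  using assms
proof (induction ps)
  case (Cons p ps)
  have "avg n F = avg n (\<lambda>z. avg (length ps) (\<lambda>u. F (upds z ps u)))"
    using Cons by simp
  also have "\<dots> = avg n (\<lambda>z. (avg (length ps) (\<lambda>u. F (upds (z[p := True]) ps u))
      + avg (length ps) (\<lambda>u. F (upds (z[p := False]) ps u))) / 2)"
    using Cons.prems by (intro avg_update) simp
  finally show ?case by (simp add: avg_Suc)
qed simp

section \<open>Parities and independent parity constraints\<close>

definition parity :: "bool list \<Rightarrow> bool" where
  "parity xs \<longleftrightarrow> odd (length (filter id xs))"

lemma parity_Nil [simp]: "\<not> parity []"
  by (simp add: parity_def)

lemma parity_Cons [simp]: "parity (x # xs) \<longleftrightarrow> x \<noteq> parity xs"
  by (simp add: parity_def)

lemma parity_append [simp]: "parity (xs @ ys) \<longleftrightarrow> parity xs \<noteq> parity ys"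
  by (induction xs) auto

lemma parity_flip_one:
  assumes "distinct ps" "q \<in> set ps" "\<forall>p\<in>set ps. f' p \<longleftrightarrow> (f p \<noteq> (p = q))"
  shows "parity (map f' ps) \<longleftrightarrow> \<not> parity (map f ps)"
proof -
  have same: "parity (map f' ps) \<longleftrightarrow> parity (map f ps)"
    if "q \<notin> set ps" "\<forall>p\<in>set ps. f' p \<longleftrightarrow> (f p \<noteq> (p = q))" for ps
    using that by (induction ps) auto
  show ?thesis using assms
  proof (induction ps)
    case (Cons p ps)
    then show ?case using same[of ps] by (cases "p = q") auto
  qed simp
qed

text \<open>Each constraint contains a private pivot bit; flipping it halves the probability.\<close>

lemma avg_parity_constraints:
  fixes n :: nat and P :: "'i \<Rightarrow> nat list" and piv :: "'i \<Rightarrow> nat"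
  assumes "distinct is"
    and "\<And>i. i \<in> set is \<Longrightarrow> distinct (P i) \<and> piv i \<in> set (P i) \<and> (\<forall>p\<in>set (P i). p < n)"
    and "\<And>i i'. i \<in> set is \<Longrightarrow> i' \<in> set is \<Longrightarrow> i \<noteq> i' \<Longrightarrow> piv i \<notin> set (P i')"
  shows "avg n (\<lambda>z. of_bool (\<forall>i\<in>set is. parity (map ((!) z) (P i)) = v i)) = 1 / 2 ^ length is"
  using assms
proof (induction "is")
  case (Cons i "is")
  define A where "A = (\<lambda>z. \<forall>i\<in>set is. parity (map ((!) z) (P i)) = v i)"
  define q where "q = piv i"
  have q: "q < n" "q \<in> set (P i)" "distinct (P i)" using Cons.prems(2)[of i] by (auto simp: q_def)
  have IH: "avg n (\<lambda>z. of_bool (A z)) = 1 / 2 ^ length is"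
    unfolding A_def by (rule Cons.IH) (use Cons.prems in auto)
  have A_flip: "A (z[q := \<not> z ! q]) = A z" for z
  proof -
    have "map ((!) (z[q := \<not> z ! q])) (P i') = map ((!) z) (P i')" if "i' \<in> set is" for i'
    proof -
      have "q \<notin> set (P i')" using Cons.prems(1) Cons.prems(3)[of i i'] that by (auto simp: q_def)
      then show ?thesis by (auto intro!: nth_list_update_neq)
    qed
    then show ?thesis by (simp add: A_def del: map_eq_conv)
  qed
  have B_flip: "parity (map ((!) (z[q := \<not> z ! q])) (P i)) \<longleftrightarrow> \<not> parity (map ((!) z) (P i))"
    if "length z = n" for z
    using that q by (intro parity_flip_one[where q = q]) (auto simp: nth_list_update)
  let ?F = "\<lambda>z. of_bool (A z \<and> parity (map ((!) z) (P i)) = v i) :: real"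
  have "2 * avg n ?F = avg n ?F + avg n (\<lambda>z. ?F (z[q := \<not> z ! q]))"
    by (subst avg_flip[OF q(1)]) simp
  also have "\<dots> = avg n (\<lambda>z. of_bool (A z))"
    unfolding avg_add[symmetric] by (intro avg_cong) (auto simp: A_flip B_flip)
  finally have "avg n ?F = 1 / 2 ^ length (i # is)" using IH by simp
  then show ?case by (simp add: A_def conj_commute)
qed simp


section \<open>Counting comparator networks\<close>

definition incomp :: "'b::lattice \<Rightarrow> 'b \<Rightarrow> bool" where
  "incomp f g \<longleftrightarrow> \<not> f \<le> g \<and> \<not> g \<le> f"

lemma incomp_irrefl [simp]: "\<not> incomp f f"
  by (simp add: incomp_def)

lemma incomp_sym: "incomp f g \<longleftrightarrow> incomp g f"
  by (auto simp: incomp_def)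

definition incomp_degree :: "'b::lattice \<Rightarrow> 'b multiset \<Rightarrow> nat" where
  "incomp_degree f M = size (filter_mset (incomp f) M)"

text \<open>Ordered pairs are counted, so each incomparable pair contributes two; the potential
  stays a plain sum of degrees and is at most the square of the size.\<close>

definition incomp_pairs :: "'b::lattice multiset \<Rightarrow> nat" where
  "incomp_pairs M = (\<Sum>f\<in>#M. incomp_degree f M)"

text \<open>A multiset forgets the positions of the wires. A gate on comparable entries only
  permutes them and is invisible here, which leaves gates on incomparable entries as the only
  steps.\<close>

inductive cstep :: "'b::lattice multiset \<Rightarrow> 'b multiset \<Rightarrow> bool" where
  "incomp f g \<Longrightarrow> cstep (R + {#f, g#}) (R + {#inf f g, sup f g#})"

lemma incomp_degree_add [simp]:
  "incomp_degree f (add_mset g M) = incomp_degree f M + of_bool (incomp f g)"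
  by (simp add: incomp_degree_def)

lemma sum_mset_incomp: "(\<Sum>g\<in>#M. of_bool (incomp g f)) = incomp_degree f M"
  by (induction M) (auto simp: incomp_degree_def incomp_sym)

lemma incomp_pairs_add: "incomp_pairs (add_mset f M) = incomp_pairs M + 2 * incomp_degree f M"
  by (simp add: incomp_pairs_def sum_mset.distrib sum_mset_incomp)

text \<open>An element incomparable to one of \<open>inf f g\<close> and \<open>sup f g\<close> is
  incomparable to \<open>f\<close> or to \<open>g\<close>, and an element incomparable to both of
  them is incomparable to both \<open>f\<close> and \<open>g\<close>.\<close>

lemma incomp_degree_inf_sup:
  "incomp_degree (inf f g) R + incomp_degree (sup f g) R \<le> incomp_degree f R + incomp_degree g R"
proof (induction R)
  case (add h R)
  have "of_bool (incomp (inf f g) h) + of_bool (incomp (sup f g) h)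
      \<le> (of_bool (incomp f h) + of_bool (incomp g h) :: nat)"
    by (auto simp: incomp_def of_bool_def intro: le_infI1 le_infI2 le_supI1 le_supI2)
  with add.IH show ?case by simp
qed (simp add: incomp_degree_def)

text \<open>The new entries form a chain, so the pair itself is lost, while by
  \<open>incomp_degree_inf_sup\<close> the pairs formed with the rest do not increase.\<close>

lemma cstep_incomp_pairs: "cstep M N \<Longrightarrow> incomp_pairs N < incomp_pairs M"
proof (induction rule: cstep.induct)
  case (1 f g R)
  have "incomp g f" using 1 by (simp add: incomp_sym)
  moreover have "\<not> incomp (sup f g) (inf f g)"
    by (simp add: incomp_def le_supI1)
  ultimately show ?case
    using incomp_degree_inf_sup[of f g R] 1 by (simp add: incomp_pairs_add incomp_sym)
qed

lemma cstep_steps: "(cstep ^^ i) M N \<Longrightarrow> i + incomp_pairs N \<le> incomp_pairs M"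
proof (induction i arbitrary: N)
  case (Suc i)
  then obtain N' where "(cstep ^^ i) M N'" "cstep N' N" by auto
  then show ?case using Suc.IH[of N'] cstep_incomp_pairs[of N' N] by simp
qed simp

lemma incomp_pairs_le: "incomp_pairs M \<le> size M * size M"
proof -
  have "(\<Sum>f\<in>#A. incomp_degree f M) \<le> size A * size M" for A
    by (induction A) (auto simp: incomp_degree_def size_filter_mset_lesseq add_mono)
  then show ?thesis by (simp add: incomp_pairs_def)
qed

section \<open>Gate lists over a lattice\<close>

fun fgate :: "nat \<times> nat \<Rightarrow> 'b::lattice list \<Rightarrow> 'b list" where
  "fgate (i, j) v = v[i := inf (v ! i) (v ! j), j := sup (v ! i) (v ! j)]"

lemma length_fgate [simp]: "length (fgate e v) = length v"
  by (cases e) simp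

lemma length_fold_fgate [simp]: "length (fold fgate gs v) = length v"
  by (induction gs arbitrary: v) auto

lemma mset_fgate:
  assumes "i < length v" "j < length v" "i \<noteq> j"
  obtains R where "mset v = R + {#v ! i, v ! j#}"
    "mset (fgate (i, j) v) = R + {#inf (v ! i) (v ! j), sup (v ! i) (v ! j)#}"
proof -
  have "image_mset ((!) v) (mset_set {i, j}) \<subseteq># image_mset ((!) v) (mset_set {..<length v})"
    using assms by (intro image_mset_subseteq_mono subset_imp_msubset_mset_set) auto
  moreover have "image_mset ((!) v) (mset_set {..<length v}) = mset v"
    by (metis lessThan_atLeast0 map_nth mset_map mset_upt)
  ultimately have "{#v ! i, v ! j#} \<subseteq># mset v" using assms by simp
  then obtain R where R: "mset v = add_mset (v ! i) (add_mset (v ! j) R)"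
    by (metis mset_subset_eq_exists_conv union_mset_add_mset_left add_0)
  have "mset (v[i := x, j := y]) = add_mset y (add_mset x R)" for x y
    using assms R by (simp add: mset_update)
  then have "mset (fgate (i, j) v) = R + {#inf (v ! i) (v ! j), sup (v ! i) (v ! j)#}"
    by (simp add: add_mset_commute)
  with R show ?thesis using that[of R] by simp
qed

lemma fold_fgate_reach:
  assumes "\<forall>(i, j)\<in>set gs. i < length v \<and> j < length v \<and> i \<noteq> j"
  shows "cstep\<^sup>*\<^sup>* (mset v) (mset (fold fgate gs v))"
  using assms
proof (induction gs arbitrary: v)
  case (Cons e gs)
  obtain i j where e: "e = (i, j)" by (cases e)
  have ij: "i < length v" "j < length v" "i \<noteq> j" using Cons.prems e by auto
  obtain R where R: "mset v = R + {#v ! i, v ! j#}"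
    "mset (fgate (i, j) v) = R + {#inf (v ! i) (v ! j), sup (v ! i) (v ! j)#}"
    using mset_fgate[OF ij] by blast
  have "cstep\<^sup>*\<^sup>* (mset v) (mset (fgate e v))"
  proof (cases "incomp (v ! i) (v ! j)")
    case True
    then have "cstep (mset v) (mset (fgate e v))"
      unfolding e R by (rule cstep.intros)
    then show ?thesis by blast
  next
    case False
    then consider "v ! i \<le> v ! j" | "v ! j \<le> v ! i" by (auto simp: incomp_def)
    then have "mset (fgate e v) = mset v"
      unfolding e R
      by cases (simp_all add: inf_absorb1 inf_absorb2 sup_absorb1 sup_absorb2 add_mset_commute)
    then show ?thesis by simp
  qed
  moreover have "cstep\<^sup>*\<^sup>* (mset (fgate e v)) (mset (fold fgate gs (fgate e v)))"
    using Cons.prems by (intro Cons.IH) auto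
  ultimately show ?case by simp
qed simp

text \<open>Constant wires are comparable to every other wire, so they never take part in a step.\<close>

lemma cstep_constants:
  fixes C L N :: "'b::bounded_lattice multiset"
  assumes "cstep (C + L) N" "\<forall>x\<in>#C. x = bot \<or> x = top"
  shows "\<exists>L'. N = C + L' \<and> cstep L L'"
  using assms(1)
proof cases
  case (1 f g R)
  have nc: "f \<notin># C" "g \<notin># C" using 1(3) assms(2) by (auto simp: incomp_def)
  have CL: "C + L = add_mset f (add_mset g R)" using 1(1) by simp
  then have "f \<in># C + L" by simp
  then obtain L1 where L1: "L = add_mset f L1" using nc by (metis mset_add union_iff)
  then have CL1: "C + L1 = add_mset g R" using CL by simp
  then have "g \<in># C + L1" by simp
  then obtain L2 where L2: "L1 = add_mset g L2" using nc by (metis mset_add union_iff)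
  then have R: "R = C + L2" using CL1 by simp
  have "cstep (L2 + {#f, g#}) (L2 + {#inf f g, sup f g#})"
    using 1(3) by (rule cstep.intros)
  then show ?thesis using 1(2) R L1 L2
    by (intro exI[of _ "L2 + {#inf f g, sup f g#}"]) (auto simp: add_mset_commute)
qed

lemma csteps_constants:
  fixes C L N :: "'b::bounded_lattice multiset"
  assumes "cstep\<^sup>*\<^sup>* (C + L) N" "\<forall>x\<in>#C. x = bot \<or> x = top"
  shows "\<exists>L'. N = C + L' \<and> cstep\<^sup>*\<^sup>* L L'"
  using assms(1)
proof (induction rule: rtranclp_induct)
  case (step M N)
  then obtain L' where "M = C + L'" "cstep\<^sup>*\<^sup>* L L'" by blast
  then show ?case using cstep_constants[of C L' N] step(2) assms(2) by (metis rtranclp.simps)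
qed auto

lemma cstep_union: "cstep M N \<Longrightarrow> cstep (M + P) (N + P)"
proof (induction rule: cstep.induct)
  case (1 f g R)
  have "cstep ((R + P) + {#f, g#}) ((R + P) + {#inf f g, sup f g#})"
    using 1 by (rule cstep.intros)
  then show ?case by (simp add: ac_simps)
qed

lemma csteps_union: "cstep\<^sup>*\<^sup>* M N \<Longrightarrow> cstep\<^sup>*\<^sup>* (M + P) (N + P)"
  by (induction rule: rtranclp_induct) (auto intro: cstep_union rtranclp.rtrancl_into_rtrancl)

lemma cstep_realize:
  assumes "cstep (mset v) N"
  shows "\<exists>e\<in>{..<length v} \<times> {..<length v}. mset (fgate e v) = N"
  using assms
proof cases
  case (1 f g R)
  have "f \<in># mset v" using 1 by simp
  then obtain i where i: "i < length v" "v ! i = f" by (metis in_set_conv_nth set_mset_mset)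
  have "g \<in># mset v" using 1 by simp
  then obtain j where j: "j < length v" "v ! j = g" by (metis in_set_conv_nth set_mset_mset)
  have "i \<noteq> j" using i j 1(3) by auto
  then obtain R' where R': "mset v = R' + {#v ! i, v ! j#}"
    "mset (fgate (i, j) v) = R' + {#inf (v ! i) (v ! j), sup (v ! i) (v ! j)#}"
    using mset_fgate i(1) j(1) by blast
  then have "R' = R" using 1 i j by simp
  then show ?thesis using R' 1 i j by (intro bexI[of _ "(i, j)"]) auto
qed

text \<open>The way back from multisets to gate lists, now with only as many gates as there are
  steps; short gate lists are what can be counted.\<close>

lemma csteps_realize:
  assumes "(cstep ^^ i) (mset v) N"
  shows "\<exists>gs. length gs = i \<and> set gs \<subseteq> {..<length v} \<times> {..<length v} \<and> mset (fold fgate gs v) = N"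
  using assms
proof (induction i arbitrary: N)
  case (Suc i)
  then obtain N' where N': "(cstep ^^ i) (mset v) N'" "cstep N' N" by auto
  then obtain gs where gs: "length gs = i" "set gs \<subseteq> {..<length v} \<times> {..<length v}"
    "mset (fold fgate gs v) = N'" using Suc.IH by blast
  obtain e where "e \<in> {..<length v} \<times> {..<length v}" "mset (fgate e (fold fgate gs v)) = N"
    using cstep_realize[of "fold fgate gs v" N] N'(2) gs(3) by auto
  then show ?case using gs by (intro exI[of _ "gs @ [e]"]) auto
qed simp

section \<open>Counting the functions of small networks\<close>

lemma card_surj_le:
  assumes "finite A" "B \<subseteq> f ` A"
  shows "card B \<le> card A"
  by (rule order_trans[OF card_mono[OF finite_imageI[OF assms(1)] assms(2)] card_image_le[OF assms(1)]])

text \<open>The numbers of wires and gates are exact, so that members are indexed by lists of fixed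
  lengths. A pair \<open>(i, i)\<close> is allowed and acts as an idle gate, which pads shorter gate
  lists.\<close>

definition network_class :: "nat \<Rightarrow> 'b::lattice set \<Rightarrow> 'b set" where
  "network_class w J = {fold fgate gs v ! out | v gs out.
     length v = w \<and> set v \<subseteq> J \<and> length gs = w * w \<and> set gs \<subseteq> {..<w} \<times> {..<w} \<and> out < w}"

lemma network_class_image:
  "network_class w J \<subseteq> (\<lambda>(v, gs, out). fold fgate gs v ! out) `
     ({v. set v \<subseteq> J \<and> length v = w} \<times>
      {gs. set gs \<subseteq> {..<w} \<times> {..<w} \<and> length gs = w * w} \<times> {..<w})"
proof
  fix f assume "f \<in> network_class w J"
  then obtain v gs out where *: "f = fold fgate gs v ! out" "length v = w" "set v \<subseteq> J"
      "length gs = w * w" "set gs \<subseteq> {..<w} \<times> {..<w}" "out < w"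
    unfolding network_class_def by blast
  show "f \<in> (\<lambda>(v, gs, out). fold fgate gs v ! out) `
     ({v. set v \<subseteq> J \<and> length v = w} \<times>
      {gs. set gs \<subseteq> {..<w} \<times> {..<w} \<and> length gs = w * w} \<times> {..<w})"
    by (rule image_eqI[of _ _ "(v, gs, out)"]) (use * in simp_all)
qed

lemma
  assumes "finite J"
  shows finite_network_class: "finite (network_class w J)"
    and card_network_class: "card (network_class w J) \<le> card J ^ w * ((w * w) ^ (w * w) * w)"
proof -
  let ?A = "{v. set v \<subseteq> J \<and> length v = w} \<times>
      {gs. set gs \<subseteq> {..<w} \<times> {..<w} \<and> length gs = w * w} \<times> {..<w}"
  have fin: "finite ?A"
    by (intro finite_cartesian_product finite_lists_length_eq finite_lessThan assms)
  have card_eq: "card ?A = card J ^ w * ((w * w) ^ (w * w) * w)"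
  proof -
    have "card {gs. set gs \<subseteq> {..<w} \<times> {..<w} \<and> length gs = w * w} = card ({..<w} \<times> {..<w}) ^ (w * w)"
      by (rule card_lists_length_eq) blast
    with card_lists_length_eq[OF assms, of w] show ?thesis
      by (metis card_cartesian_product card_lessThan)
  qed
  show "finite (network_class w J)"
    by (rule finite_surj[OF fin network_class_image])
  show "card (network_class w J) \<le> card J ^ w * ((w * w) ^ (w * w) * w)"
    by (rule card_surj_le[OF fin network_class_image, unfolded card_eq])
qed

lemma funpow_fgate_idle: "(fgate (i, i) ^^ k) v = v"
  by (induction k) auto

text \<open>Constants never take part in a step, so all steps happen inside \<open>L\<close>, and
  the potential allows at most \<open>w * w\<close> of them. The resulting class depends neither on
  the length of \<open>gs\<close> nor on the number of constant wires.\<close>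

lemma network_class_I:
  fixes vs :: "'b::bounded_lattice list"
  assumes gs: "\<forall>(i, j)\<in>set gs. i < length vs \<and> j < length vs \<and> i \<noteq> j"
    and out: "out < length vs"
    and vs: "mset vs = C + L" "\<forall>x\<in>#C. x = bot \<or> x = top" "set_mset L \<subseteq> J" "size L \<le> w"
    and J: "bot \<in> J" "top \<in> J" "0 < w"
  shows "fold fgate gs vs ! out \<in> network_class w J"
proof -
  define y where "y = fold fgate gs vs ! out"
  have "cstep\<^sup>*\<^sup>* (C + L) (mset (fold fgate gs vs))"
    using fold_fgate_reach[OF gs] vs(1) by simp
  then obtain L' where L': "mset (fold fgate gs vs) = C + L'" "cstep\<^sup>*\<^sup>* L L'"
    using csteps_constants[OF _ vs(2)] by blast
  have "y \<in># mset (fold fgate gs vs)" using out by (simp add: y_def)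
  then consider "y \<in># C" | "y \<in># L'" using L'(1) by auto
  then have "y \<in> network_class w J"
  proof cases
    case 1
    then have "y \<in> J" using vs(2) J by auto
    moreover have "fold fgate (replicate (w * w) (0, 0)) (replicate w y) ! 0 = y"
      using J by (simp add: funpow_fgate_idle)
    ultimately show ?thesis unfolding network_class_def using J
      by (intro CollectI exI[of _ "replicate w y"] exI[of _ "replicate (w * w) (0, 0)"] exI[of _ 0]) auto
  next
    case 2
    \<comment> \<open>Copies of \<open>bot\<close> bring the live wires up to exactly
      \<open>w\<close>; by \<open>csteps_union\<close> they ride along unchanged.\<close>
    define P where "P = replicate_mset (w - size L) (bot :: 'b)"
    obtain v where v: "mset v = L + P" using ex_mset by blast
    have len: "length v = w" using vs(4) arg_cong[OF v, of size] by (simp add: P_def)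
    have "set_mset (mset v) \<subseteq> J" unfolding v using vs(3) J by (auto simp: P_def split: if_splits)
    then have "set v \<subseteq> J" by simp
    obtain i where i: "(cstep ^^ i) (mset v) (L' + P)"
      using csteps_union[OF L'(2), of P] v by (metis rtranclp_imp_relpowp)
    then obtain gs' where gs': "length gs' = i" "set gs' \<subseteq> {..<w} \<times> {..<w}"
      "mset (fold fgate gs' v) = L' + P" using csteps_realize len by blast
    have "i \<le> w * w"
      using cstep_steps[OF i] incomp_pairs_le[of "mset v"] len by simp
    have "y \<in># mset (fold fgate gs' v)" using gs'(3) 2 by simp
    then obtain o' where o': "o' < w" "fold fgate gs' v ! o' = y"
      by (metis in_set_conv_nth len length_fold_fgate set_mset_mset)
    have "fold fgate (replicate (w * w - i) (0, 0) @ gs') v ! o' = y"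
      using o' by (simp add: funpow_fgate_idle)
    then show ?thesis unfolding network_class_def using \<open>i \<le> w * w\<close> gs' len o' \<open>set v \<subseteq> J\<close> J
      by (intro CollectI exI[of _ v] exI[of _ "replicate (w * w - i) (0, 0) @ gs'"] exI[of _ o']) auto
  qed
  then show ?thesis by (simp add: y_def)
qed

section \<open>Comparator circuits with functions substituted for the variables\<close>

lemma eval_comparator_fold:
  fixes x :: "'u \<Rightarrow> bool list"
  assumes "wf_comparator_circuit n C"
  shows "eval_comparator C (x u) =
    (fold fgate (cgates C) (map (\<lambda>lit u. lit_val (x u) lit) (wire_labels C)) ! output_wire C) u"
proof -
  \<comment> \<open>Wires now carry Boolean functions of the free bits \<open>u\<close>. The lattice
    of such functions is pointwise, so the two outputs of a gate become \<open>inf\<close> and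
    \<open>sup\<close>.\<close>
  have "fold apply_cgate gs (map (\<lambda>f. f u) v) = map (\<lambda>f. f u) (fold fgate gs v)"
    if "\<forall>(i, j)\<in>set gs. i < length v \<and> j < length v" for gs and v :: "('u \<Rightarrow> bool) list"
    using that
  proof (induction gs arbitrary: v)
    case (Cons e gs)
    obtain i j where e: "e = (i, j)" by (cases e)
    have "apply_cgate e (map (\<lambda>f. f u) v) = map (\<lambda>f. f u) (fgate e v)"
      using Cons.prems by (simp add: e map_update)
    then show ?case using Cons by simp
  qed simp
  from this[of "cgates C" "map (\<lambda>lit u. lit_val (x u) lit) (wire_labels C)"]
  show ?thesis
    using assms
    by (auto simp: eval_comparator_def wf_comparator_circuit_def num_wires_def comp_def case_prod_beta)
qed

definition live_wires :: "comparator_circuit \<Rightarrow> nat set \<Rightarrow> nat" where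
  "live_wires C B = length (filter (\<lambda>lit. lit_var lit \<in> B) (wire_labels C))"

text \<open>Only wires labelled from \<open>B\<close> can carry a non-constant function. Closure of
  \<open>J\<close> under complement accounts for negated literals.\<close>

lemma eval_comparator_network:
  fixes Z :: "nat \<Rightarrow> 'u \<Rightarrow> bool"
  assumes wf: "wf_comparator_circuit n C"
    and J: "bot \<in> J" "top \<in> J" "\<And>f. f \<in> J \<Longrightarrow> - f \<in> J"
    and Z: "\<And>j. j < n \<Longrightarrow> Z j \<in> J" "\<And>j. j < n \<Longrightarrow> j \<notin> B \<Longrightarrow> Z j = bot \<or> Z j = top"
    and w: "live_wires C B \<le> w" "0 < w"
  shows "(\<lambda>u. eval_comparator C (map (\<lambda>j. Z j u) [0..<n])) \<in> network_class w J"
proof -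
  define wire where "wire = (\<lambda>lit u. lit_val (map (\<lambda>j. Z j u) [0..<n]) lit)"
  have wire: "wire lit = Z (lit_var lit) \<or> wire lit = - Z (lit_var lit)" if "lit_var lit < n" for lit
    using that by (cases lit) (auto simp: wire_def fun_eq_iff)
  have labels: "lit_var lit < n" if "lit \<in> set (wire_labels C)" for lit
    using that wf by (auto simp: wf_comparator_circuit_def)
  have "fold fgate (cgates C) (map wire (wire_labels C)) ! output_wire C \<in> network_class w J"
  proof (rule network_class_I)
    show "mset (map wire (wire_labels C))
        = image_mset wire (filter_mset (\<lambda>lit. lit_var lit \<notin> B) (mset (wire_labels C)))
        + image_mset wire (filter_mset (\<lambda>lit. lit_var lit \<in> B) (mset (wire_labels C)))"
      by (simp add: image_mset_union[symmetric] multiset_partition[symmetric] add.commute)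
    show "\<forall>x\<in>#image_mset wire (filter_mset (\<lambda>lit. lit_var lit \<notin> B) (mset (wire_labels C))). x = bot \<or> x = top"
    proof
      fix x assume "x \<in># image_mset wire (filter_mset (\<lambda>lit. lit_var lit \<notin> B) (mset (wire_labels C)))"
      then obtain lit where "x = wire lit" "lit_var lit < n" "lit_var lit \<notin> B"
        using labels by auto
      then show "x = bot \<or> x = top" using wire[of lit] Z(2)[of "lit_var lit"] by auto
    qed
    show "set_mset (image_mset wire (filter_mset (\<lambda>lit. lit_var lit \<in> B) (mset (wire_labels C)))) \<subseteq> J"
    proof
      fix x assume "x \<in># image_mset wire (filter_mset (\<lambda>lit. lit_var lit \<in> B) (mset (wire_labels C)))"
      then obtain lit where "x = wire lit" "lit_var lit < n"
        using labels by auto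
      then show "x \<in> J" using wire[of lit] Z(1)[of "lit_var lit"] J(3) by auto
    qed
    show "size (image_mset wire (filter_mset (\<lambda>lit. lit_var lit \<in> B) (mset (wire_labels C)))) \<le> w"
      using w by (simp add: live_wires_def flip: mset_filter)
  qed (use wf J w in \<open>auto simp: wf_comparator_circuit_def num_wires_def\<close>)
  also have "fold fgate (cgates C) (map wire (wire_labels C)) ! output_wire C
      = (\<lambda>u. eval_comparator C (map (\<lambda>j. Z j u) [0..<n]))"
    unfolding wire_def by (rule ext) (rule eval_comparator_fold[OF wf, symmetric])
  finally show ?thesis .
qed

text \<open>Query the \<open>k\<close> functions \<open>ys\<close>, then evaluate the member of
  \<open>F\<close> selected by the answers: a decision tree of depth \<open>k\<close> with leaves in
  \<open>F\<close>. Selectors are extensional so that there are finitely many of them.\<close>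

definition branching_class ::
    "nat \<Rightarrow> ('u \<Rightarrow> bool) set \<Rightarrow> ('u \<Rightarrow> bool) set \<Rightarrow> ('u \<Rightarrow> bool) set" where
  "branching_class k F J = {\<lambda>u. \<phi> (map (\<lambda>y. y u) ys) u | ys \<phi>.
     set ys \<subseteq> J \<and> length ys = k \<and> \<phi> \<in> bitstrings k \<rightarrow>\<^sub>E F}"

lemma
  assumes "finite J" "finite F"
  shows finite_branching_class: "finite (branching_class k F J)"
    and card_branching_class: "card (branching_class k F J) \<le> card J ^ k * card F ^ (2 ^ k)"
proof -
  let ?A = "{ys. set ys \<subseteq> J \<and> length ys = k} \<times> (bitstrings k \<rightarrow>\<^sub>E F)"
  have fin: "finite ?A"
    by (rule finite_cartesian_product[OF finite_lists_length_eq[OF assms(1)]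
          finite_PiE[OF finite_bitstrings assms(2)]])
  have card_eq: "card ?A = card J ^ k * card F ^ (2 ^ k)"
  proof -
    have "card (bitstrings k \<rightarrow>\<^sub>E F) = card F ^ 2 ^ k"
      unfolding card_PiE[OF finite_bitstrings] prod_constant card_bitstrings ..
    then show ?thesis
      by (subst card_cartesian_product) (simp only: card_lists_length_eq[OF assms(1)])
  qed
  have sub: "branching_class k F J \<subseteq> (\<lambda>(ys, \<phi>) u. \<phi> (map (\<lambda>y. y u) ys) u) ` ?A"
  proof
    fix f assume "f \<in> branching_class k F J"
    then obtain ys \<phi> where *: "f = (\<lambda>u. \<phi> (map (\<lambda>y. y u) ys) u)" "set ys \<subseteq> J" "length ys = k"
        "\<phi> \<in> bitstrings k \<rightarrow>\<^sub>E F"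
      unfolding branching_class_def by blast
    show "f \<in> (\<lambda>(ys, \<phi>) u. \<phi> (map (\<lambda>y. y u) ys) u) ` ?A"
      by (rule image_eqI[of _ _ "(ys, \<phi>)"]) (use * in simp_all)
  qed
  show "finite (branching_class k F J)"
    by (rule finite_surj[OF fin sub])
  show "card (branching_class k F J) \<le> card J ^ k * card F ^ (2 ^ k)"
    by (rule card_surj_le[OF fin sub, unfolded card_eq])
qed

text \<open>Under each fixed assignment to \<open>A\<close> the variables in \<open>A\<close> are
  constants, so the restricted circuit is a network on the wires live for \<open>B - A\<close>; the
  true values of these variables select the assignment. A variable labelling many wires thus costs
  one query instead of many live wires.\<close>

lemma eval_comparator_branching:
  fixes Y :: "nat \<Rightarrow> 'u \<Rightarrow> bool"
  assumes wf: "wf_comparator_circuit n C"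
    and J: "bot \<in> J" "top \<in> J" "\<And>f. f \<in> J \<Longrightarrow> - f \<in> J"
    and Y: "\<And>j. j < n \<Longrightarrow> Y j \<in> J" "\<And>j. j < n \<Longrightarrow> j \<notin> B \<Longrightarrow> Y j = bot \<or> Y j = top"
    and A: "A \<subseteq> {..<n}" "card A \<le> k"
    and w: "live_wires C (B - A) \<le> w" "0 < w"
  shows "(\<lambda>u. eval_comparator C (map (\<lambda>j. Y j u) [0..<n])) \<in> branching_class k (network_class w J) J"
proof -
  have "finite A" using A(1) finite_subset by blast
  then obtain ls where ls: "set ls = A" "distinct ls" using finite_distinct_list by blast
  have len: "length ls \<le> k" using ls A(2) distinct_card by fastforce
  \<comment> \<open>Fewer than \<open>k\<close> queries are padded by \<open>bot\<close>; the dummy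
    answers are never read, because \<open>pos j < length ls\<close>.\<close>
  define ys where "ys = map Y ls @ replicate (k - length ls) bot"
  define pos where "pos = (\<lambda>j. SOME i. i < length ls \<and> ls ! i = j)"
  have pos: "pos j < length ls" "ls ! pos j = j" if "j \<in> A" for j
  proof -
    have "\<exists>i. i < length ls \<and> ls ! i = j"
      using that ls(1) by (auto simp: in_set_conv_nth)
    from someI_ex[OF this] show "pos j < length ls" "ls ! pos j = j"
      by (simp_all add: pos_def)
  qed
  define \<phi> where "\<phi> = (\<lambda>\<alpha>\<in>bitstrings k. \<lambda>u.
    eval_comparator C (map (\<lambda>j. if j \<in> A then \<alpha> ! pos j else Y j u) [0..<n]))"
  have "\<phi> \<in> bitstrings k \<rightarrow>\<^sub>E network_class w J"
  proof (rule PiE_I)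
    fix \<alpha> :: "bool list" assume "\<alpha> \<in> bitstrings k"
    define Z where "Z = (\<lambda>j u. if j \<in> A then \<alpha> ! pos j else Y j u)"
    have const: "Z j = bot \<or> Z j = top" if "j \<in> A" for j
      using that by (cases "\<alpha> ! pos j") (auto simp: Z_def fun_eq_iff)
    have Y_eq: "Z j = Y j" if "j \<notin> A" for j
      using that by (simp add: Z_def)
    have "(\<lambda>u. eval_comparator C (map (\<lambda>j. Z j u) [0..<n])) \<in> network_class w J"
    proof (rule eval_comparator_network[OF wf J _ _ w])
      show "Z j \<in> J" if "j < n" for j
        using const[of j] J(1,2) Y(1)[OF that] Y_eq[of j] by metis
      show "Z j = bot \<or> Z j = top" if "j < n" "j \<notin> B - A" for j
        using const[of j] Y(2)[OF that(1)] that(2) Y_eq[of j] by (metis DiffI)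
    qed
    then show "\<phi> \<alpha> \<in> network_class w J"
      using \<open>\<alpha> \<in> bitstrings k\<close> by (simp add: \<phi>_def Z_def)
  qed (simp add: \<phi>_def)
  moreover have "set ys \<subseteq> J" "length ys = k"
    using ls A Y(1) J len by (auto simp: ys_def split: if_splits)
  moreover have "eval_comparator C (map (\<lambda>j. Y j u) [0..<n]) = \<phi> (map (\<lambda>y. y u) ys) u" for u
  proof -
    have "map (\<lambda>y. y u) ys ! pos j = Y j u" if "j \<in> A" for j
      using pos[OF that] by (simp add: ys_def nth_append)
    then have "map (\<lambda>j. Y j u) [0..<n] =
        map (\<lambda>j. if j \<in> A then map (\<lambda>y. y u) ys ! pos j else Y j u) [0..<n]"
      by (intro map_cong) auto
    also have "eval_comparator C \<dots> = \<phi> (map (\<lambda>y. y u) ys) u"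
      using \<open>length ys = k\<close> by (subst \<phi>_def) (simp only: restrict_apply' mem_bitstrings length_map)
    finally show ?thesis .
  qed
  ultimately show ?thesis
    unfolding branching_class_def by (intro CollectI exI[of _ ys] exI[of _ \<phi>] conjI ext)
qed

section \<open>Functions of few bits\<close>

definition juntas :: "nat \<Rightarrow> nat \<Rightarrow> (bool list \<Rightarrow> bool) set" where
  "juntas s a = {\<lambda>u. map ((!) u) is \<in> S | is S. set is \<subseteq> {..<s} \<and> length is = a \<and> S \<subseteq> bitstrings a}"

lemma
  shows finite_juntas: "finite (juntas s a)"
    and card_juntas: "card (juntas s a) \<le> s ^ a * 2 ^ (2 ^ a)"
proof -
  let ?A = "{is. set is \<subseteq> {..<s} \<and> length is = a} \<times> Pow (bitstrings a)"
  have fin: "finite ?A"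
    by (rule finite_cartesian_product[OF finite_lists_length_eq[OF finite_lessThan]
          finite_Pow_iff[THEN iffD2, OF finite_bitstrings]])
  have card_eq: "card ?A = s ^ a * 2 ^ (2 ^ a)"
    by (subst card_cartesian_product)
      (simp only: card_lists_length_eq[OF finite_lessThan] card_Pow[OF finite_bitstrings]
        card_bitstrings card_lessThan)
  have sub: "juntas s a \<subseteq> (\<lambda>(is, S) u. map ((!) u) is \<in> S) ` ?A"
  proof
    fix f assume "f \<in> juntas s a"
    then obtain "is" S where *: "f = (\<lambda>u. map ((!) u) is \<in> S)" "set is \<subseteq> {..<s}"
        "length is = a" "S \<subseteq> bitstrings a"
      unfolding juntas_def by blast
    show "f \<in> (\<lambda>(is, S) u. map ((!) u) is \<in> S) ` ?A"
      by (rule image_eqI[of _ _ "(is, S)"]) (use * in simp_all)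
  qed
  show "finite (juntas s a)"
    by (rule finite_surj[OF fin sub])
  show "card (juntas s a) \<le> s ^ a * 2 ^ (2 ^ a)"
    by (rule card_surj_le[OF fin sub, unfolded card_eq])
qed

lemma juntas_I:
  assumes "set is \<subseteq> {..<s}" "length is = a" "S \<subseteq> bitstrings a"
  shows "(\<lambda>u. map ((!) u) is \<in> S) \<in> juntas s a"
  unfolding juntas_def using assms by (intro CollectI exI conjI) (rule refl)

lemma juntas_const:
  assumes "0 < s"
  shows "(\<lambda>_. b) \<in> juntas s a"
proof -
  have "set (replicate a 0) \<subseteq> {..<s}" using assms by (simp add: set_replicate_conv_if)
  then have "(\<lambda>u. map ((!) u) (replicate a 0) \<in> (if b then bitstrings a else {})) \<in> juntas s a"
    by (intro juntas_I) simp_all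
  moreover have "(\<lambda>u :: bool list. map ((!) u) (replicate a 0) \<in> (if b then bitstrings a else {})) = (\<lambda>_. b)"
    by (cases b) simp_all
  ultimately show ?thesis by (simp only:)
qed

lemma juntas_compl: "f \<in> juntas s a \<Longrightarrow> - f \<in> juntas s a"
proof -
  assume "f \<in> juntas s a"
  then obtain "is" S where "f = (\<lambda>u. map ((!) u) is \<in> S)" "set is \<subseteq> {..<s}" "length is = a"
    "S \<subseteq> bitstrings a" by (auto simp: juntas_def)
  moreover from this have "(\<lambda>u. map ((!) u) is \<in> bitstrings a - S) \<in> juntas s a"
    by (intro juntas_I) blast+
  moreover have "- f = (\<lambda>u. map ((!) u) is \<in> bitstrings a - S)"
    using calculation by (simp add: fun_eq_iff)
  ultimately show ?thesis by (simp only:)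
qed

text \<open>The accepted patterns are read off from the accepted strings, and \<open>dep\<close>
  makes this consistent. Agreement is claimed on strings of length \<open>s\<close> only, since
  nothing is known about the values of \<open>f\<close> on other lists.\<close>

lemma juntas_approx:
  assumes "0 < s" "B \<subseteq> {..<s}" "card B \<le> a"
    and dep: "\<And>u u'. length u = s \<Longrightarrow> length u' = s \<Longrightarrow> (\<And>b. b \<in> B \<Longrightarrow> u ! b = u' ! b) \<Longrightarrow> f u = f u'"
  shows "\<exists>g\<in>juntas s a. \<forall>u. length u = s \<longrightarrow> g u = f u"
proof -
  have "finite B" using assms(2) finite_subset by blast
  then obtain ls where ls: "set ls = B" "distinct ls" using finite_distinct_list by blast
  have len: "length ls \<le> a" using ls assms(3) distinct_card by fastforce
  \<comment> \<open>The padding index 0 is in range because \<open>0 < s\<close>.\<close>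
  define "is" where "is = ls @ replicate (a - length ls) 0"
  define S where "S = {map ((!) u) is | u. length u = s \<and> f u}"
  have len_is: "length is = a" using len by (simp add: is_def)
  have S: "map ((!) u) is \<in> S \<longleftrightarrow> f u" if u: "length u = s" for u
  proof
    assume "map ((!) u) is \<in> S"
    then obtain u' where u': "length u' = s" "f u'" "map ((!) u) is = map ((!) u') is"
      unfolding S_def by blast
    have "u ! b = u' ! b" if "b \<in> B" for b
    proof -
      have "b \<in> set is" using that ls by (simp add: is_def)
      then show ?thesis using u'(3) map_eq_conv[of "(!) u" "is" "(!) u'"] by blast
    qed
    then show "f u" using dep[OF u u'(1)] u'(2) by blast
  next
    assume "f u"
    then show "map ((!) u) is \<in> S" unfolding S_def using u by blast
  qed
  show ?thesis
  proof (rule bexI)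
    show "\<forall>u. length u = s \<longrightarrow> (map ((!) u) is \<in> S) = f u"
      using S by blast
    show "(\<lambda>u. map ((!) u) is \<in> S) \<in> juntas s a"
    proof (rule juntas_I[OF _ len_is])
      show "set is \<subseteq> {..<s}"
        using ls(1) assms(1,2) unfolding is_def by (auto split: if_splits)
      show "S \<subseteq> bitstrings a"
        unfolding S_def using len_is by auto
    qed
  qed
qed


section \<open>Composition of Boolean circuits\<close>

definition run_gates :: "bgate list \<Rightarrow> bool list \<Rightarrow> bool list" where
  "run_gates gs x = fold (\<lambda>g v. v @ [bgate_val v g]) gs x"

definition wf_gates :: "nat \<Rightarrow> bgate list \<Rightarrow> bool" where
  "wf_gates m gs \<longleftrightarrow> (\<forall>k<length gs. \<forall>i\<in>bgate_preds (gs ! k). i < m + k)"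

lemma run_gates_Nil [simp]: "run_gates [] x = x"
  by (simp add: run_gates_def)

lemma run_gates_append: "run_gates (gs @ hs) x = run_gates hs (run_gates gs x)"
  by (simp add: run_gates_def)

lemma run_gates_snoc: "run_gates (gs @ [g]) x = run_gates gs x @ [bgate_val (run_gates gs x) g]"
  by (simp add: run_gates_def)

lemma length_run_gates [simp]: "length (run_gates gs x) = length x + length gs"
  by (induction gs rule: rev_induct) (simp_all add: run_gates_snoc)

lemma run_gates_prefix: "i < length x \<Longrightarrow> run_gates gs x ! i = x ! i"
  by (induction gs rule: rev_induct) (simp_all add: run_gates_snoc nth_append)

lemma wf_gates_snoc: "wf_gates m (gs @ [g]) \<longleftrightarrow>
    wf_gates m gs \<and> (\<forall>i\<in>bgate_preds g. i < m + length gs)"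
  by (auto simp: wf_gates_def nth_append less_Suc_eq)

primrec rename_gate :: "(nat \<Rightarrow> nat) \<Rightarrow> bgate \<Rightarrow> bgate" where
  "rename_gate \<rho> (Const_gate b) = Const_gate b"
| "rename_gate \<rho> (Not_gate i) = Not_gate (\<rho> i)"
| "rename_gate \<rho> (And_gate i j) = And_gate (\<rho> i) (\<rho> j)"
| "rename_gate \<rho> (Or_gate i j) = Or_gate (\<rho> i) (\<rho> j)"

lemma bgate_preds_rename: "bgate_preds (rename_gate \<rho> g) = \<rho> ` bgate_preds g"
  by (cases g) auto

lemma bgate_val_rename:
  "(\<And>i. i \<in> bgate_preds g \<Longrightarrow> v ! \<rho> i = x ! i) \<Longrightarrow> bgate_val v (rename_gate \<rho> g) = bgate_val x g"
  by (cases g) auto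

text \<open>A gate list is relocated behind the values \<open>v\<close>: \<open>\<rho>\<close> sends
  its inputs to nodes of \<open>v\<close> carrying the same values, and its gates to the places
  where they are appended.\<close>

lemma run_gates_rename:
  assumes "wf_gates (length x) hs"
    and "\<And>i. i < length x \<Longrightarrow> \<rho> i < length v \<and> v ! \<rho> i = x ! i"
    and "\<And>i. i < length hs \<Longrightarrow> \<rho> (length x + i) = length v + i"
  shows "run_gates (map (rename_gate \<rho>) hs) v = v @ drop (length x) (run_gates hs x)"
  using assms(1,3)
proof (induction hs rule: rev_induct)
  case (snoc h hs)
  have IH: "run_gates (map (rename_gate \<rho>) hs) v = v @ drop (length x) (run_gates hs x)"
    using snoc by (simp add: wf_gates_snoc)
  have "bgate_val (v @ drop (length x) (run_gates hs x)) (rename_gate \<rho> h) = bgate_val (run_gates hs x) h"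
  proof (rule bgate_val_rename)
    fix i assume i: "i \<in> bgate_preds h"
    show "(v @ drop (length x) (run_gates hs x)) ! \<rho> i = run_gates hs x ! i"
    proof (cases "i < length x")
      case True
      then show ?thesis using assms(2)[OF True] by (simp add: nth_append run_gates_prefix)
    next
      case False
      then obtain d where d: "i = length x + d" using le_Suc_ex not_less by blast
      have "d < length hs" using snoc.prems(1) i d by (auto simp: wf_gates_snoc)
      then show ?thesis using snoc.prems(2)[of d] d by (simp add: nth_append)
    qed
  qed
  then show ?case using IH by (simp add: run_gates_snoc)
qed simp

text \<open>The gate list is hidden behind an upper bound \<open>k\<close> on its length, so that
  costs add up under composition and can be rounded up freely.\<close>

definition circuits_compute :: "nat \<Rightarrow> nat \<Rightarrow> (bool list \<Rightarrow> bool) list \<Rightarrow> bool" where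
  "circuits_compute m k fs \<longleftrightarrow> (\<exists>gs outs. length gs \<le> k \<and> wf_gates m gs \<and> length outs = length fs \<and>
     (\<forall>out\<in>set outs. out < m + length gs) \<and>
     (\<forall>x. length x = m \<longrightarrow> map ((!) (run_gates gs x)) outs = map (\<lambda>f. f x) fs))"

text \<open>The second circuit reads the outputs of the first one (composition) or its inputs
  (juxtaposition); both are instances of appending a renamed gate list.\<close>

lemma append_gates:
  assumes gs: "wf_gates m gs" and hs: "wf_gates (length sel) hs"
    and sel: "\<forall>i\<in>set sel. i < m + length gs"
    and houts: "\<forall>out\<in>set houts. out < length sel + length hs"
  shows "\<exists>gs' outs'. length gs' = length gs + length hs \<and> wf_gates m gs' \<and> length outs' = length houts \<and>
     (\<forall>out\<in>set outs'. out < m + length gs') \<and>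
     (\<forall>x. length x = m \<longrightarrow> (\<forall>i < m + length gs. run_gates gs' x ! i = run_gates gs x ! i) \<and>
        map ((!) (run_gates gs' x)) outs' =
        map ((!) (run_gates hs (map ((!) (run_gates gs x)) sel))) houts)"
proof -
  define p where "p = length sel"
  define \<rho> where "\<rho> = (\<lambda>i. if i < p then sel ! i else m + length gs + (i - p))"
  define gs' where "gs' = gs @ map (rename_gate \<rho>) hs"
  have \<rho>: "\<rho> i < m + length gs + d" if "i < p + d" for i d
    using that sel by (auto simp: \<rho>_def p_def less_diff_conv2 intro: trans_less_add1)
  have "wf_gates m gs'"
    unfolding wf_gates_def
  proof (intro allI impI ballI)
    fix k i assume k: "k < length gs'" and i: "i \<in> bgate_preds (gs' ! k)"
    show "i < m + k"
    proof (cases "k < length gs")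
      case True
      then show ?thesis using gs i by (simp add: gs'_def nth_append wf_gates_def)
    next
      case False
      define d where "d = k - length gs"
      have d: "d < length hs" "k = length gs + d" using False k by (auto simp: gs'_def d_def)
      then have "i \<in> \<rho> ` bgate_preds (hs ! d)"
        using i by (simp add: gs'_def nth_append bgate_preds_rename)
      then obtain i' where "i = \<rho> i'" "i' < p + d" using hs d by (auto simp: wf_gates_def p_def)
      then show ?thesis using \<rho>[of i' d] d by simp
    qed
  qed
  moreover have "\<forall>out\<in>set (map \<rho> houts). out < m + length gs'"
    using houts \<rho>[of _ "length hs"] by (auto simp: gs'_def p_def add.assoc)
  moreover have "(\<forall>i < m + length gs. run_gates gs' x ! i = run_gates gs x ! i) \<and>
      map ((!) (run_gates gs' x)) (map \<rho> houts) =
        map ((!) (run_gates hs (map ((!) (run_gates gs x)) sel))) houts" if "length x = m" for x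
  proof -
    define v where "v = run_gates gs x"
    define y where "y = map ((!) v) sel"
    have lens: "length v = m + length gs" "length y = p" using that by (auto simp: v_def y_def p_def)
    have "run_gates gs' x = run_gates (map (rename_gate \<rho>) hs) v"
      by (simp add: gs'_def run_gates_append v_def)
    also have "\<dots> = v @ drop (length y) (run_gates hs y)"
    proof (rule run_gates_rename)
      show "wf_gates (length y) hs" using hs lens by (simp add: p_def)
      show "\<rho> i < length v \<and> v ! \<rho> i = y ! i" if "i < length y" for i
        using that sel lens by (simp add: \<rho>_def y_def p_def)
      show "\<rho> (length y + i) = length v + i" for i
        using lens by (simp add: \<rho>_def)
    qed
    finally have R: "run_gates gs' x = v @ drop p (run_gates hs y)" using lens by simp
    have "(v @ drop p (run_gates hs y)) ! \<rho> i = run_gates hs y ! i" if "i < p + length hs" for i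
    proof (cases "i < p")
      case True
      then show ?thesis using sel lens
        by (simp add: \<rho>_def nth_append p_def run_gates_prefix) (simp add: y_def)
    next
      case False
      then obtain d where "i = p + d" using le_Suc_ex not_less by blast
      then show ?thesis using that lens by (simp add: \<rho>_def nth_append)
    qed
    then show ?thesis using houts R lens by (simp add: nth_append v_def y_def p_def)
  qed
  ultimately show ?thesis
    by (intro exI[of _ gs'] exI[of _ "map \<rho> houts"]) (simp add: gs'_def)
qed

lemma circuits_compute_comp:
  assumes "circuits_compute m k fs" "circuits_compute (length fs) k' hs"
  shows "circuits_compute m (k + k') (map (\<lambda>h x. h (map (\<lambda>f. f x) fs)) hs)"
proof -
  obtain gs outs where gs: "length gs \<le> k" "wf_gates m gs" "length outs = length fs"
    "\<forall>out\<in>set outs. out < m + length gs"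
    "\<And>x. length x = m \<Longrightarrow> map ((!) (run_gates gs x)) outs = map (\<lambda>f. f x) fs"
    using assms(1) unfolding circuits_compute_def by blast
  obtain gs2 outs2 where gs2: "length gs2 \<le> k'" "wf_gates (length fs) gs2" "length outs2 = length hs"
    "\<forall>out\<in>set outs2. out < length fs + length gs2"
    "\<And>x. length x = length fs \<Longrightarrow> map ((!) (run_gates gs2 x)) outs2 = map (\<lambda>f. f x) hs"
    using assms(2) unfolding circuits_compute_def by blast
  obtain gs' outs' where *: "length gs' = length gs + length gs2" "wf_gates m gs'" "length outs' = length outs2"
     "\<forall>out\<in>set outs'. out < m + length gs'"
     "\<And>x. length x = m \<Longrightarrow> map ((!) (run_gates gs' x)) outs' =
        map ((!) (run_gates gs2 (map ((!) (run_gates gs x)) outs))) outs2"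
    using append_gates[OF gs(2), of outs gs2 outs2] gs gs2 by metis
  show ?thesis unfolding circuits_compute_def
  proof (intro exI conjI allI impI)
    show "length gs' \<le> k + k'" using * gs gs2 by simp
    show "map ((!) (run_gates gs' x)) outs' = map (\<lambda>f. f x) (map (\<lambda>h x. h (map (\<lambda>f. f x) fs)) hs)"
      if "length x = m" for x
      using *(5)[OF that] gs(5)[OF that] gs2(5)[of "map (\<lambda>f. f x) fs"] by simp
  qed (use * gs2 in simp_all)
qed

lemma circuits_compute_append:
  assumes "circuits_compute m k fs" "circuits_compute m k' hs"
  shows "circuits_compute m (k + k') (fs @ hs)"
proof -
  obtain gs outs where gs: "length gs \<le> k" "wf_gates m gs" "length outs = length fs"
    "\<forall>out\<in>set outs. out < m + length gs"
    "\<And>x. length x = m \<Longrightarrow> map ((!) (run_gates gs x)) outs = map (\<lambda>f. f x) fs"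
    using assms(1) unfolding circuits_compute_def by blast
  obtain gs2 outs2 where gs2: "length gs2 \<le> k'" "wf_gates m gs2" "length outs2 = length hs"
    "\<forall>out\<in>set outs2. out < m + length gs2"
    "\<And>x. length x = m \<Longrightarrow> map ((!) (run_gates gs2 x)) outs2 = map (\<lambda>f. f x) hs"
    using assms(2) unfolding circuits_compute_def by blast
  have sel: "map ((!) (run_gates gs x)) [0..<m] = x" if "length x = m" for x
    using that by (intro nth_equalityI) (auto simp: run_gates_prefix)
  have "\<exists>gs' outs'. length gs' = length gs + length gs2 \<and> wf_gates m gs' \<and> length outs' = length outs2 \<and>
     (\<forall>out\<in>set outs'. out < m + length gs') \<and>
     (\<forall>x. length x = m \<longrightarrow> (\<forall>i < m + length gs. run_gates gs' x ! i = run_gates gs x ! i) \<and>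
        map ((!) (run_gates gs' x)) outs' =
        map ((!) (run_gates gs2 (map ((!) (run_gates gs x)) [0..<m]))) outs2)"
    by (rule append_gates) (use gs gs2 in auto)
  then obtain gs' outs' where *: "length gs' = length gs + length gs2" "wf_gates m gs'" "length outs' = length outs2"
     "\<forall>out\<in>set outs'. out < m + length gs'"
     "\<And>x i. length x = m \<Longrightarrow> i < m + length gs \<Longrightarrow> run_gates gs' x ! i = run_gates gs x ! i"
     "\<And>x. length x = m \<Longrightarrow> map ((!) (run_gates gs' x)) outs' =
        map ((!) (run_gates gs2 (map ((!) (run_gates gs x)) [0..<m]))) outs2"
    by metis
  show ?thesis unfolding circuits_compute_def
  proof (intro exI conjI allI impI)
    show "length gs' \<le> k + k'" using * gs gs2 by simp
    show "\<forall>out\<in>set (outs @ outs'). out < m + length gs'" using * gs by auto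
    show "map ((!) (run_gates gs' x)) (outs @ outs') = map (\<lambda>f. f x) (fs @ hs)"
      if "length x = m" for x
    proof -
      have "map ((!) (run_gates gs' x)) outs = map ((!) (run_gates gs x)) outs"
        by (rule map_cong) (use *(5)[OF that] gs(4) in simp_all)
      then show ?thesis using *(6)[OF that] gs(5)[OF that] gs2(5)[OF that] sel[OF that] by simp
    qed
  qed (use * gs gs2 in simp_all)
qed

definition circuit_computes :: "nat \<Rightarrow> nat \<Rightarrow> (bool list \<Rightarrow> bool) \<Rightarrow> bool" where
  "circuit_computes m k f \<longleftrightarrow> circuits_compute m k [f]"

lemma circuit_computes_mono: "circuit_computes m k f \<Longrightarrow> k \<le> k' \<Longrightarrow> circuit_computes m k' f"
  unfolding circuit_computes_def circuits_compute_def by (meson order_trans)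

lemma circuit_computes_cong:
  assumes "circuit_computes m k f" "\<And>x. length x = m \<Longrightarrow> g x = f x"
  shows "circuit_computes m k g"
  using assms unfolding circuit_computes_def circuits_compute_def by simp

lemma circuit_computesI:
  assumes "length gs \<le> k" "wf_gates m gs" "out < m + length gs"
    "\<And>x. length x = m \<Longrightarrow> run_gates gs x ! out = f x"
  shows "circuit_computes m k f"
  unfolding circuit_computes_def circuits_compute_def
  using assms by (intro exI[of _ gs] exI[of _ "[out]"]) simp

lemma circuit_computes_proj: "i < m \<Longrightarrow> circuit_computes m 0 (\<lambda>x. x ! i)"
  by (rule circuit_computesI[of "[]"]) (auto simp: wf_gates_def)

lemma circuits_compute_map:
  "(\<And>i. i < p \<Longrightarrow> circuit_computes m (K i) (f i)) \<Longrightarrow>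
    circuits_compute m (\<Sum>i<p. K i) (map f [0..<p])"
proof (induction p)
  case 0
  show ?case unfolding circuits_compute_def
    by (intro exI[of _ "[]"]) (auto simp: wf_gates_def)
next
  case (Suc p)
  then show ?case
    using circuits_compute_append[of m "\<Sum>i<p. K i" "map f [0..<p]" "K p" "[f p]"]
    by (simp add: circuit_computes_def)
qed

lemma circuit_computes_comp:
  assumes "\<And>i. i < p \<Longrightarrow> circuit_computes m (K i) (f i)" "circuit_computes p k h"
  shows "circuit_computes m ((\<Sum>i<p. K i) + k) (\<lambda>x. h (map (\<lambda>i. f i x) [0..<p]))"
  using circuits_compute_comp[OF circuits_compute_map[of p m K f], of k "[h]"] assms
  by (simp add: circuit_computes_def comp_def)

lemma circuit_computes_select:
  assumes "\<And>i. i < p \<Longrightarrow> \<sigma> i < m" "circuit_computes p k h"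
  shows "circuit_computes m k (\<lambda>x. h (map (\<lambda>i. x ! \<sigma> i) [0..<p]))"
  using circuit_computes_comp[of p m "\<lambda>_. 0" "\<lambda>i x. x ! \<sigma> i" k h] assms
  by (simp add: circuit_computes_proj)

section \<open>Multiplexers, lookup tables and parities\<close>

lemma circuit_computes_mux: "circuit_computes 3 4 (\<lambda>x. if x ! 0 then x ! 1 else x ! 2)"
proof (rule circuit_computesI)
  let ?gs = "[Not_gate 0, And_gate 0 1, And_gate 3 2, Or_gate 4 5]"
  show "wf_gates 3 ?gs"
    unfolding wf_gates_def by (auto simp: less_Suc_eq numeral_eq_Suc)
  show "run_gates ?gs x ! 6 = (if x ! 0 then x ! 1 else x ! 2)" if "length x = 3" for x
    using that by (auto simp: run_gates_def nth_append nth_Cons')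
qed auto

text \<open>Shannon expansion on the first bit: two cofactors and a multiplexer give the recursion
  \<open>S (N + 1) = 2 * S N + 4\<close> with \<open>S 0 = 1\<close>, which
  \<open>5 * 2 ^ N - 4\<close> solves.\<close>

lemma circuit_computes_any: "circuit_computes N (5 * 2 ^ N - 4) f"
proof (induction N arbitrary: f)
  case 0
  show ?case
    by (rule circuit_computesI[of "[Const_gate (f [])]" _ _ 0]) (auto simp: wf_gates_def run_gates_def)
next
  case (Suc N)
  \<comment> \<open>The multiplexer inputs: the first bit, then the cofactors for
    \<open>True\<close> and for \<open>False\<close>.\<close>
  define h where "h = (\<lambda>i::nat. if i = 0 then (\<lambda>x. x ! 0) else
      (\<lambda>x. f ((i = 1) # map (\<lambda>d. x ! Suc d) [0..<N])))"
  define K where "K = (\<lambda>i::nat. if i = 0 then 0 else 5 * 2 ^ N - 4 :: nat)"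
  have h: "circuit_computes (Suc N) (K i) (h i)" if "i < 3" for i
  proof (cases "i = 0")
    case True
    then show ?thesis by (simp add: h_def K_def circuit_computes_proj)
  next
    case False
    then show ?thesis
      using circuit_computes_select[of N Suc "Suc N" "5 * 2 ^ N - 4" "\<lambda>y. f ((i = 1) # y)"] Suc.IH
      by (simp add: h_def K_def)
  qed
  have "(\<Sum>i<3. K i) + 4 \<le> 5 * 2 ^ Suc N - 4"
  proof -
    have "2 * (5 * z - 4) + 4 \<le> 10 * z - 4" if "1 \<le> z" for z :: nat
      using that by arith
    from this[of "2 ^ N"] show ?thesis by (simp add: K_def numeral_3_eq_3)
  qed
  with circuit_computes_comp[of 3 "Suc N" K h, OF h circuit_computes_mux]
  have "circuit_computes (Suc N) (5 * 2 ^ Suc N - 4)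
      (\<lambda>x. (\<lambda>x. if x ! 0 then x ! 1 else x ! 2) (map (\<lambda>i. h i x) [0..<3]))"
    by (rule circuit_computes_mono)
  then show ?case
  proof (rule circuit_computes_cong)
    fix x :: "bool list" assume x: "length x = Suc N"
    then obtain b y where xy: "x = b # y" "length y = N" by (auto simp: length_Suc_conv)
    have "map (\<lambda>d. x ! Suc d) [0..<N] = y"
      using xy by (intro nth_equalityI) auto
    then show "f x = (\<lambda>x. if x ! 0 then x ! 1 else x ! 2) (map (\<lambda>i. h i x) [0..<3])"
      by (cases b) (simp_all add: h_def xy numeral_3_eq_3)
  qed
qed

lemma circuit_computes_table: "circuit_computes N (5 * 2 ^ N) f"
  using circuit_computes_any by (rule circuit_computes_mono) simp

text \<open>The constant 20 is the table bound \<open>5 * 2 ^ N\<close> at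
  \<open>N = 2\<close>.\<close>

lemma circuit_computes_binop:
  assumes "circuit_computes m k f" "circuit_computes m k' g"
  shows "circuit_computes m (k + k' + 20) (\<lambda>x. bop (f x) (g x))"
proof -
  have "circuit_computes m ((\<Sum>i<2::nat. if i = 0 then k else k') + 20)
    (\<lambda>x. (\<lambda>y. bop (y ! 0) (y ! 1)) (map (\<lambda>i. (if i = 0 then f else g) x) [0..<2]))"
    by (rule circuit_computes_comp) (use assms circuit_computes_table[of 2] in auto)
  then show ?thesis by (simp add: numeral_2_eq_2)
qed

lemma circuit_computes_parity:
  "(\<And>i. i < p \<Longrightarrow> circuit_computes m k (f i)) \<Longrightarrow>
    circuit_computes m (p * (k + 20) + 1) (\<lambda>x. parity (map (\<lambda>i. f i x) [0..<p]))"
proof (induction p)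
  case 0
  show ?case
    by (rule circuit_computesI[of "[Const_gate False]" _ _ m])
      (auto simp: wf_gates_def run_gates_def nth_append)
next
  case (Suc p)
  then have "circuit_computes m ((p * (k + 20) + 1) + k + 20)
      (\<lambda>x. parity (map (\<lambda>i. f i x) [0..<p]) \<noteq> f p x)"
    by (intro circuit_computes_binop) auto
  then show ?case by (simp add: algebra_simps)
qed

lemma circuit_computes_const: "circuit_computes m 1 (\<lambda>_. b)"
  by (rule circuit_computesI[of "[Const_gate b]" _ _ m])
    (auto simp: wf_gates_def run_gates_def nth_append)

lemma computes_bits_exists:
  assumes "circuit_computes (ceillog2 n) k f" "\<And>j. j < n \<Longrightarrow> f (index_bits n j) = y ! j"
  shows "\<exists>D. circuit_size D \<le> k \<and> computes_bits n D y"
proof -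
  obtain gs outs where gs: "length gs \<le> k" "wf_gates (ceillog2 n) gs" "length outs = 1"
    "\<forall>out\<in>set outs. out < ceillog2 n + length gs"
    "\<And>x. length x = ceillog2 n \<Longrightarrow> map ((!) (run_gates gs x)) outs = [f x]"
    using assms(1) unfolding circuit_computes_def circuits_compute_def by auto
  then obtain out where out: "outs = [out]" by (metis One_nat_def length_0_conv length_Suc_conv)
  define D where "D = \<lparr>bgates = gs, output_node = out\<rparr>"
  have "length (index_bits n j) = ceillog2 n" for j by (simp add: index_bits_def)
  then have "computes_bits n D y"
    using gs out assms(2)
    by (simp add: computes_bits_def D_def wf_boolean_circuit_def wf_gates_def eval_boolean_def run_gates_def)
  moreover have "circuit_size D \<le> k" using gs by (simp add: D_def circuit_size_def)
  ultimately show ?thesis by blast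
qed


section \<open>Hard functions as XORs of tables\<close>

definition signb :: "bool \<Rightarrow> real" where
  "signb b = (if b then - 1 else 1)"

lemma signb_simps [simp]: "signb True = - 1" "signb False = 1"
  by (simp_all add: signb_def)

lemma signb_eq_not: "signb (a \<longleftrightarrow> \<not> b) = signb a * signb b"
  by (cases a; cases b) auto

definition character :: "nat list \<Rightarrow> bool list \<Rightarrow> real" where
  "character ps T = prod_list (map (\<lambda>p. signb (T ! p)) ps)"

lemma character_append: "character (ps @ qs) T = character ps T * character qs T"
  by (simp add: character_def)

lemma prod_list_count:
  fixes f :: "nat \<Rightarrow> real"
  shows "set ps \<subseteq> {..<R} \<Longrightarrow> prod_list (map f ps) = (\<Prod>p<R. f p ^ count_list ps p)"
proof (induction ps)
  case (Cons x ps)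
  have "(\<Prod>p<R. f p ^ count_list (x # ps) p) = (\<Prod>p<R. f p ^ count_list ps p * (if p = x then f x else 1))"
    by (intro prod.cong) (auto simp: mult.commute)
  also have "\<dots> = (\<Prod>p<R. f p ^ count_list ps p) * f x"
    using Cons.prems by (simp add: prod.distrib prod.delta)
  finally show ?case using Cons by (simp add: mult.commute)
qed simp

text \<open>Coordinates are independent, and the power of a random sign has mean 1 for an even
  exponent and 0 for an odd one, so the mean of a character is 0 or 1.\<close>

lemma avg_character_nonneg:
  assumes "set ps \<subseteq> {..<R}"
  shows "0 \<le> avg R (character ps)"
proof -
  have "avg R (character ps) = avg R (\<lambda>T. \<Prod>p<R. signb (T ! p) ^ count_list ps p)"
    unfolding character_def using assms by (intro avg_cong prod_list_count)
  also have "\<dots> = (\<Prod>p<R. (signb True ^ count_list ps p + signb False ^ count_list ps p) / 2)"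
    by (rule avg_prod)
  also have "\<dots> \<ge> 0"
  proof (rule prod_nonneg)
    show "0 \<le> (signb True ^ count_list ps p + signb False ^ count_list ps p) / 2" for p
      by (cases "even (count_list ps p)") simp_all
  qed
  finally show ?thesis .
qed

text \<open>Expanding the power, every term is a character with nonnegative mean, so signs of the
  coefficients can only decrease the moment.\<close>

lemma avg_character_sum_power_le:
  assumes "finite U" "\<And>u. u \<in> U \<Longrightarrow> set (ps u) \<subseteq> {..<R}" "\<And>u. u \<in> U \<Longrightarrow> \<bar>g u\<bar> \<le> 1"
    and "set qs \<subseteq> {..<R}"
  shows "\<bar>avg R (\<lambda>T. character qs T * (\<Sum>u\<in>U. g u * character (ps u) T) ^ q)\<bar>
    \<le> avg R (\<lambda>T. character qs T * (\<Sum>u\<in>U. character (ps u) T) ^ q)"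
  using assms(4)
\<comment> \<open>The prefix \<open>qs\<close> collects the characters already split off from the
  power.\<close>
proof (induction q arbitrary: qs)
  case 0
  then show ?case using avg_character_nonneg[of qs R] by simp
next
  case (Suc q)
  define A where "A = (\<lambda>u. avg R (\<lambda>T. character (qs @ ps u) T * (\<Sum>u\<in>U. g u * character (ps u) T) ^ q))"
  define B where "B = (\<lambda>u. avg R (\<lambda>T. character (qs @ ps u) T * (\<Sum>u\<in>U. character (ps u) T) ^ q))"
  have AB: "\<bar>A u\<bar> \<le> B u" if "u \<in> U" for u
    unfolding A_def B_def using Suc.prems assms(2)[OF that] by (intro Suc.IH) auto
  have "avg R (\<lambda>T. character qs T * (\<Sum>u\<in>U. g u * character (ps u) T) ^ Suc q)
      = avg R (\<lambda>T. \<Sum>u\<in>U. g u * (character (qs @ ps u) T * (\<Sum>u\<in>U. g u * character (ps u) T) ^ q))"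
    by (intro avg_cong) (simp add: character_append sum_distrib_left sum_distrib_right mult_ac)
  also have "\<dots> = (\<Sum>u\<in>U. g u * A u)"
    by (simp add: avg_sum avg_cmult A_def)
  finally have 1: "avg R (\<lambda>T. character qs T * (\<Sum>u\<in>U. g u * character (ps u) T) ^ Suc q) = (\<Sum>u\<in>U. g u * A u)" .
  have "avg R (\<lambda>T. character qs T * (\<Sum>u\<in>U. character (ps u) T) ^ Suc q)
      = avg R (\<lambda>T. \<Sum>u\<in>U. (character (qs @ ps u) T * (\<Sum>u\<in>U. character (ps u) T) ^ q))"
    by (intro avg_cong) (simp add: character_append sum_distrib_left sum_distrib_right mult_ac)
  also have "\<dots> = (\<Sum>u\<in>U. B u)"
    by (simp add: avg_sum B_def)
  finally have 2: "avg R (\<lambda>T. character qs T * (\<Sum>u\<in>U. character (ps u) T) ^ Suc q) = (\<Sum>u\<in>U. B u)" .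
  have "\<bar>\<Sum>u\<in>U. g u * A u\<bar> \<le> (\<Sum>u\<in>U. \<bar>g u * A u\<bar>)" by (rule sum_abs)
  also have "\<dots> \<le> (\<Sum>u\<in>U. B u)"
  proof (rule sum_mono)
    fix u assume u: "u \<in> U"
    have "\<bar>g u\<bar> * \<bar>A u\<bar> \<le> 1 * B u"
      using assms(3)[OF u] AB[OF u] by (intro mult_mono) auto
    then show "\<bar>g u * A u\<bar> \<le> B u" by (simp add: abs_mult)
  qed
  finally show ?case by (simp only: 1 2)
qed

section \<open>Moments of a sum of random signs\<close>

lemma fact_double_ge: "2 ^ k * fact k \<le> (fact (2 * k) :: real)"
proof (induction k)
  case (Suc k)
  have "(2::real) ^ Suc k * fact (Suc k) = (2 * (real k + 1)) * (2 ^ k * fact k)"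
    by (simp add: algebra_simps)
  also have "\<dots> \<le> (2 * (real k + 1)) * ((2 * real k + 1) * fact (2 * k))"
  proof (rule mult_left_mono)
    have "1 * fact (2 * k) \<le> (2 * real k + 1) * (fact (2 * k) :: real)"
      by (rule mult_right_mono) simp_all
    with Suc.IH show "2 ^ k * fact k \<le> (2 * real k + 1) * fact (2 * k)" by linarith
  qed simp
  also have "\<dots> = fact (2 * Suc k)" by (simp add: algebra_simps)
  finally show ?case .
qed simp

text \<open>Termwise comparison of power series, where \<open>cosh\<close> has only even powers and
  \<open>fact_double_ge\<close> compares the coefficients. It bounds the moment generating function
  of a random sign.\<close>

lemma cosh_le_exp_half_square: "cosh (x::real) \<le> exp (x\<^sup>2 / 2)"
proof -
  let ?f = "\<lambda>n. if even n then x ^ n /\<^sub>R fact n else 0"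
  have "?f sums cosh x" by (rule cosh_converges)
  moreover have "strict_mono (\<lambda>k::nat. 2 * k)" by (simp add: strict_mono_def)
  moreover have "?f n = 0" if "n \<notin> range (\<lambda>k::nat. 2 * k)" for n
    using that by (auto elim!: evenE)
  ultimately have sums1: "(\<lambda>k. ?f (2 * k)) sums cosh x"
    using sums_mono_reindex[of "\<lambda>k. 2 * k" ?f "cosh x"] by simp
  have sums2: "(\<lambda>k. (x\<^sup>2 / 2) ^ k /\<^sub>R fact k) sums exp (x\<^sup>2 / 2)"
    by (rule exp_converges)
  have le: "?f (2 * k) \<le> (x\<^sup>2 / 2) ^ k /\<^sub>R fact k" for k
  proof -
    have "?f (2 * k) = (x\<^sup>2) ^ k / fact (2 * k)"
      by (simp add: power_mult[symmetric] divide_inverse mult.commute)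
    also have "\<dots> \<le> (x\<^sup>2) ^ k / (2 ^ k * fact k)"
      by (rule divide_left_mono[OF fact_double_ge zero_le_power[OF zero_le_power2]])
        (intro mult_pos_pos zero_less_power fact_gt_zero zero_less_numeral)
    also have "\<dots> = (x\<^sup>2 / 2) ^ k /\<^sub>R fact k"
      by (simp add: power_divide field_simps)
    finally show ?thesis .
  qed
  show ?thesis by (rule sums_le[OF le sums1 sums2])
qed

lemma power_le_fact_exp:
  fixes x :: real
  assumes "0 \<le> x"
  shows "x ^ n \<le> fact n * exp x"
proof -
  have sums: "(\<lambda>k. x ^ k /\<^sub>R fact k) sums exp x" by (rule exp_converges)
  have "(\<Sum>k\<in>{n}. x ^ k /\<^sub>R fact k) \<le> (\<Sum>k. x ^ k /\<^sub>R fact k)"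
    by (rule sum_le_suminf) (use sums assms in \<open>auto simp: sums_iff\<close>)
  then have "x ^ n / fact n \<le> exp x"
    using sums by (simp add: sums_iff divide_inverse mult.commute)
  then show ?thesis by (simp add: divide_le_eq mult.commute)
qed

text \<open>An even power is at most a factorial times an exponential, and the exponential moment of
  a sum of signs is a power of \<open>cosh\<close>. Growth of order \<open>(p * K) ^ p\<close> is
  what permits \<open>p\<close> to be as large as the logarithm of the number of predictors.\<close>

lemma avg_sign_sum_power_le:
  assumes "1 \<le> p"
  shows "avg K (\<lambda>T. (\<Sum>v<K. signb (T ! v)) ^ (2 * p)) \<le> (12 * real p * real K) ^ p"
proof (cases "K = 0")
  case True
  then show ?thesis using assms by (simp add: power_0_left)
next
  case False
  define S where "S = (\<lambda>T. \<Sum>v<K. signb (T ! v))"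
  \<comment> \<open>At this scale \<open>K * r^2 / 2 = p\<close>, so the exponential moments at
    \<open>r\<close> and \<open>- r\<close> are at most \<open>exp p\<close>.\<close>
  define r where "r = sqrt (2 * real p / real K)"
  have r: "0 < r" "r\<^sup>2 = 2 * real p / real K" using assms False by (simp_all add: r_def)
  have mgf: "avg K (\<lambda>T. exp (c * S T)) \<le> exp (real p)" if "c\<^sup>2 = r\<^sup>2" for c
  proof -
    have "avg K (\<lambda>T. exp (c * S T)) = avg K (\<lambda>T. \<Prod>v<K. exp (c * signb (T ! v)))"
      by (simp add: S_def sum_distrib_left exp_sum)
    also have "\<dots> = (\<Prod>v<K. (exp (c * signb True) + exp (c * signb False)) / 2)"
      by (rule avg_prod)
    also have "\<dots> = cosh c ^ K"
      by (simp add: cosh_field_def add.commute)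
    also have "\<dots> \<le> exp (c\<^sup>2 / 2) ^ K"
      by (intro power_mono cosh_le_exp_half_square) (simp add: cosh_real_nonneg)
    also have "\<dots> = exp (real p)"
      using False that r by (simp flip: exp_of_nat_mult)
    finally show ?thesis .
  qed
  have pt: "r ^ (2 * p) * S T ^ (2 * p) \<le> fact (2 * p) * (exp (r * S T) + exp (- r * S T))" for T
  proof -
    have "r ^ (2 * p) * S T ^ (2 * p) = \<bar>r * S T\<bar> ^ (2 * p)"
      by (simp add: power_mult_distrib power_even_abs)
    also have "\<dots> \<le> fact (2 * p) * exp \<bar>r * S T\<bar>"
      by (rule power_le_fact_exp) simp
    also have "exp \<bar>r * S T\<bar> \<le> exp (r * S T) + exp (- r * S T)"
      by (cases "0 \<le> r * S T") (simp_all add: abs_if)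
    finally show ?thesis by simp
  qed
  have "r ^ (2 * p) * avg K (\<lambda>T. S T ^ (2 * p))
      \<le> fact (2 * p) * (avg K (\<lambda>T. exp (r * S T)) + avg K (\<lambda>T. exp (- r * S T)))"
    unfolding avg_cmult[symmetric] avg_add[symmetric] by (rule avg_mono) (rule pt)
  also have "\<dots> \<le> fact (2 * p) * (2 * exp (real p))"
    using mgf[of r] mgf[of "- r"] by (intro mult_left_mono) simp_all
  also have "\<dots> \<le> (2 * real p) ^ (2 * p) * (2 * 3 ^ p)"
  proof (rule mult_mono)
    have "fact (2 * p) \<le> real ((2 * p) ^ (2 * p))"
      by (metis fact_le_power order_refl of_nat_fact of_nat_le_iff)
    then show "fact (2 * p) \<le> (2 * real p) ^ (2 * p)" by simp
    have "exp (real p) = exp 1 ^ p" by (simp flip: exp_of_nat_mult)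
    also have "\<dots> \<le> 3 ^ p" using exp_le by (intro power_mono) auto
    finally show "2 * exp (real p) \<le> 2 * 3 ^ p" by simp
  qed simp_all
  also have "\<dots> \<le> (2 * real p) ^ (2 * p) * 6 ^ p"
  proof (rule mult_left_mono)
    have "(2::real) ^ 1 \<le> 2 ^ p" using assms by (intro power_increasing) auto
    then have "2 * (3::real) ^ p \<le> 2 ^ p * 3 ^ p" by (intro mult_right_mono) auto
    then show "2 * (3::real) ^ p \<le> 6 ^ p" by (simp flip: power_mult_distrib)
  qed simp
  also have "\<dots> = r ^ (2 * p) * (12 * real p * real K) ^ p"
  proof -
    have "(2 * real p)\<^sup>2 * 6 = r\<^sup>2 * (12 * real p * real K)"
      unfolding r(2) using False by (simp add: power2_eq_square)
    then have "((2 * real p)\<^sup>2 * 6) ^ p = (r\<^sup>2 * (12 * real p * real K)) ^ p" by (simp only:)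
    then show ?thesis by (simp only: power_mult power_mult_distrib)
  qed
  finally show ?thesis
    unfolding S_def by (rule mult_left_le_imp_le) (simp add: r(1))
qed

section \<open>XORs of tables and their correlation with predictors\<close>

definition bnum :: "bool list \<Rightarrow> nat" where
  "bnum bs = horner_sum of_bool 2 bs"

lemma bnum_less: "bnum bs < 2 ^ length bs"
proof (induction bs)
  case (Cons b bs)
  then show ?case by (cases b) (simp_all add: bnum_def)
qed (simp add: bnum_def)

lemma bnum_inj: "length bs = length bs' \<Longrightarrow> bnum bs = bnum bs' \<Longrightarrow> bs = bs'"
proof (induction bs bs' rule: list_induct2)
  case (Cons b bs b' bs')
  have "of_bool b + 2 * bnum bs = of_bool b' + 2 * bnum bs'"
    using Cons.prems by (simp add: bnum_def)
  moreover from arg_cong[OF this, of odd] have "b = b'" by simp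
  ultimately show ?case using Cons.IH by simp
qed simp

lemma bij_betw_bnum: "bij_betw bnum (bitstrings k) {..<2 ^ k}"
proof -
  have inj: "inj_on bnum (bitstrings k)" by (auto simp: inj_on_def intro: bnum_inj)
  have "bnum ` bitstrings k = {..<2 ^ k}"
    by (rule card_subset_eq) (use bnum_less in \<open>auto simp: card_image[OF inj]\<close>)
  then show ?thesis using inj by (simp add: bij_betw_def)
qed

fun xor_tables :: "nat \<Rightarrow> nat \<Rightarrow> bool list \<Rightarrow> bool list \<Rightarrow> bool" where
  "xor_tables 0 k T u = False"
| "xor_tables (Suc c) k T u =
     (T ! bnum (take k u) \<noteq> xor_tables c k (drop (2 ^ k) T) (drop k u))"

fun table_positions :: "nat \<Rightarrow> nat \<Rightarrow> bool list \<Rightarrow> nat list" where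
  "table_positions 0 k u = []"
| "table_positions (Suc c) k u =
     bnum (take k u) # map ((+) (2 ^ k)) (table_positions c k (drop k u))"

text \<open>For fixed \<open>u\<close> the output is an XOR of bits of \<open>T\<close>, so its sign
  is a character in the table bits. The random object is \<open>T\<close>; the input
  \<open>u\<close> only selects the character.\<close>

lemma signb_xor_tables:
  assumes "length T = c * 2 ^ k"
  shows "signb (xor_tables c k T u) = character (table_positions c k u) T"
  using assms
proof (induction c arbitrary: T u)
  case (Suc c)
  have "character (map ((+) (2 ^ k)) ps) T = character ps (drop (2 ^ k) T)" for ps
    unfolding character_def using Suc.prems by (simp add: comp_def)
  then show ?case
    using Suc by (simp add: signb_eq_not character_def)
qed (simp add: character_def)

lemma table_positions_bound:
  "length u = c * k \<Longrightarrow> set (table_positions c k u) \<subseteq> {..<c * 2 ^ k}"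
proof (induction c arbitrary: u)
  case (Suc c)
  have "bnum (take k u) < 2 ^ k"
    using bnum_less[of "take k u"] Suc.prems by simp
  moreover have "set (table_positions c k (drop k u)) \<subseteq> {..<c * 2 ^ k}"
    using Suc by simp
  ultimately show ?case by auto
qed simp

lemma sum_signb_xor_tables_Suc:
  assumes "length T1 = 2 ^ k"
  shows "(\<Sum>u\<in>bitstrings (Suc c * k). signb (xor_tables (Suc c) k (T1 @ T2) u))
    = (\<Sum>v<2 ^ k. signb (T1 ! v)) * (\<Sum>u\<in>bitstrings (c * k). signb (xor_tables c k T2 u))"
proof -
  have "(\<Sum>u\<in>bitstrings (k + c * k). signb (xor_tables (Suc c) k (T1 @ T2) u))
    = (\<Sum>(u1, u2)\<in>bitstrings k \<times> bitstrings (c * k). signb (xor_tables (Suc c) k (T1 @ T2) (u1 @ u2)))"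
    unfolding bitstrings_append by (subst sum.reindex) (auto simp: inj_on_def case_prod_unfold)
  also have "\<dots> = (\<Sum>(u1, u2)\<in>bitstrings k \<times> bitstrings (c * k).
      signb (T1 ! bnum u1) * signb (xor_tables c k T2 u2))"
  proof (rule sum.cong)
    fix x assume "x \<in> bitstrings k \<times> bitstrings (c * k)"
    then obtain u1 u2 where x: "x = (u1, u2)" "length u1 = k" by auto
    have "bnum u1 < 2 ^ k" using bnum_less[of u1] x by simp
    then show "(case x of (u1, u2) \<Rightarrow> signb (xor_tables (Suc c) k (T1 @ T2) (u1 @ u2))) =
      (case x of (u1, u2) \<Rightarrow> signb (T1 ! bnum u1) * signb (xor_tables c k T2 u2))"
      using x assms by (simp add: signb_eq_not nth_append)
  qed simp
  also have "\<dots> = (\<Sum>u1\<in>bitstrings k. signb (T1 ! bnum u1)) * (\<Sum>u\<in>bitstrings (c * k). signb (xor_tables c k T2 u))"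
    by (simp add: sum.cartesian_product[symmetric] sum_product)
  also have "(\<Sum>u1\<in>bitstrings k. signb (T1 ! bnum u1)) = (\<Sum>v<2 ^ k. signb (T1 ! v))"
    by (rule sum.reindex_bij_betw[OF bij_betw_bnum])
  finally show ?thesis by simp
qed

text \<open>Without a predictor the sum over all inputs is a product of one sign sum per table, and
  the tables are independent, so moments multiply.\<close>

lemma avg_xor_tables_power:
  "avg (c * 2 ^ k) (\<lambda>T. (\<Sum>u\<in>bitstrings (c * k). signb (xor_tables c k T u)) ^ q)
    = avg (2 ^ k) (\<lambda>T. (\<Sum>v<2 ^ k. signb (T ! v)) ^ q) ^ c"
proof (induction c)
  case 0
  then show ?case by (simp add: bitstrings_def)
next
  case (Suc c)
  have "avg (2 ^ k + c * 2 ^ k) (\<lambda>T. (\<Sum>u\<in>bitstrings (Suc c * k). signb (xor_tables (Suc c) k T u)) ^ q)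
    = avg (2 ^ k) (\<lambda>T1. avg (c * 2 ^ k) (\<lambda>T2.
        (\<Sum>u\<in>bitstrings (Suc c * k). signb (xor_tables (Suc c) k (T1 @ T2) u)) ^ q))"
    by (rule avg_append)
  also have "\<dots> = avg (2 ^ k) (\<lambda>T1. avg (c * 2 ^ k) (\<lambda>T2.
        (\<Sum>v<2 ^ k. signb (T1 ! v)) ^ q * (\<Sum>u\<in>bitstrings (c * k). signb (xor_tables c k T2 u)) ^ q))"
    by (intro avg_cong) (simp only: sum_signb_xor_tables_Suc power_mult_distrib)
  also have "\<dots> = avg (2 ^ k) (\<lambda>T1. (\<Sum>v<2 ^ k. signb (T1 ! v)) ^ q *
        avg (2 ^ k) (\<lambda>T. (\<Sum>v<2 ^ k. signb (T ! v)) ^ q) ^ c)"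
    by (simp only: avg_cmult Suc.IH)
  also have "\<dots> = avg (2 ^ k) (\<lambda>T. (\<Sum>v<2 ^ k. signb (T ! v)) ^ q) ^ Suc c"
    by (simp only: mult.commute[of _ "_ ^ c"] avg_cmult power_Suc2)
  finally show ?case by (simp only: mult_Suc)
qed

text \<open>Compare the moment with that of the constant function, which factors over the tables.\<close>

lemma xor_tables_moment:
  assumes "1 \<le> p"
  shows "avg (c * 2 ^ k) (\<lambda>T. (\<Sum>u\<in>bitstrings (c * k). of_bool (f u) * signb (xor_tables c k T u)) ^ (2 * p))
    \<le> ((12 * real p * 2 ^ k) ^ p) ^ c"
proof -
  have eq: "avg (c * 2 ^ k) (\<lambda>T. (\<Sum>u\<in>bitstrings (c * k). g u * signb (xor_tables c k T u)) ^ (2 * p))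
    = avg (c * 2 ^ k) (\<lambda>T. character [] T * (\<Sum>u\<in>bitstrings (c * k). g u * character (table_positions c k u) T) ^ (2 * p))" for g
    by (intro avg_cong) (simp add: signb_xor_tables character_def)
  have "\<bar>avg (c * 2 ^ k) (\<lambda>T. character [] T * (\<Sum>u\<in>bitstrings (c * k). of_bool (f u) * character (table_positions c k u) T) ^ (2 * p))\<bar>
    \<le> avg (c * 2 ^ k) (\<lambda>T. character [] T * (\<Sum>u\<in>bitstrings (c * k). character (table_positions c k u) T) ^ (2 * p))"
    by (rule avg_character_sum_power_le) (use table_positions_bound in auto)
  also have "\<dots> = avg (c * 2 ^ k) (\<lambda>T. (\<Sum>u\<in>bitstrings (c * k). signb (xor_tables c k T u)) ^ (2 * p))"
    using eq[of "\<lambda>_. 1"] by simp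
  also have "\<dots> = avg (2 ^ k) (\<lambda>T. (\<Sum>v<2 ^ k. signb (T ! v)) ^ (2 * p)) ^ c"
    by (rule avg_xor_tables_power)
  also have "\<dots> \<le> ((12 * real p * 2 ^ k) ^ p) ^ c"
    using avg_sign_sum_power_le[OF assms, of "2 ^ k"]
    by (intro power_mono avg_nonneg) (simp_all add: power_mult)
  finally show ?thesis using eq[of "\<lambda>u. of_bool (f u)"] by simp
qed

text \<open>Markov's inequality for moments of order \<open>2 * p\<close>, with a union bound over
  fewer than \<open>4 ^ p\<close> predictors. In the squared correlation each table contributes
  \<open>12 * p * 2 ^ k / 4 ^ k\<close>, at most \<open>2 ^ - g\<close>, so \<open>c\<close> tables
  together reach at most \<open>\<delta>^2 / 4\<close>.\<close>

lemma hard_function_exists: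
  fixes R :: "(bool list \<Rightarrow> bool) set"
  assumes R: "finite R" "card R < 4 ^ p" and p: "1 \<le> p"
    and k: "12 * p * 2 ^ g \<le> 2 ^ k" and \<delta>: "0 < \<delta>" "4 \<le> \<delta>\<^sup>2 * 2 ^ (g * c)"
  shows "\<exists>T. length T = c * 2 ^ k \<and>
    (\<forall>f\<in>R. \<bar>avg (c * k) (\<lambda>u. of_bool (f u) * signb (xor_tables c k T u))\<bar> \<le> \<delta>)"
proof -
  define M where "M = (2::real) ^ (c * k)"
  define \<Phi> where "\<Phi> = (\<lambda>f T. \<Sum>u\<in>bitstrings (c * k). of_bool (f u) * signb (xor_tables c k T u))"
  \<comment> \<open>Scaled so that \<open>X f T < 1\<close> means a correlation below
    \<open>\<delta>\<close> in absolute value.\<close>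
  define X where "X = (\<lambda>f T. (\<Phi> f T / (\<delta> * M)) ^ (2 * p))"
  have M: "0 < M" by (simp add: M_def)
  have "avg (c * 2 ^ k) (X f) \<le> 1 / 4 ^ p" for f
  proof -
    have "avg (c * 2 ^ k) (X f) = avg (c * 2 ^ k) (\<lambda>T. \<Phi> f T ^ (2 * p)) / (\<delta> * M) ^ (2 * p)"
      by (simp add: X_def power_divide avg_divide)
    also have "\<dots> \<le> ((12 * real p * 2 ^ k) ^ p) ^ c / (\<delta> * M) ^ (2 * p)"
      unfolding \<Phi>_def using \<delta> M
      by (intro divide_right_mono xor_tables_moment p) simp
    also have "\<dots> = (((12 * real p * 2 ^ k) ^ c) / (\<delta> * M)\<^sup>2) ^ p"
      by (simp add: power_divide power_mult[symmetric] mult.commute)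
    also have "\<dots> \<le> (1 / 4) ^ p"
    proof (rule power_mono)
      have "real (12 * p * 2 ^ g) \<le> real (2 ^ k)" using k by (simp only: of_nat_le_iff)
      then have "2 ^ k * (12 * real p * 2 ^ g) \<le> 2 ^ k * 2 ^ k"
        by (intro mult_left_mono) simp_all
      then have "12 * real p * 2 ^ k * 2 ^ g \<le> 2 ^ k * 2 ^ k"
        by (simp only: mult_ac)
      then have "(12 * real p * 2 ^ k * 2 ^ g) ^ c \<le> (2 ^ k * 2 ^ k) ^ c"
        by (intro power_mono) auto
      then have 1: "(12 * real p * 2 ^ k) ^ c * 2 ^ (g * c) \<le> M\<^sup>2"
        by (simp add: M_def power_mult_distrib power_mult[symmetric] power2_eq_square mult.commute)
      have "(12 * real p * 2 ^ k) ^ c * 4 \<le> (12 * real p * 2 ^ k) ^ c * (\<delta>\<^sup>2 * 2 ^ (g * c))"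
        by (rule mult_left_mono[OF \<delta>(2)]) simp
      also have "\<dots> \<le> \<delta>\<^sup>2 * M\<^sup>2"
        using mult_left_mono[OF 1, of "\<delta>\<^sup>2"] by (simp add: mult_ac)
      finally show "(12 * real p * 2 ^ k) ^ c / (\<delta> * M)\<^sup>2 \<le> 1 / 4"
        using \<delta> M by (simp add: power_mult_distrib divide_le_eq)
    qed simp
    finally show ?thesis by (simp add: power_divide)
  qed
  then have "(\<Sum>f\<in>R. avg (c * 2 ^ k) (X f)) \<le> real (card R) * (1 / 4 ^ p)"
    by (rule sum_bounded_above)
  also have "\<dots> < 1"
  proof -
    have "real (card R) < real (4 ^ p)" by (rule of_nat_less_iff[THEN iffD2, OF R(2)])
    then show ?thesis by simp
  qed
  finally have "avg (c * 2 ^ k) (\<lambda>T. \<Sum>f\<in>R. X f T) < 1" by (simp add: avg_sum)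
  then obtain T where T: "length T = c * 2 ^ k" "(\<Sum>f\<in>R. X f T) < 1" using ex_le_avg by blast
  have "\<bar>avg (c * k) (\<lambda>u. of_bool (f u) * signb (xor_tables c k T u))\<bar> \<le> \<delta>" if f: "f \<in> R" for f
  proof -
    have "X f T \<le> (\<Sum>f\<in>R. X f T)"
      by (rule member_le_sum[OF f _ R(1)]) (simp add: X_def power_mult)
    moreover have "\<bar>\<Phi> f T / (\<delta> * M)\<bar> ^ (2 * p) = X f T"
      unfolding X_def by (rule power_even_abs) simp
    ultimately have "\<bar>\<Phi> f T / (\<delta> * M)\<bar> ^ (2 * p) < 1"
      using T(2) by linarith
    then have "\<bar>\<Phi> f T / (\<delta> * M)\<bar> < 1"
      using one_le_power[of "\<bar>\<Phi> f T / (\<delta> * M)\<bar>" "2 * p"] by linarith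
    then have "\<bar>\<Phi> f T / M\<bar> \<le> \<delta>"
      using \<delta> M by (simp add: abs_mult divide_less_eq divide_le_eq)
    then show ?thesis by (simp add: avg_def \<Phi>_def M_def)
  qed
  then show ?thesis using T(1) by blast
qed

lemma circuit_computes_xor_tables:
  "circuit_computes (c * k) (c * (5 * 2 ^ k + 20) + 1) (xor_tables c k T)"
proof (induction c arbitrary: T)
  case 0
  have "circuit_computes (0 * k) 1 (\<lambda>_. False)" by (rule circuit_computes_const)
  then show ?case
    by (rule circuit_computes_cong[OF circuit_computes_mono]) simp_all
next
  case (Suc c)
  have take: "circuit_computes (Suc c * k) (5 * 2 ^ k) (\<lambda>u. (\<lambda>y. T ! bnum y) (map (\<lambda>i. u ! i) [0..<k]))"
    by (rule circuit_computes_select) (simp_all add: circuit_computes_table)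
  have drop: "circuit_computes (Suc c * k) (c * (5 * 2 ^ k + 20) + 1)
      (\<lambda>u. xor_tables c k (drop (2 ^ k) T) (map (\<lambda>i. u ! (k + i)) [0..<c * k]))"
    by (rule circuit_computes_select[OF _ Suc.IH]) simp
  show ?case
  proof (rule circuit_computes_cong[OF circuit_computes_mono[OF circuit_computes_binop[OF take drop, of "(\<noteq>)"]]])
    show "5 * 2 ^ k + (c * (5 * 2 ^ k + 20) + 1) + 20 \<le> Suc c * (5 * 2 ^ k + 20) + 1" by simp
    fix u :: "bool list" assume u: "length u = Suc c * k"
    have "map ((!) u) [0..<k] = take k u" "map (\<lambda>i. u ! (k + i)) [0..<c * k] = drop k u"
      using u by (auto intro!: nth_equalityI)
    then show "xor_tables (Suc c) k T u \<longleftrightarrow> T ! bnum (map ((!) u) [0..<k]) \<noteq>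
        xor_tables c k (drop (2 ^ k) T) (map (\<lambda>i. u ! (k + i)) [0..<c * k])"
      by simp
  qed
qed


section \<open>The generator\<close>

lemma mixed_radix_inj:
  fixes b b' e e' g :: nat
  assumes "e < g" "e' < g" "b * g + e = b' * g + e'"
  shows "b = b' \<and> e = e'"
proof -
  have "b = b'" using arg_cong[OF assms(3), of "\<lambda>x. x div g"] assms(1,2) by simp
  then show ?thesis using assms(3) by simp
qed

lemma mixed_radix_less:
  fixes b e g s :: nat
  assumes "b < s" "e < g"
  shows "b * g + e < s * g"
proof -
  have "b * g + e < Suc b * g" using assms(2) by simp
  also have "\<dots> \<le> s * g" using assms(1) by (intro mult_le_mono1) simp
  finally show ?thesis .
qed

text \<open>Symbol \<open>b\<close> of the codeword of \<open>y\<close> under a linear code: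
  \<open>L\<close> lists row by row a matrix with rows of \<open>N\<close> bits, and each group of
  \<open>g\<close> rows yields one symbol over an alphabet of size \<open>2 ^ g\<close>.\<close>

definition code_symbol :: "nat \<Rightarrow> nat \<Rightarrow> bool list \<Rightarrow> nat \<Rightarrow> bool list \<Rightarrow> bool list" where
  "code_symbol N g L b y =
     map (\<lambda>e. parity (map (\<lambda>d. L ! ((b * g + e) * N + d) \<and> y ! d) [0..<N])) [0..<g]"

lemma length_code_symbol [simp]: "length (code_symbol N g L b y) = g"
  by (simp add: code_symbol_def)

lemma parity_masked_eq:
  "parity (map (\<lambda>d. f d \<and> y d) ds) = parity (map (\<lambda>d. f d \<and> y' d) ds)
    \<longleftrightarrow> \<not> parity (map f (filter (\<lambda>d. y d \<noteq> y' d) ds))"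
  by (induction ds) auto

text \<open>By linearity, agreement in a symbol says that \<open>g\<close> rows of \<open>L\<close>
  have even parity on the places where \<open>y\<close> and \<open>y'\<close> differ. Different rows
  share no bits, so any such place is a private pivot and the \<open>g * a\<close> constraints are
  independent.\<close>

lemma avg_code_agree:
  assumes y: "length y = N" "length y' = N" "y \<noteq> y'" and B: "B \<subseteq> {..<s}" "card B = a"
  shows "avg (s * g * N) (\<lambda>L. of_bool (\<forall>b\<in>B. code_symbol N g L b y = code_symbol N g L b y'))
    \<le> 1 / 2 ^ (g * a)"
proof -
  have "finite B" using B(1) finite_subset by blast
  then obtain bs where bs: "set bs = B" "distinct bs" using finite_distinct_list by blast
  define ds where "ds = filter (\<lambda>d. y ! d \<noteq> y' ! d) [0..<N]"
  have "\<exists>d<N. y ! d \<noteq> y' ! d" using y by (auto simp: list_eq_iff_nth_eq)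
  then have ne: "ds \<noteq> []" by (auto simp: ds_def filter_empty_conv)
  have dist: "distinct ds" by (simp add: ds_def)
  have ds: "d < N" if "d \<in> set ds" for d using that by (auto simp: ds_def)
  define is' where "is' = List.product bs [0..<g]"
  define P where "P = (\<lambda>(b, e). map (\<lambda>d. (b * g + e) * N + d) ds)"
  define piv where "piv = (\<lambda>(b, e). (b * g + e) * N + hd ds)"
  have is': "set is' = B \<times> {..<g}" "distinct is'" "length is' = g * a"
    using bs distinct_card[OF bs(2)] B(2) by (auto simp: is'_def distinct_product)
  have "avg (s * g * N) (\<lambda>L. of_bool (\<forall>b\<in>B. code_symbol N g L b y = code_symbol N g L b y'))
      \<le> avg (s * g * N) (\<lambda>L. of_bool (\<forall>i\<in>set is'. parity (map ((!) L) (P i)) = False))"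
  proof (rule avg_mono)
    fix L :: "bool list"
    have "parity (map ((!) L) (P i)) = False"
      if agree: "\<forall>b\<in>B. code_symbol N g L b y = code_symbol N g L b y'" and i: "i \<in> set is'" for i
    proof -
      obtain b e where be: "i = (b, e)" "b \<in> B" "e < g" using i is' by auto
      have "code_symbol N g L b y ! e = code_symbol N g L b y' ! e" using agree be by simp
      then have "parity (map (\<lambda>d. L ! ((b * g + e) * N + d) \<and> y ! d) [0..<N])
          = parity (map (\<lambda>d. L ! ((b * g + e) * N + d) \<and> y' ! d) [0..<N])"
        using be by (simp add: code_symbol_def)
      then have "\<not> parity (map (\<lambda>d. L ! ((b * g + e) * N + d)) ds)"
        unfolding parity_masked_eq ds_def .
      then show ?thesis by (simp add: be P_def comp_def)
    qed
    then show "of_bool (\<forall>b\<in>B. code_symbol N g L b y = code_symbol N g L b y')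
        \<le> (of_bool (\<forall>i\<in>set is'. parity (map ((!) L) (P i)) = False) :: real)"
      by (auto simp: of_bool_def)
  qed
  also have "\<dots> = 1 / 2 ^ length is'"
  proof (rule avg_parity_constraints[where piv = piv])
    show "distinct is'" by (rule is')
    fix i assume i: "i \<in> set is'"
    then obtain b e where be: "i = (b, e)" "b < s" "e < g" using is' B(1) by auto
    have "distinct (P i)"
      using dist by (simp add: be P_def distinct_map inj_on_def)
    moreover have "piv i \<in> set (P i)" using ne by (simp add: be P_def piv_def)
    moreover have "(b * g + e) * N + d < s * g * N" if "d \<in> set ds" for d
      using mixed_radix_less[OF mixed_radix_less[OF be(2,3)] ds[OF that]] .
    then have "\<forall>p\<in>set (P i). p < s * g * N" by (simp add: be P_def)
    ultimately show "distinct (P i) \<and> piv i \<in> set (P i) \<and> (\<forall>p\<in>set (P i). p < s * g * N)" by blast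
  next
    fix i i' assume i: "i \<in> set is'" "i' \<in> set is'" "i \<noteq> i'"
    obtain b e where be: "i = (b, e)" "e < g" using i is' by auto
    obtain b' e' where be': "i' = (b', e')" "e' < g" using i is' by auto
    show "piv i \<notin> set (P i')"
    proof
      assume "piv i \<in> set (P i')"
      then obtain d where d: "d \<in> set ds" "(b * g + e) * N + hd ds = (b' * g + e') * N + d"
        by (auto simp: be be' P_def piv_def)
      have "hd ds < N" "d < N" using ds ne d(1) by simp_all
      then have "b * g + e = b' * g + e'" using mixed_radix_inj d(2) by blast
      then show False using mixed_radix_inj[OF be(2) be'(2)] i(3) be be' by blast
    qed
  qed
  finally show ?thesis by (simp only: is'(3))
qed

text \<open>Union bound over two messages and a set of \<open>a\<close> coordinates: at most
  \<open>2 ^ (2 * N + s)\<close> events, each of probability at most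
  \<open>2 ^ - (g * a)\<close>.\<close>

lemma code_exists:
  assumes "2 * N + s < g * a"
  shows "\<exists>L. \<forall>y y'. length y = N \<longrightarrow> length y' = N \<longrightarrow> y \<noteq> y' \<longrightarrow>
    card {b. b < s \<and> code_symbol N g L b y = code_symbol N g L b y'} < a"
proof -
  define Is where "Is = {((y, y'), B). (y, y') \<in> bitstrings N \<times> bitstrings N \<and> B \<in> Pow {..<s} \<and> y \<noteq> y' \<and> card B = a}"
  define E :: "(bool list \<times> bool list) \<times> nat set \<Rightarrow> bool list \<Rightarrow> real" where
    "E = (\<lambda>((y, y'), B) L. of_bool (\<forall>b\<in>B. code_symbol N g L b y = code_symbol N g L b y'))"
  let ?U = "(bitstrings N \<times> bitstrings N) \<times> Pow {..<s}"
  have sub: "Is \<subseteq> ?U" by (auto simp: Is_def)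
  have finU: "finite ?U" by simp
  have "card ?U = 2 ^ N * 2 ^ N * 2 ^ s"
    by (simp add: card_cartesian_product card_Pow)
  then have cardU: "card ?U = 2 ^ (2 * N + s)" by (simp add: power_add mult_2)
  have fin: "finite Is" using sub finU by (rule finite_subset)
  have "card Is \<le> 2 ^ (2 * N + s)" using card_mono[OF finU sub] cardU by simp
  then have card_Is: "real (card Is) \<le> 2 ^ (2 * N + s)"
    using of_nat_mono[where 'a = real] by fastforce
  have E: "avg (s * g * N) (E i) \<le> 1 / 2 ^ (g * a)" if "i \<in> Is" for i
  proof -
    obtain y y' B where i: "i = ((y, y'), B)" by (metis prod.collapse)
    show ?thesis
      unfolding i E_def prod.case by (rule avg_code_agree) (use that in \<open>auto simp: i Is_def\<close>)
  qed
  have "avg (s * g * N) (\<lambda>L. \<Sum>i\<in>Is. E i L) = (\<Sum>i\<in>Is. avg (s * g * N) (E i))"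
    by (rule avg_sum)
  also have "\<dots> \<le> real (card Is) * (1 / 2 ^ (g * a))"
    using E by (rule sum_bounded_above)
  also have "\<dots> \<le> 2 ^ (2 * N + s) * (1 / 2 ^ (g * a))"
    using card_Is by (rule mult_right_mono) simp
  also have "\<dots> < 1"
  proof -
    have "(2::real) ^ (2 * N + s) < 2 ^ (g * a)" using assms by simp
    then show ?thesis by simp
  qed
  finally obtain L where L: "(\<Sum>i\<in>Is. E i L) < 1" using ex_le_avg by blast
  have "card {b. b < s \<and> code_symbol N g L b y = code_symbol N g L b y'} < a"
    if y: "length y = N" "length y' = N" "y \<noteq> y'" for y y'
  proof (rule ccontr)
    assume "\<not> ?thesis"
    then have "a \<le> card {b. b < s \<and> code_symbol N g L b y = code_symbol N g L b y'}" by (simp only: not_less)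
    then obtain B where B: "B \<subseteq> {b. b < s \<and> code_symbol N g L b y = code_symbol N g L b y'}" "card B = a"
      by (rule obtain_subset_with_card_n)
    have "B \<subseteq> {..<s}" using B(1) by blast
    then have "((y, y'), B) \<in> Is" using B(2) y by (simp add: Is_def)
    then have "E ((y, y'), B) L \<le> (\<Sum>i\<in>Is. E i L)"
      by (rule member_le_sum) (simp_all add: E_def fin case_prod_beta)
    moreover have "E ((y, y'), B) L = 1"
    proof -
      have "\<forall>b\<in>B. code_symbol N g L b y = code_symbol N g L b y'" using B(1) by blast
      then show ?thesis by (simp add: E_def)
    qed
    ultimately show False using L by simp
  qed
  then show ?thesis by blast
qed

section \<open>Weighted sums over injective tuples\<close>

definition distinct_tuples :: "nat \<Rightarrow> 'a set \<Rightarrow> 'a list set" where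
  "distinct_tuples m B = {js. length js = m \<and> distinct js \<and> set js \<subseteq> B}"

lemma finite_distinct_tuples: "finite B \<Longrightarrow> finite (distinct_tuples m B)"
  by (rule finite_subset[OF _ finite_lists_length_eq[of B m]]) (auto simp: distinct_tuples_def)

lemma distinct_tuples_0 [simp]: "distinct_tuples 0 B = {[]}"
  by (auto simp: distinct_tuples_def)

text \<open>These sums are factorial multiples of elementary symmetric polynomials in the weights.
  In contrast to a power of the total weight they contain no repeated variable, so a single huge
  weight cannot dominate them.\<close>

lemma sum_distinct_tuples_Suc:
  fixes W :: "'a \<Rightarrow> real"
  assumes "finite B"
  shows "(\<Sum>js\<in>distinct_tuples (Suc m) B. prod_list (map W js))
    = (\<Sum>js\<in>distinct_tuples m B. prod_list (map W js) * (\<Sum>j\<in>B - set js. W j))"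
proof -
  have eq: "distinct_tuples (Suc m) B = (\<lambda>(js, j). j # js) ` (SIGMA js:distinct_tuples m B. B - set js)"
  proof (intro equalityI subsetI)
    fix xs assume "xs \<in> distinct_tuples (Suc m) B"
    then obtain j js where "xs = j # js" "(js, j) \<in> (SIGMA js:distinct_tuples m B. B - set js)"
      by (cases xs) (auto simp: distinct_tuples_def)
    then show "xs \<in> (\<lambda>(js, j). j # js) ` (SIGMA js:distinct_tuples m B. B - set js)"
      by (metis (no_types, lifting) case_prod_conv image_eqI)
  qed (auto simp: distinct_tuples_def)
  have inj: "inj_on (\<lambda>(js, j). j # js) (SIGMA js:distinct_tuples m B. B - set js)"
    by (auto simp: inj_on_def)
  have "(\<Sum>js\<in>distinct_tuples (Suc m) B. prod_list (map W js))
      = (\<Sum>(js, j)\<in>(SIGMA js:distinct_tuples m B. B - set js). W j * prod_list (map W js))"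
    unfolding eq by (subst sum.reindex[OF inj]) (simp add: comp_def case_prod_unfold)
  also have "\<dots> = (\<Sum>js\<in>distinct_tuples m B. \<Sum>j\<in>B - set js. W j * prod_list (map W js))"
    by (rule sum.Sigma[symmetric]) (use assms finite_distinct_tuples in auto)
  finally show ?thesis by (simp add: sum_distrib_left mult.commute)
qed

lemma prod_list_nonneg_real: "(\<And>j. 0 \<le> W j) \<Longrightarrow> 0 \<le> prod_list (map W js)" for W :: "'a \<Rightarrow> real"
  by (induction js) auto

lemma sum_distinct_tuples_le:
  fixes W :: "'a \<Rightarrow> real"
  assumes "finite B" "\<And>j. 0 \<le> W j"
  shows "(\<Sum>js\<in>distinct_tuples m B. prod_list (map W js)) \<le> (\<Sum>j\<in>B. W j) ^ m"
proof (induction m)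
  case (Suc m)
  have "(\<Sum>js\<in>distinct_tuples (Suc m) B. prod_list (map W js))
    \<le> (\<Sum>js\<in>distinct_tuples m B. prod_list (map W js) * (\<Sum>j\<in>B. W j))"
    unfolding sum_distinct_tuples_Suc[OF assms(1)]
    by (intro sum_mono mult_left_mono sum_mono2 prod_list_nonneg_real) (use assms in auto)
  also have "\<dots> = (\<Sum>js\<in>distinct_tuples m B. prod_list (map W js)) * (\<Sum>j\<in>B. W j)"
    by (simp add: sum_distrib_right)
  also have "\<dots> \<le> (\<Sum>j\<in>B. W j) ^ m * (\<Sum>j\<in>B. W j)"
    by (rule mult_right_mono[OF Suc]) (simp add: assms sum_nonneg)
  finally show ?case by (simp add: mult.commute)
qed simp

text \<open>Applying Markov's inequality to this sum treats light and heavy variables at once: the set \<open>A\<close>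
  collects the few variables that label many wires.\<close>

lemma sum_distinct_tuples_ge:
  fixes W :: "'a \<Rightarrow> real"
  assumes "finite B" "\<And>j. 0 \<le> W j" "0 \<le> w"
    and heavy: "\<And>A. A \<subseteq> B \<Longrightarrow> card A < m \<Longrightarrow> w \<le> (\<Sum>j\<in>B - A. W j)"
  shows "w ^ m \<le> (\<Sum>js\<in>distinct_tuples m B. prod_list (map W js))"
  using heavy
proof (induction m)
  case (Suc m)
  have "w ^ m * w \<le> (\<Sum>js\<in>distinct_tuples m B. prod_list (map W js)) * w"
    by (rule mult_right_mono[OF Suc.IH assms(3)]) (use Suc.prems in auto)
  also have "\<dots> = (\<Sum>js\<in>distinct_tuples m B. prod_list (map W js) * w)"
    by (simp add: sum_distrib_right)
  also have "\<dots> \<le> (\<Sum>js\<in>distinct_tuples m B. prod_list (map W js) * (\<Sum>j\<in>B - set js. W j))"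
  proof (intro sum_mono mult_left_mono prod_list_nonneg_real assms(2))
    fix js assume "js \<in> distinct_tuples m B"
    then show "w \<le> (\<Sum>j\<in>B - set js. W j)"
      by (intro Suc.prems) (auto simp: distinct_tuples_def distinct_card)
  qed
  finally show ?case using sum_distinct_tuples_Suc[OF assms(1), of W m] by (simp add: mult.commute)
qed simp

lemma live_wires_sum:
  assumes "finite D"
  shows "live_wires C D = (\<Sum>j\<in>D. live_wires C {j})"
proof -
  have "length (filter (\<lambda>lit. lit_var lit \<in> D) ls) = (\<Sum>j\<in>D. length (filter (\<lambda>lit. lit_var lit \<in> {j}) ls))" for ls
  proof (induction ls)
    case (Cons lit ls)
    have "(\<Sum>j\<in>D. length (filter (\<lambda>lit. lit_var lit \<in> {j}) (lit # ls)))
        = (\<Sum>j\<in>D. (if j = lit_var lit then 1 else 0) + length (filter (\<lambda>lit. lit_var lit \<in> {j}) ls))"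
      by (intro sum.cong) auto
    also have "\<dots> = (if lit_var lit \<in> D then 1 else 0) + length (filter (\<lambda>lit. lit_var lit \<in> D) ls)"
      using assms Cons by (simp add: sum.distrib)
    finally show ?case by simp
  qed simp
  then show ?thesis by (simp add: live_wires_def)
qed

text \<open>Position \<open>j\<close> is described by a codeword of \<open>s\<close> symbols
  \<open>\<alpha> b j\<close> with \<open>g\<close> bits each. These select the
  \<open>s = c * \<kappa>\<close> input bits of the XOR of \<open>c\<close> tables with
  \<open>\<kappa>\<close> address bits, all stored in \<open>T\<close>. There are
  \<open>2 ^ \<tau>\<close> blocks.\<close>

locale xor_generator =
  fixes n g s a c \<kappa> \<tau> :: nat and \<alpha> :: "nat \<Rightarrow> nat \<Rightarrow> bool list" and T :: "bool list"
  assumes s: "s = c * \<kappa>" "0 < s"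
    and \<alpha>_length: "length (\<alpha> b j) = g"
    and \<alpha>_agree: "j < n \<Longrightarrow> j' < n \<Longrightarrow> j \<noteq> j' \<Longrightarrow> card {b. b < s \<and> \<alpha> b j = \<alpha> b j'} < a"
begin

text \<open>The cell \<open>v\<close> in row \<open>b\<close> of array \<open>i\<close>. For fixed
  \<open>i\<close>, the cells \<open>pos i b (\<alpha> b j)\<close> with \<open>b < s\<close> form
  the design set of \<open>j\<close>; two such sets meet exactly in the rows where the codewords
  agree. The block seeds use one array per block, the hash key one array per hash bit.\<close>

definition pos :: "nat \<Rightarrow> nat \<Rightarrow> bool list \<Rightarrow> nat" where
  "pos i b v = (i * s + b) * 2 ^ g + bnum v"

lemma pos_inj:
  assumes "b < s" "b' < s" "length v = g" "length v' = g" "pos i b v = pos i' b' v'"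
  shows "i = i' \<and> b = b' \<and> v = v'"
proof -
  have "bnum v < 2 ^ g" "bnum v' < 2 ^ g"
    using bnum_less[of v] bnum_less[of v'] assms(3,4) by simp_all
  then have "i * s + b = i' * s + b' \<and> bnum v = bnum v'"
    using assms(5) unfolding pos_def by (rule mixed_radix_inj)
  then show ?thesis using mixed_radix_inj[OF assms(1,2)] bnum_inj assms(3,4) by metis
qed

lemma pos_less:
  assumes "i < t" "b < s" "length v = g"
  shows "pos i b v < t * s * 2 ^ g"
proof -
  have "bnum v < 2 ^ g" using bnum_less[of v] assms(3) by simp
  then show ?thesis unfolding pos_def
    by (intro mixed_radix_less assms(1,2))
qed

section \<open>Tabulation hashing of the codewords\<close>

definition hash_bit :: "bool list \<Rightarrow> nat \<Rightarrow> nat \<Rightarrow> bool" where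
  "hash_bit H j e = parity (map (\<lambda>b. H ! pos e b (\<alpha> b j)) [0..<s])"

definition block :: "bool list \<Rightarrow> nat \<Rightarrow> nat" where
  "block H j = bnum (map (hash_bit H j) [0..<\<tau>])"

lemma block_less: "block H j < 2 ^ \<tau>"
  using bnum_less[of "map (hash_bit H j) [0..<\<tau>]"] by (simp add: block_def)

text \<open>There are at most \<open>k * k\<close> pairs, and each of them spoils at most
  \<open>a - 1\<close> of the \<open>s\<close> coordinates.\<close>

lemma separating_coordinate:
  assumes "distinct js" "set js \<subseteq> {..<n}" "length js = k" "k * k * a \<le> s"
  shows "\<exists>b<s. inj_on (\<alpha> b) (set js)"
\<comment> \<open>Two distinct entries are what yields \<open>a \<noteq> 0\<close> below; for
  \<open>k \<le> 1\<close> there are none, and any coordinate separates.\<close>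
proof (cases "k \<le> 1")
  case True
  then have "\<exists>x. set js \<subseteq> {x}"
    using assms(3) by (cases js) auto
  then have "inj_on (\<alpha> 0) (set js)" by (auto simp: inj_on_def)
  then show ?thesis using s(2) by blast
next
  case False
  define Q where "Q = {p \<in> set js \<times> set js. fst p \<noteq> snd p}"
  have finQ: "finite Q" by (rule finite_subset[of _ "set js \<times> set js"]) (auto simp: Q_def)
  have cardQ: "card Q \<le> k * k"
  proof -
    have "card Q \<le> card (set js \<times> set js)" by (rule card_mono) (auto simp: Q_def)
    then show ?thesis using distinct_card[OF assms(1)] assms(3) by (simp add: card_cartesian_product)
  qed
  define F where "F = (\<lambda>p. {b. b < s \<and> \<alpha> b (fst p) = \<alpha> b (snd p)})"
  have F: "card (F p) \<le> a - 1" if "p \<in> Q" for p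
  proof -
    have "fst p < n" "snd p < n" "fst p \<noteq> snd p" using that assms(2) by (auto simp: Q_def)
    then have "card (F p) < a" unfolding F_def by (rule \<alpha>_agree)
    then show ?thesis by simp
  qed
  have "a \<noteq> 0"
  proof -
    obtain j j' where j: "j \<in> set js" "j' \<in> set js" "j \<noteq> j'"
      using False assms(1,3) by (cases js; cases "tl js") auto
    then have "j < n" "j' < n" using assms(2) by auto
    then have "card {b. b < s \<and> \<alpha> b j = \<alpha> b j'} < a" using j(3) by (rule \<alpha>_agree)
    then show ?thesis by (rule gr_implies_not_zero)
  qed
  have "card (\<Union>p\<in>Q. F p) \<le> (\<Sum>p\<in>Q. card (F p))" by (rule card_UN_le[OF finQ])
  also have "\<dots> \<le> card Q * (a - 1)" using sum_bounded_above[OF F] by simp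
  also have "\<dots> \<le> k * k * (a - 1)" using cardQ by (rule mult_le_mono1)
  also have "\<dots> < k * k * a" using False \<open>a \<noteq> 0\<close> by simp
  also have "\<dots> \<le> card {..<s}" using assms(4) by simp
  finally have "\<not> {..<s} \<subseteq> (\<Union>p\<in>Q. F p)"
    using card_mono[of "\<Union>p\<in>Q. F p" "{..<s}"] finQ by (auto simp: F_def)
  then obtain b where b: "b < s" "b \<notin> (\<Union>p\<in>Q. F p)" by auto
  have "inj_on (\<alpha> b) (set js)"
  proof (rule inj_onI, rule ccontr)
    fix x y assume xy: "x \<in> set js" "y \<in> set js" "\<alpha> b x = \<alpha> b y" "x \<noteq> y"
    then have "(x, y) \<in> Q" by (simp add: Q_def)
    moreover have "b \<in> F (x, y)" using xy b by (simp add: F_def)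
    ultimately show False using b by blast
  qed
  then show ?thesis using b by blast
qed

text \<open>At a coordinate \<open>b0\<close> that separates \<open>js\<close>, every
  \<open>j\<close> reads a cell of its own in each array. This cell is a private pivot for the hash
  bit, so the \<open>\<tau> * k\<close> hash bits involved are independent.\<close>

lemma avg_block_collision:
  assumes "distinct js" "set js \<subseteq> {..<n}" "length js = k" "k * k * a \<le> s"
  shows "avg (\<tau> * s * 2 ^ g) (\<lambda>H. of_bool (\<forall>j\<in>set js. block H j = i)) \<le> 1 / 2 ^ (\<tau> * k)"
proof (cases "i < 2 ^ \<tau>")
  case False
  \<comment> \<open>No position is hashed to an index out of range, so the event occurs only for
    empty \<open>js\<close>, where \<open>k = 0\<close>.\<close>
  then have "block H j \<noteq> i" for H j using block_less[of H j] by auto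
  then have eq: "(\<forall>j\<in>set js. block H j = i) \<longleftrightarrow> js = []" for H
    by (cases js) auto
  show ?thesis unfolding eq using assms(3) by (cases js) simp_all
next
  case True
  then obtain \<beta> where \<beta>: "length \<beta> = \<tau>" "bnum \<beta> = i"
    using bij_betw_bnum[of \<tau>] unfolding bij_betw_def by (metis imageE lessThan_iff mem_bitstrings)
  obtain b0 where b0: "b0 < s" "inj_on (\<alpha> b0) (set js)"
    using separating_coordinate[OF assms] by blast
  define is' where "is' = List.product [0..<\<tau>] js"
  define P where "P = (\<lambda>(e, j). map (\<lambda>b. pos e b (\<alpha> b j)) [0..<s])"
  define piv where "piv = (\<lambda>(e, j). pos e b0 (\<alpha> b0 j))"
  have is': "set is' = {..<\<tau>} \<times> set js" "distinct is'" "length is' = \<tau> * k"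
    using assms by (auto simp: is'_def distinct_product)
  have "avg (\<tau> * s * 2 ^ g) (\<lambda>H. of_bool (\<forall>j\<in>set js. block H j = i))
      \<le> avg (\<tau> * s * 2 ^ g) (\<lambda>H. of_bool (\<forall>p\<in>set is'. parity (map ((!) H) (P p)) = \<beta> ! fst p))"
  proof (rule avg_mono)
    fix H :: "bool list"
    have "parity (map ((!) H) (P p)) = \<beta> ! fst p"
      if coll: "\<forall>j\<in>set js. block H j = i" and p: "p \<in> set is'" for p
    proof -
      obtain e j where ej: "p = (e, j)" "e < \<tau>" "j \<in> set js" using p is' by auto
      have "bnum (map (hash_bit H j) [0..<\<tau>]) = bnum \<beta>" using coll ej \<beta> by (simp add: block_def)
      then have "map (hash_bit H j) [0..<\<tau>] = \<beta>" by (intro bnum_inj) (simp_all add: \<beta>)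
      then have "hash_bit H j e = \<beta> ! e" using ej by auto
      then show ?thesis by (simp add: ej P_def hash_bit_def comp_def)
    qed
    then show "of_bool (\<forall>j\<in>set js. block H j = i)
        \<le> (of_bool (\<forall>p\<in>set is'. parity (map ((!) H) (P p)) = \<beta> ! fst p) :: real)"
      by (auto simp: of_bool_def)
  qed
  also have "\<dots> = 1 / 2 ^ length is'"
  proof (rule avg_parity_constraints[where piv = piv])
    show "distinct is'" by (rule is')
    fix p assume p: "p \<in> set is'"
    then obtain e j where ej: "p = (e, j)" "e < \<tau>" using is' by auto
    have "inj_on (\<lambda>b. pos e b (\<alpha> b j)) (set [0..<s])"
      using pos_inj \<alpha>_length by (intro inj_onI) (metis atLeastLessThan_iff set_upt)
    then have "distinct (P p)" by (simp add: ej P_def distinct_map)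
    moreover have "piv p \<in> set (P p)" using b0 by (auto simp: ej P_def piv_def)
    moreover have "\<forall>q\<in>set (P p). q < \<tau> * s * 2 ^ g"
      using pos_less[OF ej(2)] \<alpha>_length by (auto simp: ej P_def)
    ultimately show "distinct (P p) \<and> piv p \<in> set (P p) \<and> (\<forall>q\<in>set (P p). q < \<tau> * s * 2 ^ g)" by blast
  next
    fix p p' assume p: "p \<in> set is'" "p' \<in> set is'" "p \<noteq> p'"
    obtain e j where ej: "p = (e, j)" "j \<in> set js" using p is' by auto
    obtain e' j' where ej': "p' = (e', j')" "j' \<in> set js" using p is' by auto
    show "piv p \<notin> set (P p')"
    proof
      assume "piv p \<in> set (P p')"
      then obtain b where b: "b < s" "pos e b0 (\<alpha> b0 j) = pos e' b (\<alpha> b j')"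
        by (auto simp: ej ej' P_def piv_def)
      then have "e = e'" "b0 = b" "\<alpha> b0 j = \<alpha> b j'"
        using pos_inj[OF b0(1) b(1) \<alpha>_length \<alpha>_length b(2)] by auto
      then have "j = j'" using b0(2) ej ej' by (auto dest: inj_onD)
      then show False using p(3) ej ej' \<open>e = e'\<close> by simp
    qed
  qed
  finally show ?thesis by (simp only: is'(3))
qed

text \<open>All wires of one variable fall into the same block whatever the key, so a variable
  labelling more than \<open>w\<close> wires always overloads its block. Up to \<open>k\<close>
  variables per block are exempted here and queried in \<open>branching_class\<close>.\<close>

definition balanced :: "nat \<Rightarrow> nat \<Rightarrow> comparator_circuit \<Rightarrow> bool list \<Rightarrow> bool" where
  "balanced k w C H \<longleftrightarrow> (\<forall>i<2 ^ \<tau>. \<exists>A. A \<subseteq> {..<n} \<and> card A \<le> k \<and>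
     live_wires C ({j. j < n \<and> block H j = i} - A) \<le> w)"

text \<open>In an overloaded block even the removal of any \<open>k\<close> variables leaves more
  than \<open>w\<close> wires, so its sum over injective \<open>k\<close>-tuples is at least
  \<open>w ^ k\<close>. By independence of the hash the mean of this sum is at most
  \<open>(num_wires C / 2 ^ \<tau>) ^ k\<close>; Markov's inequality is then summed over the
  blocks.\<close>

lemma avg_unbalanced:
  assumes wf: "wf_comparator_circuit n C" and k: "k * k * a \<le> s" and w: "0 < w"
  shows "avg (\<tau> * s * 2 ^ g) (\<lambda>H. of_bool (\<not> balanced k w C H))
    \<le> 2 ^ \<tau> * (real (num_wires C) / (2 ^ \<tau> * real w)) ^ k"
proof -
  define W where "W = (\<lambda>j. real (live_wires C {j}))"
  define B where "B = (\<lambda>H i. {j. j < n \<and> block H j = i})"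
  define S where "S = (\<lambda>H i. \<Sum>js\<in>distinct_tuples k {..<n}. prod_list (map W js) * of_bool (\<forall>j\<in>set js. block H j = i))"
  have W: "0 \<le> W j" for j by (simp add: W_def)
  have live: "real (live_wires C D) = (\<Sum>j\<in>D. W j)" if "finite D" for D
    using live_wires_sum[OF that, of C] by (simp add: W_def)
  have "live_wires C {..<n} = num_wires C"
  proof -
    have "filter (\<lambda>lit. lit_var lit \<in> {..<n}) (wire_labels C) = wire_labels C"
      by (rule filter_True) (use wf in \<open>simp add: wf_comparator_circuit_def\<close>)
    then show ?thesis by (simp only: live_wires_def num_wires_def)
  qed
  then have total: "(\<Sum>j<n. W j) = real (num_wires C)" using live[of "{..<n}"] by simp
  have finB: "finite (B H i)" for H i by (simp add: B_def)
  have S_eq: "S H i = (\<Sum>js\<in>distinct_tuples k (B H i). prod_list (map W js))" for H i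
  proof -
    have "distinct_tuples k (B H i) = {js \<in> distinct_tuples k {..<n}. \<forall>j\<in>set js. block H j = i}"
      by (auto simp: distinct_tuples_def B_def)
    then show ?thesis
      by (simp add: S_def of_bool_def if_distrib sum.If_cases finite_distinct_tuples Int_def cong: if_cong)
  qed
  have S_nonneg: "0 \<le> S H i" for H i
    unfolding S_eq by (intro sum_nonneg prod_list_nonneg_real W)
  have avg_S: "avg (\<tau> * s * 2 ^ g) (\<lambda>H. S H i) \<le> real (num_wires C) ^ k / 2 ^ (\<tau> * k)" for i
  proof -
    have "avg (\<tau> * s * 2 ^ g) (\<lambda>H. S H i) = (\<Sum>js\<in>distinct_tuples k {..<n}. prod_list (map W js) *
        avg (\<tau> * s * 2 ^ g) (\<lambda>H. of_bool (\<forall>j\<in>set js. block H j = i)))"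
      unfolding S_def avg_sum avg_cmult ..
    also have "\<dots> \<le> (\<Sum>js\<in>distinct_tuples k {..<n}. prod_list (map W js) * (1 / 2 ^ (\<tau> * k)))"
      by (intro sum_mono mult_left_mono avg_block_collision[OF _ _ _ k] prod_list_nonneg_real W)
        (auto simp: distinct_tuples_def)
    also have "\<dots> = (\<Sum>js\<in>distinct_tuples k {..<n}. prod_list (map W js)) * (1 / 2 ^ (\<tau> * k))"
      by (rule sum_distrib_right[symmetric])
    also have "\<dots> \<le> (\<Sum>j<n. W j) ^ k * (1 / 2 ^ (\<tau> * k))"
      by (intro mult_right_mono sum_distinct_tuples_le W) simp_all
    finally show ?thesis by (simp add: total)
  qed
  have "avg (\<tau> * s * 2 ^ g) (\<lambda>H. of_bool (\<not> balanced k w C H))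
      \<le> avg (\<tau> * s * 2 ^ g) (\<lambda>H. (\<Sum>i<2 ^ \<tau>. S H i / real w ^ k))"
  proof (rule avg_mono)
    fix H :: "bool list"
    have nonneg: "0 \<le> S H i / real w ^ k" for i using S_nonneg by simp
    show "of_bool (\<not> balanced k w C H) \<le> (\<Sum>i<2 ^ \<tau>. S H i / real w ^ k)"
    proof (cases "balanced k w C H")
      case True
      then show ?thesis using nonneg by (simp add: sum_nonneg)
    next
      case False
      then obtain i where i: "i < 2 ^ \<tau>"
        "\<And>A. A \<subseteq> {..<n} \<Longrightarrow> card A \<le> k \<Longrightarrow> w < live_wires C (B H i - A)"
        unfolding balanced_def B_def by (meson not_le)
      have "real w ^ k \<le> S H i"
        unfolding S_eq
      proof (rule sum_distinct_tuples_ge[OF finB W])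
        fix A assume A: "A \<subseteq> B H i" "card A < k"
        then have "w < live_wires C (B H i - A)" by (intro i(2)) (auto simp: B_def)
        then show "real w \<le> (\<Sum>j\<in>B H i - A. W j)"
          using live[of "B H i - A"] finB by simp
      qed simp
      then have "1 \<le> S H i / real w ^ k" using w by simp
      also have "\<dots> \<le> (\<Sum>i<2 ^ \<tau>. S H i / real w ^ k)"
        by (rule member_le_sum) (use i(1) nonneg in auto)
      finally show ?thesis using False by simp
    qed
  qed
  also have "\<dots> = (\<Sum>i<2 ^ \<tau>. avg (\<tau> * s * 2 ^ g) (\<lambda>H. S H i) / real w ^ k)"
    unfolding avg_sum avg_divide ..
  also have "\<dots> \<le> (\<Sum>i<(2::nat) ^ \<tau>. real (num_wires C) ^ k / 2 ^ (\<tau> * k) / real w ^ k)"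
    by (intro sum_mono divide_right_mono avg_S) simp
  also have "\<dots> = 2 ^ \<tau> * (real (num_wires C) / (2 ^ \<tau> * real w)) ^ k"
    by (simp add: power_divide power_mult power_mult_distrib)
  finally show ?thesis .
qed

section \<open>The hybrid argument\<close>

definition gen_bit :: "(nat \<Rightarrow> nat) \<Rightarrow> bool list \<Rightarrow> nat \<Rightarrow> bool" where
  "gen_bit h \<sigma> j = xor_tables c \<kappa> T (map (\<lambda>b. \<sigma> ! pos (h j) b (\<alpha> b j)) [0..<s])"

text \<open>Fix the seed outside the positions \<open>ps\<close> read for bit \<open>i\<close>: every earlier bit of the same block then
  depends on at most \<open>a\<close> bits of \<open>u\<close>, and all bits of other blocks are constant.\<close>

lemma predictor_in_class:
  assumes wf: "wf_comparator_circuit n C" and i: "i < n"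
    and bal: "A \<subseteq> {..<n}" "card A \<le> k" "live_wires C ({j. j < n \<and> h j = h i} - A) \<le> w" "0 < w"
    and \<sigma>: "length \<sigma> = t * s * 2 ^ g" "h i < t" and x: "length x = n"
  defines "ps \<equiv> map (\<lambda>b. pos (h i) b (\<alpha> b i)) [0..<s]"
  shows "\<exists>f\<in>branching_class k (network_class w (juntas s a)) (juntas s a). \<forall>u. length u = s \<longrightarrow>
    f u = eval_comparator C (map (\<lambda>j. if j < i then gen_bit h (upds \<sigma> ps u) j else if j = i then v else x ! j) [0..<n])"
proof -
  define J where "J = juntas s a"
  have J: "(\<lambda>_. b) \<in> J" for b using juntas_const[OF s(2)] by (simp add: J_def)
  have J': "bot \<in> J" "top \<in> J" using J[of False] J[of True] by (simp_all add: bot_fun_def top_fun_def)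
  have ps: "distinct ps" "length ps = s" "\<forall>p\<in>set ps. p < length \<sigma>"
  proof -
    have "inj_on (\<lambda>b. pos (h i) b (\<alpha> b i)) (set [0..<s])"
      using pos_inj \<alpha>_length by (intro inj_onI) (metis atLeastLessThan_iff set_upt)
    then show "distinct ps" by (simp add: ps_def distinct_map)
    show "length ps = s" by (simp add: ps_def)
    show "\<forall>p\<in>set ps. p < length \<sigma>" using pos_less[OF \<sigma>(2)] \<alpha>_length \<sigma>(1) by (auto simp: ps_def)
  qed
  have val: "upds \<sigma> ps u ! pos i' b v' =
      (if i' = h i \<and> v' = \<alpha> b i then u ! b else \<sigma> ! pos i' b v')"
    if "length u = s" "b < s" "length v' = g" for u i' b v'
  proof (cases "i' = h i \<and> v' = \<alpha> b i")
    case True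
    then have "pos i' b v' = ps ! b" using that by (simp add: ps_def)
    then show ?thesis using upds_nth[of ps u b \<sigma>] ps that True by simp
  next
    case False
    have "pos i' b v' \<notin> set ps"
    proof
      assume "pos i' b v' \<in> set ps"
      then obtain b' where "b' < s" "pos i' b v' = pos (h i) b' (\<alpha> b' i)" by (auto simp: ps_def)
      then show False using pos_inj[OF that(2) _ that(3) \<alpha>_length] False by metis
    qed
    then show ?thesis unfolding if_not_P[OF False] by (rule upds_nth_notin)
  qed
  \<comment> \<open>Earlier bits of the same block become juntas, earlier bits of other blocks are
    determined by \<open>\<sigma>\<close>, bit \<open>i\<close> is \<open>v\<close>, and later bits
    come from \<open>x\<close>.\<close>
  have "\<exists>y\<in>J. (\<forall>u. length u = s \<longrightarrow>
      y u = (if j < i then gen_bit h (upds \<sigma> ps u) j else if j = i then v else x ! j)) \<and>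
      (j \<notin> {j. j < n \<and> h j = h i} \<longrightarrow> y = bot \<or> y = top)" if "j < n" for j
  proof (cases "j < i \<and> h j = h i")
    case False
    define b where "b = (if j < i then gen_bit h \<sigma> j else if j = i then v else x ! j)"
    have "gen_bit h (upds \<sigma> ps u) j = gen_bit h \<sigma> j" if "length u = s" "j < i" for u
    proof -
      have "map (\<lambda>b. upds \<sigma> ps u ! pos (h j) b (\<alpha> b j)) [0..<s] = map (\<lambda>b. \<sigma> ! pos (h j) b (\<alpha> b j)) [0..<s]"
        by (rule map_cong) (use val[OF that(1) _ \<alpha>_length] False that in auto)
      then show ?thesis by (simp only: gen_bit_def)
    qed
    then have "(\<forall>u. length u = s \<longrightarrow>
      (\<lambda>_. b) u = (if j < i then gen_bit h (upds \<sigma> ps u) j else if j = i then v else x ! j))"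
      by (simp add: b_def)
    moreover have "(\<lambda>_::bool list. b) = bot \<or> (\<lambda>_::bool list. b) = top"
      by (cases b) (simp_all add: bot_fun_def top_fun_def)
    ultimately show ?thesis by (intro bexI[OF _ J[of b]] conjI impI)
  next
    case True
    have "\<exists>y\<in>juntas s a. \<forall>u. length u = s \<longrightarrow> y u = gen_bit h (upds \<sigma> ps u) j"
    \<comment> \<open>The resampled cells form the design set of \<open>i\<close>, so bit
      \<open>j\<close> sees them only in the rows where the two codewords agree.\<close>
    proof (rule juntas_approx[OF s(2)])
      show "{b. b < s \<and> \<alpha> b j = \<alpha> b i} \<subseteq> {..<s}" by auto
      show "card {b. b < s \<and> \<alpha> b j = \<alpha> b i} \<le> a"
        using \<alpha>_agree[of j i] True i by simp
      fix u u' :: "bool list"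
      assume u: "length u = s" "length u' = s"
        and eq: "\<And>b. b \<in> {b. b < s \<and> \<alpha> b j = \<alpha> b i} \<Longrightarrow> u ! b = u' ! b"
      have "map (\<lambda>b. upds \<sigma> ps u ! pos (h j) b (\<alpha> b j)) [0..<s]
          = map (\<lambda>b. upds \<sigma> ps u' ! pos (h j) b (\<alpha> b j)) [0..<s]"
      proof (rule map_cong)
        fix b assume "b \<in> set [0..<s]"
        then have b: "b < s" by simp
        show "upds \<sigma> ps u ! pos (h j) b (\<alpha> b j) = upds \<sigma> ps u' ! pos (h j) b (\<alpha> b j)"
          using val[OF u(1) b \<alpha>_length] val[OF u(2) b \<alpha>_length] eq[of b] b by simp
      qed simp
      then show "gen_bit h (upds \<sigma> ps u) j = gen_bit h (upds \<sigma> ps u') j" by (simp only: gen_bit_def)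
    qed
    then obtain y where y: "y \<in> J" "\<forall>u. length u = s \<longrightarrow> y u = gen_bit h (upds \<sigma> ps u) j"
      unfolding J_def by (rule bexE)
    show ?thesis
    proof (intro bexI[OF _ y(1)] conjI impI)
      show "\<forall>u. length u = s \<longrightarrow>
          y u = (if j < i then gen_bit h (upds \<sigma> ps u) j else if j = i then v else x ! j)"
        using y(2) True by simp
      show "y = bot \<or> y = top" if "j \<notin> {j. j < n \<and> h j = h i}"
        using that True \<open>j < n\<close> by simp
    qed
  qed
  then have "\<forall>j\<in>{..<n}. \<exists>y. y \<in> J \<and> (\<forall>u. length u = s \<longrightarrow>
      y u = (if j < i then gen_bit h (upds \<sigma> ps u) j else if j = i then v else x ! j)) \<and>
      (j \<notin> {j. j < n \<and> h j = h i} \<longrightarrow> y = bot \<or> y = top)"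
    by (simp only: lessThan_iff Bex_def) blast
  from bchoice[OF this] obtain Y where YY: "\<forall>j\<in>{..<n}. Y j \<in> J \<and> (\<forall>u. length u = s \<longrightarrow>
      Y j u = (if j < i then gen_bit h (upds \<sigma> ps u) j else if j = i then v else x ! j)) \<and>
      (j \<notin> {j. j < n \<and> h j = h i} \<longrightarrow> Y j = bot \<or> Y j = top)"
    by (rule exE)
  have Y: "\<And>j. j < n \<Longrightarrow> Y j \<in> J"
    "\<And>j u. j < n \<Longrightarrow> length u = s \<Longrightarrow>
      Y j u = (if j < i then gen_bit h (upds \<sigma> ps u) j else if j = i then v else x ! j)"
    "\<And>j. j < n \<Longrightarrow> j \<notin> {j. j < n \<and> h j = h i} \<Longrightarrow> Y j = bot \<or> Y j = top"
    using YY lessThan_iff by metis+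
  have "(\<lambda>u. eval_comparator C (map (\<lambda>j. Y j u) [0..<n])) \<in> branching_class k (network_class w J) J"
    by (rule eval_comparator_branching[OF wf J' _ Y(1) Y(3) bal(1,2,3,4)])
      (simp_all add: J_def juntas_compl)
  moreover have "eval_comparator C (map (\<lambda>j. Y j u) [0..<n]) =
      eval_comparator C (map (\<lambda>j. if j < i then gen_bit h (upds \<sigma> ps u) j else if j = i then v else x ! j) [0..<n])"
    if "length u = s" for u
  proof -
    have "map (\<lambda>j. Y j u) [0..<n] =
      map (\<lambda>j. if j < i then gen_bit h (upds \<sigma> ps u) j else if j = i then v else x ! j) [0..<n]"
      by (rule map_cong) (use Y(2) that in auto)
    then show ?thesis by (simp only:)
  qed
  ultimately show ?thesis unfolding J_def
    by (intro bexI[of _ "\<lambda>u. eval_comparator C (map (\<lambda>j. Y j u) [0..<n])"] allI impI)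
qed

definition hybrid :: "(nat \<Rightarrow> nat) \<Rightarrow> bool list \<Rightarrow> nat \<Rightarrow> bool list \<Rightarrow> bool list" where
  "hybrid h \<sigma> i x = map (\<lambda>j. if j < i then gen_bit h \<sigma> j else x ! j) [0..<n]"

text \<open>Replacing a random bit by a generated one changes the acceptance probability by half the
  difference of two correlations of the XOR function, namely with the circuit whose bit
  \<open>i\<close> is set to \<open>False\<close> and to \<open>True\<close>. All remaining
  randomness is fixed and averaged over at the end.\<close>

lemma hybrid_step:
  assumes wf: "wf_comparator_circuit n C" and i: "i < n"
    and bal: "A \<subseteq> {..<n}" "card A \<le> k" "live_wires C ({j. j < n \<and> h j = h i} - A) \<le> w" "0 < w"
    and h: "h i < t"
    and hard: "\<And>f. f \<in> branching_class k (network_class w (juntas s a)) (juntas s a) \<Longrightarrow>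
      \<bar>avg s (\<lambda>u. of_bool (f u) * signb (xor_tables c \<kappa> T u))\<bar> \<le> \<delta>"
  defines "M \<equiv> t * s * 2 ^ g"
  shows "\<bar>avg M (\<lambda>\<sigma>. avg n (\<lambda>x. of_bool (eval_comparator C (hybrid h \<sigma> (Suc i) x))))
    - avg M (\<lambda>\<sigma>. avg n (\<lambda>x. of_bool (eval_comparator C (hybrid h \<sigma> i x))))\<bar> \<le> \<delta>"
proof -
  define F where "F = (\<lambda>\<sigma> x v. of_bool (eval_comparator C
    (map (\<lambda>j. if j < i then gen_bit h \<sigma> j else if j = i then v else x ! j) [0..<n])) :: real)"
  \<comment> \<open>The value at a bit \<open>b\<close> minus the mean of both values is
    \<open>signb b\<close> times half the difference of the values at \<open>False\<close> and
    \<open>True\<close>.\<close>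
  define D where "D = (\<lambda>\<sigma> x. signb (gen_bit h \<sigma> i) * ((F \<sigma> x False - F \<sigma> x True) / 2))"
  have Suc: "of_bool (eval_comparator C (hybrid h \<sigma> (Suc i) x)) = F \<sigma> x (gen_bit h \<sigma> i)" for \<sigma> x
  proof -
    have "hybrid h \<sigma> (Suc i) x =
        map (\<lambda>j. if j < i then gen_bit h \<sigma> j else if j = i then gen_bit h \<sigma> i else x ! j) [0..<n]"
      unfolding hybrid_def by (rule map_cong) auto
    then show ?thesis by (simp only: F_def)
  qed
  have old: "avg n (\<lambda>x. of_bool (eval_comparator C (hybrid h \<sigma> i x))) = avg n (\<lambda>x. (F \<sigma> x True + F \<sigma> x False) / 2)" for \<sigma>
  proof -
    have "hybrid h \<sigma> i (x[i := v]) =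
        map (\<lambda>j. if j < i then gen_bit h \<sigma> j else if j = i then v else x ! j) [0..<n]"
      if "length x = n" for x v
      unfolding hybrid_def by (rule map_cong) (use that i in auto)
    then have "of_bool (eval_comparator C (hybrid h \<sigma> i (x[i := v]))) = F \<sigma> x v" if "length x = n" for x v
      using that by (simp only: F_def)
    then show ?thesis
      by (subst avg_update[OF i]) (intro avg_cong, simp)
  qed
  have "avg M (\<lambda>\<sigma>. avg n (\<lambda>x. of_bool (eval_comparator C (hybrid h \<sigma> (Suc i) x))))
      - avg M (\<lambda>\<sigma>. avg n (\<lambda>x. of_bool (eval_comparator C (hybrid h \<sigma> i x))))
      = avg M (\<lambda>\<sigma>. avg n (\<lambda>x. F \<sigma> x (gen_bit h \<sigma> i) - (F \<sigma> x True + F \<sigma> x False) / 2))"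
    by (simp only: Suc old avg_diff)
  also have "\<dots> = avg M (\<lambda>\<sigma>. avg n (\<lambda>x. D \<sigma> x))"
  proof (intro avg_cong)
    fix \<sigma> x :: "bool list"
    show "F \<sigma> x (gen_bit h \<sigma> i) - (F \<sigma> x True + F \<sigma> x False) / 2 = D \<sigma> x"
      unfolding D_def by (cases "gen_bit h \<sigma> i") (simp_all add: field_simps)
  qed
  also have "\<dots> = avg n (\<lambda>x. avg M (\<lambda>\<sigma>. D \<sigma> x))" by (rule avg_swap)
  finally have eq: "avg M (\<lambda>\<sigma>. avg n (\<lambda>x. of_bool (eval_comparator C (hybrid h \<sigma> (Suc i) x))))
      - avg M (\<lambda>\<sigma>. avg n (\<lambda>x. of_bool (eval_comparator C (hybrid h \<sigma> i x)))) = avg n (\<lambda>x. avg M (\<lambda>\<sigma>. D \<sigma> x))" .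
  define ps where "ps = map (\<lambda>b. pos (h i) b (\<alpha> b i)) [0..<s]"
  have ps: "distinct ps" "length ps = s" "\<forall>p\<in>set ps. p < M"
  proof -
    have "inj_on (\<lambda>b. pos (h i) b (\<alpha> b i)) (set [0..<s])"
      using pos_inj \<alpha>_length by (intro inj_onI) (metis atLeastLessThan_iff set_upt)
    then show "distinct ps" by (simp add: ps_def distinct_map)
    show "length ps = s" by (simp add: ps_def)
    show "\<forall>p\<in>set ps. p < M" using pos_less[OF h] \<alpha>_length by (auto simp: ps_def M_def)
  qed
  have inner: "\<bar>avg s (\<lambda>u. D (upds \<sigma> ps u) x)\<bar> \<le> \<delta>" if \<sigma>: "length \<sigma> = M" and x: "length x = n" for \<sigma> x
  proof -
    have ex: "\<exists>f\<in>branching_class k (network_class w (juntas s a)) (juntas s a).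
        \<forall>u. length u = s \<longrightarrow> of_bool (f u) = F (upds \<sigma> ps u) x v" for v
    proof -
      obtain f where f: "f \<in> branching_class k (network_class w (juntas s a)) (juntas s a)"
        "\<forall>u. length u = s \<longrightarrow> f u = eval_comparator C
          (map (\<lambda>j. if j < i then gen_bit h (upds \<sigma> ps u) j else if j = i then v else x ! j) [0..<n])"
        using predictor_in_class[OF wf i bal \<sigma>[unfolded M_def] h x, of v]
        unfolding ps_def[symmetric] by (rule bexE)
      show ?thesis
        unfolding F_def by (intro bexI[OF _ f(1)] allI impI) (use f(2) in simp)
    qed
    obtain f0 where f0: "f0 \<in> branching_class k (network_class w (juntas s a)) (juntas s a)"
      "\<forall>u. length u = s \<longrightarrow> of_bool (f0 u) = F (upds \<sigma> ps u) x False"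
      using ex[of False] by (rule bexE)
    obtain f1 where f1: "f1 \<in> branching_class k (network_class w (juntas s a)) (juntas s a)"
      "\<forall>u. length u = s \<longrightarrow> of_bool (f1 u) = F (upds \<sigma> ps u) x True"
      using ex[of True] by (rule bexE)
    have bit: "gen_bit h (upds \<sigma> ps u) i = xor_tables c \<kappa> T u" if u: "length u = s" for u
    proof -
      have "map (\<lambda>b. upds \<sigma> ps u ! pos (h i) b (\<alpha> b i)) [0..<s] = u"
      proof (rule nth_equalityI)
        fix b assume "b < length (map (\<lambda>b. upds \<sigma> ps u ! pos (h i) b (\<alpha> b i)) [0..<s])"
        then have "b < s" by simp
        then show "map (\<lambda>b. upds \<sigma> ps u ! pos (h i) b (\<alpha> b i)) [0..<s] ! b = u ! b"
          using upds_nth[of ps u b \<sigma>] ps u \<sigma> by (simp add: ps_def)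
      qed (simp add: u)
      then show ?thesis by (simp only: gen_bit_def)
    qed
    have "avg s (\<lambda>u. D (upds \<sigma> ps u) x) = avg s (\<lambda>u.
        (of_bool (f0 u) * signb (xor_tables c \<kappa> T u) - of_bool (f1 u) * signb (xor_tables c \<kappa> T u)) / 2)"
    proof (rule avg_cong)
      fix u :: "bool list" assume u: "length u = s"
      show "D (upds \<sigma> ps u) x = (of_bool (f0 u) * signb (xor_tables c \<kappa> T u)
          - of_bool (f1 u) * signb (xor_tables c \<kappa> T u)) / 2"
        unfolding D_def bit[OF u] f0(2)[rule_format, OF u, symmetric] f1(2)[rule_format, OF u, symmetric]
        by (simp add: left_diff_distrib mult.commute)
    qed
    also have "\<dots> = (avg s (\<lambda>u. of_bool (f0 u) * signb (xor_tables c \<kappa> T u))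
        - avg s (\<lambda>u. of_bool (f1 u) * signb (xor_tables c \<kappa> T u))) / 2"
      by (simp only: avg_divide avg_diff)
    finally have eq: "avg s (\<lambda>u. D (upds \<sigma> ps u) x) = (avg s (\<lambda>u. of_bool (f0 u) * signb (xor_tables c \<kappa> T u))
        - avg s (\<lambda>u. of_bool (f1 u) * signb (xor_tables c \<kappa> T u))) / 2" .
    have half: "\<bar>(p - q) / 2\<bar> \<le> \<delta>" if "\<bar>p\<bar> \<le> \<delta>" "\<bar>q\<bar> \<le> \<delta>" for p q :: real
      using that by (simp add: abs_le_iff)
    show ?thesis unfolding eq by (rule half[OF hard[OF f0(1)] hard[OF f1(1)]])
  qed
  have "\<bar>avg M (\<lambda>\<sigma>. D \<sigma> x)\<bar> \<le> \<delta>" if x: "length x = n" for x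
  proof -
    have "avg M (\<lambda>\<sigma>. D \<sigma> x) = avg M (\<lambda>\<sigma>. avg s (\<lambda>u. D (upds \<sigma> ps u) x))"
      using avg_resample[OF ps(3), of "\<lambda>\<sigma>. D \<sigma> x"] ps(2) by simp
    also have "\<bar>\<dots>\<bar> \<le> avg M (\<lambda>\<sigma>. \<bar>avg s (\<lambda>u. D (upds \<sigma> ps u) x)\<bar>)" by (rule abs_avg_le)
    also have "\<dots> \<le> \<delta>" by (rule avg_le) (rule inner[OF _ x])
    finally show ?thesis .
  qed
  then have "avg n (\<lambda>x. \<bar>avg M (\<lambda>\<sigma>. D \<sigma> x)\<bar>) \<le> \<delta>" by (rule avg_le)
  then show ?thesis unfolding eq using abs_avg_le[of n "\<lambda>x. avg M (\<lambda>\<sigma>. D \<sigma> x)"] by linarith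
qed

text \<open>The hash key is fixed before the hybrids are formed, so the blocks are known and only
  the block seeds are random; the \<open>n\<close> steps telescope.\<close>

lemma fools_fixed_hash:
  assumes wf: "wf_comparator_circuit n C"
    and bal: "balanced k w C H" and w: "0 < w"
    and hard: "\<And>f. f \<in> branching_class k (network_class w (juntas s a)) (juntas s a) \<Longrightarrow>
      \<bar>avg s (\<lambda>u. of_bool (f u) * signb (xor_tables c \<kappa> T u))\<bar> \<le> \<delta>"
  shows "\<bar>avg (2 ^ \<tau> * s * 2 ^ g) (\<lambda>\<sigma>. of_bool (eval_comparator C (map (gen_bit (block H) \<sigma>) [0..<n])))
    - accept_prob n (eval_comparator C)\<bar> \<le> real n * \<delta>"
proof -
  define M where "M = 2 ^ \<tau> * s * 2 ^ g"
  define E where "E = (\<lambda>i. avg M (\<lambda>\<sigma>. avg n (\<lambda>x. of_bool (eval_comparator C (hybrid (block H) \<sigma> i x)) :: real)))"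
  have step: "\<bar>E (Suc i) - E i\<bar> \<le> \<delta>" if i: "i < n" for i
  proof -
    obtain A where A: "A \<subseteq> {..<n}" "card A \<le> k"
      "live_wires C ({j. j < n \<and> block H j = block H i} - A) \<le> w"
      using bal block_less[of H i] unfolding balanced_def by blast
    show ?thesis
      unfolding E_def M_def by (rule hybrid_step[OF wf i A w block_less hard])
  qed
  have "\<bar>E i - E 0\<bar> \<le> real i * \<delta>" if "i \<le> n" for i
    using that
  proof (induction i)
    case (Suc i)
    then have "\<bar>E i - E 0\<bar> \<le> real i * \<delta>" "\<bar>E (Suc i) - E i\<bar> \<le> \<delta>" using step[of i] by auto
    then show ?case by (simp add: algebra_simps)
  qed simp
  then have "\<bar>E n - E 0\<bar> \<le> real n * \<delta>" by simp
  moreover have "E n = avg M (\<lambda>\<sigma>. of_bool (eval_comparator C (map (gen_bit (block H) \<sigma>) [0..<n])))"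
  proof -
    have "hybrid (block H) \<sigma> n x = map (gen_bit (block H) \<sigma>) [0..<n]" for \<sigma> x
      unfolding hybrid_def by (rule map_cong) auto
    then show ?thesis by (simp add: E_def)
  qed
  moreover have "E 0 = accept_prob n (eval_comparator C)"
  proof -
    have "hybrid (block H) \<sigma> 0 x = x" if "length x = n" for \<sigma> x
      using that by (intro nth_equalityI) (simp_all add: hybrid_def)
    then have "avg n (\<lambda>x. of_bool (eval_comparator C (hybrid (block H) \<sigma> 0 x)) :: real) = avg n (\<lambda>x. of_bool (eval_comparator C x))" for \<sigma>
      by (intro avg_cong) simp
    then show ?thesis by (simp add: E_def accept_prob_avg)
  qed
  ultimately show ?thesis by (simp add: M_def)
qed

definition generator :: "bool list \<Rightarrow> bool list" where
  "generator z = map (gen_bit (block (drop (2 ^ \<tau> * s * 2 ^ g) z)) (take (2 ^ \<tau> * s * 2 ^ g) z)) [0..<n]"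

lemma fools_generator:
  assumes k: "k * k * a \<le> s" and w: "0 < w"
    and hard: "\<And>f. f \<in> branching_class k (network_class w (juntas s a)) (juntas s a) \<Longrightarrow>
      \<bar>avg s (\<lambda>u. of_bool (f u) * signb (xor_tables c \<kappa> T u))\<bar> \<le> \<delta>"
  shows "fools (real n * \<delta> + 2 ^ \<tau> * (real l / (2 ^ \<tau> * real w)) ^ k)
    (2 ^ \<tau> * s * 2 ^ g + \<tau> * s * 2 ^ g) n generator (comparator_class n l)"
  unfolding fools_def
proof
  fix f assume "f \<in> comparator_class n l"
  then obtain C where C: "f = eval_comparator C" "wf_comparator_circuit n C" "num_wires C = l"
    unfolding comparator_class_def by blast
  define M where "M = 2 ^ \<tau> * s * 2 ^ g"
  define R where "R = \<tau> * s * 2 ^ g"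
  define Q where "Q = (\<lambda>H. avg M (\<lambda>\<sigma>. of_bool (eval_comparator C (map (gen_bit (block H) \<sigma>) [0..<n])) :: real))"
  define p where "p = accept_prob n (eval_comparator C)"
  have "accept_prob (M + R) (\<lambda>z. f (generator z)) = avg M (\<lambda>\<sigma>. avg R (\<lambda>H. of_bool (f (generator (\<sigma> @ H)))))"
    unfolding accept_prob_avg by (rule avg_append)
  also have "\<dots> = avg M (\<lambda>\<sigma>. avg R (\<lambda>H. of_bool (eval_comparator C (map (gen_bit (block H) \<sigma>) [0..<n]))))"
    by (intro avg_cong) (simp add: generator_def C(1) M_def)
  also have "\<dots> = avg R Q" unfolding Q_def by (rule avg_swap)
  finally have 1: "accept_prob (M + R) (\<lambda>z. f (generator z)) = avg R Q" .
  \<comment> \<open>As \<open>\<delta>\<close> is an arbitrary real, its sign is extracted from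
    \<open>hard\<close> at a constant predictor. Unbalanced keys are charged 1 on top of this term,
    which must therefore be nonnegative.\<close>
  have \<delta>: "0 \<le> real n * \<delta>"
  proof -
    show ?thesis
    proof (cases "n = 0")
      case False
      define y where "y = (\<lambda>_ :: bool list. False)"
      have y: "y \<in> juntas s a" unfolding y_def by (rule juntas_const[OF s(2)])
      have "y \<in> network_class w (juntas s a)"
        unfolding network_class_def using w y
        by (intro CollectI exI[of _ "replicate w y"] exI[of _ "replicate (w * w) (0, 0)"] exI[of _ 0])
          (auto simp: funpow_fgate_idle)
      then have "y \<in> branching_class k (network_class w (juntas s a)) (juntas s a)"
        unfolding branching_class_def using y
        by (intro CollectI exI[of _ "replicate k y"] exI[of _ "\<lambda>_\<in>bitstrings k. y"]) auto
      from hard[OF this] show ?thesis by simp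
    qed simp
  qed
  have "\<bar>Q H - p\<bar> \<le> real n * \<delta> + of_bool (\<not> balanced k w C H)" for H
  proof (cases "balanced k w C H")
    case True
    then show ?thesis
      using fools_fixed_hash[OF C(2) True w hard] by (simp add: Q_def p_def M_def)
  next
    case False
    have "0 \<le> Q H" "Q H \<le> 1" unfolding Q_def by (rule avg_nonneg avg_le, simp)+
    moreover have "0 \<le> p" "p \<le> 1" unfolding p_def accept_prob_avg by (rule avg_nonneg avg_le, simp)+
    ultimately show ?thesis using False \<delta> by simp
  qed
  then have "avg R (\<lambda>H. \<bar>Q H - p\<bar>) \<le> avg R (\<lambda>H. real n * \<delta> + of_bool (\<not> balanced k w C H))"
    by (intro avg_mono)
  also have "\<dots> = real n * \<delta> + avg R (\<lambda>H. of_bool (\<not> balanced k w C H))"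
    by (simp only: avg_add avg_const)
  also have "\<dots> \<le> real n * \<delta> + 2 ^ \<tau> * (real l / (2 ^ \<tau> * real w)) ^ k"
    using avg_unbalanced[OF C(2) k w] C(3) by (simp add: R_def)
  finally have "avg R (\<lambda>H. \<bar>Q H - p\<bar>) \<le> real n * \<delta> + 2 ^ \<tau> * (real l / (2 ^ \<tau> * real w)) ^ k" .
  moreover have "\<bar>avg R Q - p\<bar> \<le> avg R (\<lambda>H. \<bar>Q H - p\<bar>)"
    using abs_avg_le[of R "\<lambda>H. Q H - p"] by (simp add: avg_diff)
  ultimately show "\<bar>accept_prob (2 ^ \<tau> * s * 2 ^ g + \<tau> * s * 2 ^ g) (\<lambda>z. f (generator z)) - accept_prob n f\<bar>
      \<le> real n * \<delta> + 2 ^ \<tau> * (real l / (2 ^ \<tau> * real w)) ^ k"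
    using 1 by (simp add: p_def C(1) M_def R_def)
qed

text \<open>For fixed \<open>z\<close> the seed, the hash key and the tables are constants of the
  circuit. Only the position is input, and every access is a lookup on few computed bits.\<close>

lemma generator_circuit:
  assumes "\<And>b e. b < s \<Longrightarrow> e < g \<Longrightarrow> circuit_computes N q (\<lambda>y. \<alpha>' b y ! e)"
    and \<alpha>': "\<And>b y. length (\<alpha>' b y) = g"
    and y: "\<And>j b. j < n \<Longrightarrow> \<alpha>' b (index_bits n j) = \<alpha> b j" and N: "N = ceillog2 n"
  shows "\<exists>D. circuit_size D \<le> s * (\<tau> * (s * (g * q + 5 * 2 ^ g + 20) + 1) + g * q + 5 * 2 ^ (\<tau> + g))
      + (c * (5 * 2 ^ \<kappa> + 20) + 1) \<and> computes_bits n D (generator z)"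
proof -
  define \<sigma> where "\<sigma> = take (2 ^ \<tau> * s * 2 ^ g) z"
  define H where "H = drop (2 ^ \<tau> * s * 2 ^ g) z"
  define hb where "hb = (\<lambda>e y. parity (map (\<lambda>b. H ! pos e b (\<alpha>' b y)) [0..<s]))"
  define uv where "uv = (\<lambda>b y. \<sigma> ! pos (bnum (map (\<lambda>e. hb e y) [0..<\<tau>])) b (\<alpha>' b y))"
  have symb: "map (\<lambda>e. \<alpha>' b y ! e) [0..<g] = \<alpha>' b y" for b y
    using \<alpha>'[of b y] by (metis map_nth)
  \<comment> \<open>For fixed \<open>e\<close> and \<open>b\<close> only the symbol varies, so
    \<open>2 ^ g\<close> entries suffice. The seed lookup below needs
    \<open>2 ^ (\<tau> + g)\<close>, since the block index is itself computed.\<close>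
  have table: "circuit_computes N (g * q + 5 * 2 ^ g) (\<lambda>y. H ! pos e b (\<alpha>' b y))" if "b < s" for b e
  proof -
    have "circuit_computes N ((\<Sum>e'<g. q) + 5 * 2 ^ g)
        (\<lambda>y. (\<lambda>v. H ! pos e b v) (map (\<lambda>e'. \<alpha>' b y ! e') [0..<g]))"
      by (rule circuit_computes_comp[OF _ circuit_computes_table]) (rule assms(1)[OF that])
    then show ?thesis by (simp add: symb)
  qed
  have hash: "circuit_computes N (s * (g * q + 5 * 2 ^ g + 20) + 1) (hb e)" for e
    unfolding hb_def by (rule circuit_computes_parity) (rule table)
  define K where "K = (\<lambda>i. if i < \<tau> then s * (g * q + 5 * 2 ^ g + 20) + 1 else q)"
  have sumK: "(\<Sum>i<\<tau> + g. K i) = \<tau> * (s * (g * q + 5 * 2 ^ g + 20) + 1) + g * q"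
  proof -
    have "(\<Sum>i<\<tau> + g. K i) = (\<Sum>i<\<tau>. K i) + (\<Sum>i\<in>{\<tau>..<\<tau> + g}. K i)"
      by (subst sum.union_disjoint[symmetric]) (auto intro: arg_cong[of _ _ "sum K"])
    also have "(\<Sum>i<\<tau>. K i) = (\<Sum>i<\<tau>. s * (g * q + 5 * 2 ^ g + 20) + 1)" by (rule sum.cong) (auto simp: K_def)
    also have "(\<Sum>i\<in>{\<tau>..<\<tau> + g}. K i) = (\<Sum>i\<in>{\<tau>..<\<tau> + g}. q)" by (rule sum.cong) (auto simp: K_def)
    finally show ?thesis by simp
  qed
  have look: "circuit_computes N (\<tau> * (s * (g * q + 5 * 2 ^ g + 20) + 1) + g * q + 5 * 2 ^ (\<tau> + g)) (uv b)"
    if b: "b < s" for b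
  proof -
    define F where "F = (\<lambda>i y. if i < \<tau> then hb i y else \<alpha>' b y ! (i - \<tau>))"
    have "circuit_computes N ((\<Sum>i<\<tau> + g. K i) + 5 * 2 ^ (\<tau> + g))
        (\<lambda>y. (\<lambda>v. \<sigma> ! pos (bnum (take \<tau> v)) b (drop \<tau> v)) (map (\<lambda>i. F i y) [0..<\<tau> + g]))"
    proof (rule circuit_computes_comp[OF _ circuit_computes_table])
      fix i assume i: "i < \<tau> + g"
      show "circuit_computes N (K i) (F i)"
      proof (cases "i < \<tau>")
        case True
        then have "F i = hb i" by (simp add: F_def)
        with True hash[of i] show ?thesis by (simp only: K_def if_True)
      next
        case False
        then have "F i = (\<lambda>y. \<alpha>' b y ! (i - \<tau>))" by (simp add: F_def)
        moreover have "i - \<tau> < g" using i False by simp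
        ultimately show ?thesis using False assms(1)[OF b] by (simp add: K_def)
      qed
    qed
    moreover have "take \<tau> (map (\<lambda>i. F i y) [0..<\<tau> + g]) = map (\<lambda>e. hb e y) [0..<\<tau>]" for y
      by (rule nth_equalityI) (auto simp: F_def)
    moreover have "drop \<tau> (map (\<lambda>i. F i y) [0..<\<tau> + g]) = \<alpha>' b y" for y
      by (rule nth_equalityI) (auto simp: F_def \<alpha>')
    ultimately show ?thesis by (simp add: sumK uv_def)
  qed
  have X: "circuit_computes s (c * (5 * 2 ^ \<kappa> + 20) + 1) (xor_tables c \<kappa> T)"
    unfolding s(1) by (rule circuit_computes_xor_tables)
  have "circuit_computes N ((\<Sum>b<s. \<tau> * (s * (g * q + 5 * 2 ^ g + 20) + 1) + g * q + 5 * 2 ^ (\<tau> + g))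
      + (c * (5 * 2 ^ \<kappa> + 20) + 1)) (\<lambda>y. xor_tables c \<kappa> T (map (\<lambda>b. uv b y) [0..<s]))"
    by (rule circuit_computes_comp[OF _ X]) (rule look)
  then have circ: "circuit_computes (ceillog2 n) (s * (\<tau> * (s * (g * q + 5 * 2 ^ g + 20) + 1) + g * q + 5 * 2 ^ (\<tau> + g))
      + (c * (5 * 2 ^ \<kappa> + 20) + 1)) (\<lambda>y. xor_tables c \<kappa> T (map (\<lambda>b. uv b y) [0..<s]))"
    unfolding N by simp
  have "xor_tables c \<kappa> T (map (\<lambda>b. uv b (index_bits n j)) [0..<s]) = generator z ! j" if j: "j < n" for j
  proof -
    have "hb e (index_bits n j) = hash_bit H j e" for e by (simp add: hb_def hash_bit_def y[OF j])
    then have "uv b (index_bits n j) = \<sigma> ! pos (block H j) b (\<alpha> b j)" for b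
      by (simp add: uv_def block_def y[OF j])
    then show ?thesis using j by (simp add: generator_def gen_bit_def \<sigma>_def H_def)
  qed
  with circ show ?thesis by (rule computes_bits_exists)
qed

end

section \<open>Fixing the code and the tables\<close>

lemma index_bits_inj:
  assumes "j < n" "j' < n" "index_bits n j = index_bits n j'"
  shows "j = j'"
proof -
  have "take_bit (ceillog2 n) j = take_bit (ceillog2 n) j'"
    unfolding horner_sum_bit_eq_take_bit[symmetric] using assms(3) by (simp only: index_bits_def)
  moreover have "j < 2 ^ ceillog2 n" "j' < 2 ^ ceillog2 n"
    using assms(1,2) le_two_power_ceillog2[of n] by linarith+
  ultimately show ?thesis by (simp add: take_bit_nat_eq_self)
qed

lemma circuit_computes_code_symbol:
  assumes "e < g"
  shows "circuit_computes N (N * 21 + 1) (\<lambda>y. code_symbol N g L b y ! e)"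
proof -
  have "circuit_computes N 1 (\<lambda>y. L ! ((b * g + e) * N + d) \<and> y ! d)" if "d < N" for d
  proof (cases "L ! ((b * g + e) * N + d)")
    case True
    then show ?thesis using circuit_computes_mono[OF circuit_computes_proj[OF that]] by simp
  next
    case False
    then show ?thesis using circuit_computes_const[of N False] by simp
  qed
  then have "circuit_computes N (N * (1 + 20) + 1)
      (\<lambda>y. parity (map (\<lambda>d. L ! ((b * g + e) * N + d) \<and> y ! d) [0..<N]))"
    by (rule circuit_computes_parity)
  then show ?thesis using assms by (simp add: code_symbol_def)
qed

lemma xor_generator_exists:
  fixes n l :: nat
  defines "N \<equiv> ceillog2 n"
  assumes code: "2 * N + c * \<kappa> < g * a" and pos: "0 < c * \<kappa>" "0 < w" "1 \<le> p"
    and k: "k * k * a \<le> c * \<kappa>"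
    and few: "card (branching_class k (network_class w (juntas (c * \<kappa>) a)) (juntas (c * \<kappa>) a)) < 4 ^ p"
    and \<kappa>: "12 * p * 2 ^ g \<le> 2 ^ \<kappa>" and \<delta>: "0 < \<delta>" "4 \<le> \<delta>\<^sup>2 * 2 ^ (g * c)"
  shows "\<exists>G. G ` bitstrings (2 ^ \<tau> * (c * \<kappa>) * 2 ^ g + \<tau> * (c * \<kappa>) * 2 ^ g) \<subseteq> bitstrings n \<and>
    fools (real n * \<delta> + 2 ^ \<tau> * (real l / (2 ^ \<tau> * real w)) ^ k)
      (2 ^ \<tau> * (c * \<kappa>) * 2 ^ g + \<tau> * (c * \<kappa>) * 2 ^ g) n G (comparator_class n l) \<and>
    (\<forall>z. \<exists>D. circuit_size D \<le> c * \<kappa> * (\<tau> * (c * \<kappa> * (g * (N * 21 + 1) + 5 * 2 ^ g + 20) + 1)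
        + g * (N * 21 + 1) + 5 * 2 ^ (\<tau> + g)) + (c * (5 * 2 ^ \<kappa> + 20) + 1) \<and> computes_bits n D (G z))"
proof -
  obtain L where L: "\<And>y y'. length y = N \<Longrightarrow> length y' = N \<Longrightarrow> y \<noteq> y' \<Longrightarrow>
      card {b. b < c * \<kappa> \<and> code_symbol N g L b y = code_symbol N g L b y'} < a"
    using code_exists[OF code] by blast
  have fin: "finite (branching_class k (network_class w (juntas (c * \<kappa>) a)) (juntas (c * \<kappa>) a))"
    by (intro finite_branching_class finite_network_class finite_juntas)
  obtain T where T: "\<And>f. f \<in> branching_class k (network_class w (juntas (c * \<kappa>) a)) (juntas (c * \<kappa>) a) \<Longrightarrow>
      \<bar>avg (c * \<kappa>) (\<lambda>u. of_bool (f u) * signb (xor_tables c \<kappa> T u))\<bar> \<le> \<delta>"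
    using hard_function_exists[OF fin few pos(3) \<kappa> \<delta>] by blast
  interpret xor_generator n g "c * \<kappa>" a c \<kappa> \<tau> "\<lambda>b j. code_symbol N g L b (index_bits n j)" T
  proof
    show "card {b. b < c * \<kappa> \<and> code_symbol N g L b (index_bits n j) = code_symbol N g L b (index_bits n j')} < a"
      if "j < n" "j' < n" "j \<noteq> j'" for j j'
    proof (rule L)
      show "index_bits n j \<noteq> index_bits n j'" using index_bits_inj that by blast
    qed (simp_all add: index_bits_def N_def)
  qed (use pos in auto)
  show ?thesis
  proof (intro exI[of _ generator] conjI allI)
    show "generator ` bitstrings (2 ^ \<tau> * (c * \<kappa>) * 2 ^ g + \<tau> * (c * \<kappa>) * 2 ^ g) \<subseteq> bitstrings n"
      by (auto simp: generator_def)
    show "fools (real n * \<delta> + 2 ^ \<tau> * (real l / (2 ^ \<tau> * real w)) ^ k)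
      (2 ^ \<tau> * (c * \<kappa>) * 2 ^ g + \<tau> * (c * \<kappa>) * 2 ^ g) n generator (comparator_class n l)"
      by (rule fools_generator[OF k pos(2) T])
    show "\<exists>D. circuit_size D \<le> c * \<kappa> * (\<tau> * (c * \<kappa> * (g * (N * 21 + 1) + 5 * 2 ^ g + 20) + 1)
        + g * (N * 21 + 1) + 5 * 2 ^ (\<tau> + g)) + (c * (5 * 2 ^ \<kappa> + 20) + 1) \<and> computes_bits n D (generator z)" for z
    proof (rule generator_circuit[where \<alpha>' = "code_symbol N g L"])
      show "circuit_computes N (N * 21 + 1) (\<lambda>y. code_symbol N g L b y ! e)" if "e < g" for b e
        by (rule circuit_computes_code_symbol[OF that])
    qed (simp_all add: N_def)
  qed
qed


section \<open>Parameters\<close>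

text \<open>Here \<open>x\<close> bounds the base two logarithm of the number of juntas. The term
  meant to dominate is \<open>2 * y * (w * w)\<close>, which comes from the gate lists.\<close>

lemma card_branching_juntas_le:
  fixes s N w y a k :: nat
  assumes s: "s \<le> 2 ^ N" and w: "w \<le> 2 ^ y"
  defines "x \<equiv> a * N + 2 ^ a"
  shows "card (branching_class k (network_class w (juntas s a)) (juntas s a))
    \<le> 2 ^ (x * k + (x * w + 2 * y * (w * w) + y) * 2 ^ k)"
proof -
  have J: "card (juntas s a) \<le> 2 ^ x"
  proof -
    have "card (juntas s a) \<le> s ^ a * 2 ^ (2 ^ a)" by (rule card_juntas)
    also have "\<dots> \<le> (2 ^ N) ^ a * 2 ^ (2 ^ a)" by (intro mult_le_mono1 power_mono s) simp
    also have "\<dots> = 2 ^ x" by (simp add: x_def power_add power_mult[symmetric] mult.commute)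
    finally show ?thesis .
  qed
  have F: "card (network_class w (juntas s a)) \<le> 2 ^ (x * w + 2 * y * (w * w) + y)"
  proof -
    have "card (network_class w (juntas s a)) \<le> card (juntas s a) ^ w * ((w * w) ^ (w * w) * w)"
      by (rule card_network_class[OF finite_juntas])
    also have "\<dots> \<le> (2 ^ x) ^ w * ((2 ^ y * 2 ^ y) ^ (w * w) * 2 ^ y)"
      by (intro mult_le_mono power_mono J w) simp_all
    also have "\<dots> = 2 ^ (x * w + 2 * y * (w * w) + y)"
      by (simp only: power_mult[symmetric] power_add[symmetric] mult_2) (simp add: algebra_simps)
    finally show ?thesis .
  qed
  have "card (branching_class k (network_class w (juntas s a)) (juntas s a))
      \<le> card (juntas s a) ^ k * card (network_class w (juntas s a)) ^ (2 ^ k)"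
    by (rule card_branching_class[OF finite_juntas finite_network_class[OF finite_juntas]])
  also have "\<dots> \<le> (2 ^ x) ^ k * (2 ^ (x * w + 2 * y * (w * w) + y)) ^ (2 ^ k)"
    by (intro mult_le_mono power_mono J F) simp_all
  also have "\<dots> = 2 ^ (x * k + (x * w + 2 * y * (w * w) + y) * 2 ^ k)"
    by (simp only: power_mult[symmetric] power_add[symmetric])
  finally show ?thesis .
qed

text \<open>One number bounds both the seed length and the circuit size, so a single minimal value
  can serve for both in the theorem.\<close>

definition prg_exists :: "nat \<Rightarrow> nat \<Rightarrow> real \<Rightarrow> nat \<Rightarrow> bool" where
  "prg_exists n l e R \<longleftrightarrow> (\<exists>G. G ` bitstrings R \<subseteq> bitstrings n \<and> fools e R n G (comparator_class n l) \<and>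
     (\<forall>z\<in>bitstrings R. \<exists>D. circuit_size D \<le> R \<and> computes_bits n D (G z)))"

lemma prg_exists_pad:
  assumes G: "G ` bitstrings r \<subseteq> bitstrings n" "fools e r n G (comparator_class n l)"
    "\<And>z. \<exists>D. circuit_size D \<le> Z \<and> computes_bits n D (G z)"
    and R: "r \<le> R" "Z \<le> R" "e \<le> e'"
  shows "prg_exists n l e' R"
  unfolding prg_exists_def
proof (intro exI[of _ "\<lambda>z. G (take r z)"] conjI ballI)
  show "(\<lambda>z. G (take r z)) ` bitstrings R \<subseteq> bitstrings n"
  proof
    fix y assume "y \<in> (\<lambda>z. G (take r z)) ` bitstrings R"
    then obtain z where z: "y = G (take r z)" "length z = R" by auto
    then have "take r z \<in> bitstrings r" using R by simp
    then show "y \<in> bitstrings n" using G(1) z(1) by blast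
  qed
  show "fools e' R n (\<lambda>z. G (take r z)) (comparator_class n l)"
    unfolding fools_def
  proof
    fix C assume "C \<in> comparator_class n l"
    then have "\<bar>accept_prob r (\<lambda>z. C (G z)) - accept_prob n C\<bar> \<le> e" using G(2) unfolding fools_def by blast
    moreover have "accept_prob R (\<lambda>z. C (G (take r z))) = accept_prob r (\<lambda>z. C (G z))"
      unfolding accept_prob_avg by (rule avg_take[OF R(1)])
    ultimately show "\<bar>accept_prob R (\<lambda>z. C (G (take r z))) - accept_prob n C\<bar> \<le> e'" using R(3) by simp
  qed
  fix z :: "bool list"
  show "\<exists>D. circuit_size D \<le> R \<and> computes_bits n D (G (take r z))"
    using G(3)[of "take r z"] R(2) le_trans by blast
qed

lemma table_circuit_exists:
  "\<exists>D. circuit_size D \<le> 10 * n + 5 \<and> computes_bits n D y"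
proof (rule computes_bits_exists)
  have "2 ^ ceillog2 n \<le> 2 * n + 1"
    using two_power_ceillog2_gt[of n] by (cases "n = 0") auto
  then show "circuit_computes (ceillog2 n) (10 * n + 5) (\<lambda>v. y ! bnum v)"
    using circuit_computes_mono[OF circuit_computes_table[of "ceillog2 n" "\<lambda>v. y ! bnum v"]] by simp
  fix j assume "j < n"
  then have "j < 2 ^ ceillog2 n" using le_two_power_ceillog2[of n] by linarith
  then have "bnum (index_bits n j) = j"
    by (simp add: bnum_def index_bits_def horner_sum_bit_eq_take_bit take_bit_nat_eq_self)
  then show "y ! bnum (index_bits n j) = y ! j" by simp
qed

text \<open>This covers small \<open>n\<close>, and also \<open>l\<close> above
  \<open>n powr (3/2)\<close>, where \<open>n\<close> is at most \<open>l powr (2/3)\<close> and no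
  stretch is called for.\<close>

lemma prg_exists_identity:
  assumes "0 \<le> e" "10 * n + 5 \<le> R"
  shows "prg_exists n l e R"
proof (rule prg_exists_pad[of "\<lambda>z. z" n n 0 l "10 * n + 5"])
  show "fools 0 n n (\<lambda>z. z) (comparator_class n l)" by (simp add: fools_def)
qed (use assms table_circuit_exists in auto)

lemma powr_two_thirds:
  assumes "0 \<le> (L::real)"
  shows "L powr (2/3) = (L powr (1/3)) ^ 2" "L = (L powr (1/3)) ^ 3"
  using assms by (simp_all add: powr_powr flip: powr_realpow')

text \<open>The loss \<open>2 ^ g\<close> is about \<open>n powr (1 / B)\<close>. The choice of
  \<open>k\<close> makes \<open>2 ^ - (g * k)\<close> at most \<open>1 / n ^ (A + 2)\<close>;
  \<open>c = 2 * k\<close> compensates for the square in the correlation bound; and \<open>a\<close>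
  makes \<open>g * a\<close> exceed \<open>2 * N + c * \<kappa>\<close>, using
  \<open>N < g * B\<close> and \<open>\<kappa> \<le> 17 * N\<close>. The logarithms of the number of
  juntas and of \<open>w\<close> are bounded by \<open>x\<close> and \<open>y\<close>.\<close>

lemma prg_exists_core:
  fixes n l A B R :: nat
  defines "N \<equiv> ceillog2 n"
  defines "g \<equiv> N div B + 1"
  defines "k \<equiv> B * (A + 2)"
  defines "c \<equiv> 2 * k"
  defines "a \<equiv> B * (17 * c + 2)"
  defines "x \<equiv> a * N + 2 ^ a"
  defines "y \<equiv> 2 * N + 2"
  assumes B: "1 \<le> B" and n: "4 \<le> n" and l: "1 \<le> l" "real l \<le> real n powr (3/2)"
    and e: "1 / real n ^ A \<le> e"
    and ev: "17 * c * N \<le> 2 ^ N" "17 * c * N \<le> 2 ^ g" "c \<le> 2 ^ g" "k * k * a \<le> g" "N + 1 \<le> 2 ^ g"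
      "x * k + (x + 3 * y) * 2 ^ k + 1 \<le> 2 ^ g" "g * (N * 21 + 1) + 20 \<le> 2 ^ g"
    and R: "real l powr (2/3) * 2 ^ (17 * g) \<le> real R"
  shows "prg_exists n l e R"
proof -
  define U where "U = real l powr (1/3)"
  have U: "1 \<le> U" "real l = U ^ 3" "real l powr (2/3) = U\<^sup>2"
    using l powr_two_thirds[of "real l"] by (simp_all add: U_def ge_one_powr_ge_zero)
  have nN: "n \<le> 2 ^ N" unfolding N_def by (rule le_two_power_ceillog2)
  have N1: "1 \<le> N"
  proof (rule ccontr)
    assume "\<not> 1 \<le> N"
    then have "N = 0" by simp
    then show False using nN n by simp
  qed
  have U2n: "U\<^sup>2 \<le> real n"
  proof -
    have "U\<^sup>2 = real l powr (2/3)" by (rule U(3)[symmetric])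
    also have "\<dots> \<le> (real n powr (3/2)) powr (2/3)" by (rule powr_mono2) (use l in auto)
    also have "\<dots> = real n" using n by (simp add: powr_powr)
    finally show ?thesis .
  qed
  have U2N: "U\<^sup>2 \<le> 2 ^ N"
  proof -
    have "real n \<le> 2 ^ N" using nN by simp
    with U2n show ?thesis by (rule order_trans)
  qed
  have gN: "g \<le> N + 1" using B by (simp add: g_def div_le_dividend)
  have gB: "N < g * B"
    using dividend_less_div_times[of B N] B by (simp add: g_def algebra_simps)
  \<comment> \<open>The number of blocks is within a factor two of
    \<open>l powr (2/3)\<close>.\<close>
  define \<tau> where "\<tau> = nat \<lceil>log 2 (U\<^sup>2)\<rceil>"
  have \<tau>: "U\<^sup>2 \<le> 2 ^ \<tau>" "2 ^ \<tau> \<le> 2 * U\<^sup>2"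
  proof -
    have U21: "1 \<le> U\<^sup>2" using U by simp
    then have log0: "0 \<le> log 2 (U\<^sup>2)" by (subst zero_le_log_cancel_iff) linarith+
    then have \<tau>r: "log 2 (U\<^sup>2) \<le> real \<tau>" "real \<tau> \<le> log 2 (U\<^sup>2) + 1"
      unfolding \<tau>_def by linarith+
    have cancel: "2 powr log 2 (U\<^sup>2) = U\<^sup>2"
      using U21 by (intro powr_log_cancel) linarith+
    have "2 powr log 2 (U\<^sup>2) \<le> 2 powr real \<tau>" by (rule powr_mono[OF \<tau>r(1)]) simp
    then show "U\<^sup>2 \<le> 2 ^ \<tau>" unfolding cancel by (simp add: powr_realpow)
    have "2 powr real \<tau> \<le> 2 powr (log 2 (U\<^sup>2) + 1)" by (rule powr_mono[OF \<tau>r(2)]) simp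
    also have "\<dots> = 2 * U\<^sup>2" unfolding powr_add cancel by simp
    finally show "2 ^ \<tau> \<le> 2 * U\<^sup>2" by (simp add: powr_realpow)
  qed
  have \<tau>N: "\<tau> \<le> N + 1"
  proof -
    have "(2::real) ^ \<tau> \<le> 2 ^ (N + 1)" using \<tau>(2) U2N by simp
    then show ?thesis by (rule power_le_imp_le_exp[rotated]) simp
  qed
  \<comment> \<open>The factor \<open>2 ^ g\<close> over the mean load \<open>l / 2 ^ \<tau>\<close>
    makes each of the \<open>k\<close> factors of the hashing error at most
    \<open>2 ^ - g\<close>.\<close>
  define w where "w = nat \<lceil>real l * 2 ^ g / 2 ^ \<tau>\<rceil>"
  have w: "real l * 2 ^ g / 2 ^ \<tau> \<le> real w" "real w \<le> 2 * U * 2 ^ g" "0 < w"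
  proof -
    have pos: "0 < real l * 2 ^ g / 2 ^ \<tau>" using l by simp
    then show "0 < w" by (simp add: w_def)
    show "real l * 2 ^ g / 2 ^ \<tau> \<le> real w" unfolding w_def by linarith
    have "real w \<le> real l * 2 ^ g / 2 ^ \<tau> + 1" using pos unfolding w_def by linarith
    also have "real l * 2 ^ g / 2 ^ \<tau> \<le> real l * 2 ^ g / U\<^sup>2"
      by (rule divide_left_mono) (use \<tau> U in \<open>simp_all\<close>)
    also have "\<dots> = U * 2 ^ g" using U(1) by (simp add: U(2) power3_eq_cube power2_eq_square)
    also have "1 \<le> U * 2 ^ g"
      using mult_mono[OF U(1) one_le_power[of "2::real" g]] U(1) by simp
    finally show "real w \<le> 2 * U * 2 ^ g" by simp
  qed
  have w2: "real (w * w) \<le> 4 * U\<^sup>2 * 4 ^ g"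
  proof -
    have "real w * real w \<le> (2 * U * 2 ^ g) * (2 * U * 2 ^ g)"
      by (rule mult_mono[OF w(2) w(2)]) (use U in simp_all)
    also have "\<dots> = 4 * U\<^sup>2 * (2 * 2) ^ g" by (simp only: power_mult_distrib power2_eq_square) simp
    finally show ?thesis by simp
  qed
  have w2N: "w * w \<le> 2 ^ (3 * N + 4)"
  proof -
    have "real (w * w) \<le> 4 * 2 ^ N * 4 ^ (N + 1)"
      using w2 U2N gN mult_mono[OF U2N power_increasing[OF gN, of "4::real"]] by simp
    also have "\<dots> = 2 ^ (3 * N + 4)"
    proof -
      have "(4::real) ^ (N + 1) = 2 ^ (2 * (N + 1))" by (simp add: power_mult)
      then show ?thesis by (simp add: power_add[symmetric] power_mult[symmetric]) (simp add: power_add)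
    qed
    finally have "real (w * w) \<le> real (2 ^ (3 * N + 4))" by simp
    then show ?thesis by (simp only: of_nat_le_iff)
  qed
  have wy: "w \<le> 2 ^ y"
  proof (rule ccontr)
    assume "\<not> ?thesis"
    then have "2 ^ y * 2 ^ y < w * w" by (intro mult_strict_mono) simp_all
    then have "(2::nat) ^ (y + y) < 2 ^ (3 * N + 4)" using w2N by (simp add: power_add)
    then have "y + y < 3 * N + 4" by (rule power_less_imp_less_exp[rotated]) simp
    then show False by (simp add: y_def)
  qed
  \<comment> \<open>One more than the exponent in \<open>card_branching_juntas_le\<close>, so that
    the predictors number fewer than \<open>4 ^ p\<close>.\<close>
  define p where "p = x * k + (x * w + 2 * y * (w * w) + y) * 2 ^ k + 1"
  have p_le: "p \<le> w * w * 2 ^ g"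
  proof -
    have w1: "1 \<le> w * w" "w \<le> w * w" using w(3) by simp_all
    have "p \<le> x * k * (w * w) + (x * (w * w) + 2 * y * (w * w) + y * (w * w)) * 2 ^ k + (w * w)"
    proof -
      have "x * k * 1 \<le> x * k * (w * w)" "x * w \<le> x * (w * w)" "y * 1 \<le> y * (w * w)"
        using w1 by (intro mult_le_mono2; simp)+
      then show ?thesis
        unfolding p_def mult_1_right using w1 by (intro add_mono mult_le_mono1 order_refl)
    qed
    also have "\<dots> = w * w * (x * k + (x + 3 * y) * 2 ^ k + 1)" by (simp add: algebra_simps)
    also have "\<dots> \<le> w * w * 2 ^ g" using ev(6) by (rule mult_le_mono2)
    finally show ?thesis .
  qed
  define \<kappa> where "\<kappa> = ceillog2 (12 * p * 2 ^ g)"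
  have \<kappa>: "12 * p * 2 ^ g \<le> 2 ^ \<kappa>" unfolding \<kappa>_def by (rule le_two_power_ceillog2)
  have \<kappa>_less: "2 ^ \<kappa> < 2 * (12 * p * 2 ^ g)"
    unfolding \<kappa>_def by (rule two_power_ceillog2_gt) (simp add: p_def)
  have \<kappa>_le: "2 ^ \<kappa> \<le> 24 * (w * w) * (2 ^ g * 2 ^ g)"
  proof -
    have "2 * (12 * p * 2 ^ g) \<le> 2 * (12 * (w * w * 2 ^ g) * 2 ^ g)"
      using p_le by (intro mult_le_mono order_refl)
    also have "\<dots> = 24 * (w * w) * (2 ^ g * 2 ^ g)" by simp
    finally show ?thesis using \<kappa>_less by linarith
  qed
  have \<kappa>N: "\<kappa> \<le> 17 * N"
  proof -
    have "24 * (w * w) * (2 ^ g * 2 ^ g) \<le> 32 * 2 ^ (3 * N + 4) * (2 ^ (N + 1) * 2 ^ (N + 1))"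
      by (intro mult_le_mono w2N power_increasing gN) simp_all
    also have "\<dots> = 2 ^ (5 * N + 11)"
    proof -
      have "(32::nat) = 2 ^ 5" by simp
      then show ?thesis by (simp only: power_add[symmetric]) (simp add: algebra_simps)
    qed
    finally have "(2::nat) ^ \<kappa> \<le> 2 ^ (5 * N + 11)" using \<kappa>_le by linarith
    then have "\<kappa> \<le> 5 * N + 11" by (rule power_le_imp_le_exp[rotated]) simp
    then show ?thesis using N1 by linarith
  qed
  have g\<kappa>: "g \<le> \<kappa>"
  proof -
    have "1 * 2 ^ g \<le> 12 * p * 2 ^ g" by (rule mult_le_mono1) (simp add: p_def)
    then have "(2::nat) ^ g \<le> 2 ^ \<kappa>" using \<kappa> by linarith
    then show ?thesis by simp
  qed
  have k1: "1 \<le> k" using B by (simp add: k_def)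
  have c1: "1 \<le> c" using k1 by (simp add: c_def)
  have g1: "1 \<le> g" by (simp add: g_def)
  have s_le: "c * \<kappa> \<le> 17 * c * N" using mult_le_mono2[OF \<kappa>N, of c] by (simp add: mult_ac)
  have s_pos: "0 < c * \<kappa>" using c1 g1 g\<kappa> by simp
  have code: "2 * N + c * \<kappa> < g * a"
  proof -
    have "2 * N + c * \<kappa> \<le> (17 * c + 2) * N" using s_le by (simp add: algebra_simps)
    also have "\<dots> < (17 * c + 2) * (g * B)" using gB by (intro mult_strict_left_mono) simp_all
    also have "\<dots> = g * a" by (simp only: a_def mult_ac)
    finally show ?thesis .
  qed
  have few: "card (branching_class k (network_class w (juntas (c * \<kappa>) a)) (juntas (c * \<kappa>) a)) < 4 ^ p"
  proof -
    have "card (branching_class k (network_class w (juntas (c * \<kappa>) a)) (juntas (c * \<kappa>) a))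
        \<le> 2 ^ (x * k + (x * w + 2 * y * (w * w) + y) * 2 ^ k)"
      unfolding x_def by (rule card_branching_juntas_le[OF _ wy]) (use s_le ev(1) in linarith)
    also have "\<dots> < 2 ^ (2 * p)" by (rule power_strict_increasing) (simp_all add: p_def)
    also have "\<dots> = 4 ^ p" by (simp add: power_mult)
    finally show ?thesis .
  qed
  define \<delta> :: real where "\<delta> = 2 / 2 ^ (g * k)"
  have \<delta>: "0 < \<delta>" "4 \<le> \<delta>\<^sup>2 * 2 ^ (g * c)"
  proof -
    show "0 < \<delta>" by (simp add: \<delta>_def)
    have "(2::real) ^ (g * c) = (2 ^ (g * k))\<^sup>2"
      by (simp add: c_def power_mult[symmetric] mult_ac)
    then show "4 \<le> \<delta>\<^sup>2 * 2 ^ (g * c)" by (simp add: \<delta>_def power_divide)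
  qed
  have small: "1 / 2 ^ (g * k) \<le> 1 / real n ^ (A + 2)"
  proof -
    have "real n \<le> 2 ^ N" using of_nat_mono[OF nN, where 'a = real] by simp
    also have "\<dots> \<le> 2 ^ (g * B)" using gB by (intro power_increasing) simp_all
    finally have "real n ^ (A + 2) \<le> (2 ^ (g * B)) ^ (A + 2)" by (rule power_mono) simp
    also have "\<dots> = 2 ^ (g * k)" by (simp only: k_def power_mult[symmetric] mult.assoc)
    finally show ?thesis using n by (intro divide_left_mono) simp_all
  qed
  \<comment> \<open>Both errors are at most \<open>2 * n / n ^ (A + 2)\<close>: one comes from
    \<open>n\<close> hybrid steps, the other from at most \<open>2 * n\<close> blocks. Their sum is
    at most \<open>1 / n ^ A\<close> because \<open>n \<ge> 4\<close>.\<close>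
  have err: "real n * \<delta> + 2 ^ \<tau> * (real l / (2 ^ \<tau> * real w)) ^ k \<le> e"
  proof -
    have "real l / (2 ^ \<tau> * real w) \<le> 1 / 2 ^ g"
      using w(1,3) by (simp add: divide_le_eq le_divide_eq mult_ac)
    then have "(real l / (2 ^ \<tau> * real w)) ^ k \<le> (1 / 2 ^ g) ^ k" by (rule power_mono) simp
    also have "\<dots> = 1 / 2 ^ (g * k)" by (simp add: power_divide power_mult)
    also note small
    finally have "2 ^ \<tau> * (real l / (2 ^ \<tau> * real w)) ^ k \<le> (2 * real n) * (1 / real n ^ (A + 2))"
      using \<tau>(2) U2n by (intro mult_mono) simp_all
    moreover have "real n * \<delta> \<le> (2 * real n) * (1 / real n ^ (A + 2))"
    proof -
      have "real n * \<delta> = (2 * real n) * (1 / 2 ^ (g * k))" by (simp add: \<delta>_def)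
      also have "\<dots> \<le> (2 * real n) * (1 / real n ^ (A + 2))" by (rule mult_left_mono[OF small]) simp
      finally show ?thesis .
    qed
    ultimately have "real n * \<delta> + 2 ^ \<tau> * (real l / (2 ^ \<tau> * real w)) ^ k \<le>
        (2 * real n) * (1 / real n ^ (A + 2)) + (2 * real n) * (1 / real n ^ (A + 2))"
      by linarith
    also have "\<dots> = (4 / real n) * (1 / real n ^ A)" using n by (simp add: power_add power2_eq_square)
    also have "\<dots> \<le> 1 * (1 / real n ^ A)" using n by (intro mult_right_mono) simp_all
    finally show ?thesis using e by simp
  qed
  have kka: "k * k * a \<le> c * \<kappa>"
  proof -
    have "k * k * a \<le> 1 * \<kappa>" using ev(4) g\<kappa> by simp
    also have "\<dots> \<le> c * \<kappa>" using c1 by (rule mult_le_mono1)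
    finally show ?thesis .
  qed
  define r where "r = 2 ^ \<tau> * (c * \<kappa>) * 2 ^ g + \<tau> * (c * \<kappa>) * 2 ^ g"
  define Z where "Z = c * \<kappa> * (\<tau> * (c * \<kappa> * (g * (N * 21 + 1) + 5 * 2 ^ g + 20) + 1)
        + g * (N * 21 + 1) + 5 * 2 ^ (\<tau> + g)) + (c * (5 * 2 ^ \<kappa> + 20) + 1)"
  obtain G where G: "G ` bitstrings r \<subseteq> bitstrings n"
    "fools (real n * \<delta> + 2 ^ \<tau> * (real l / (2 ^ \<tau> * real w)) ^ k) r n G (comparator_class n l)"
    "\<forall>z. \<exists>D. circuit_size D \<le> Z \<and> computes_bits n D (G z)"
    using xor_generator_exists[OF code[unfolded N_def] s_pos w(3) _ kka few \<kappa> \<delta>, where l = l and \<tau> = \<tau>]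
    unfolding r_def Z_def N_def[symmetric] by (auto simp: p_def)
  define Q where "Q = (2::real) ^ g"
  have Q: "1 \<le> Q" "2 \<le> Q" using power_increasing[OF g1, of "2::real"] by (simp_all add: Q_def)
  have sQ: "real (c * \<kappa>) \<le> Q" and \<tau>Q: "real \<tau> \<le> Q" and cQ: "real c \<le> Q" and hQ: "real (g * (N * 21 + 1) + 20) \<le> Q"
  proof -
    have *: "real m \<le> Q" if "m \<le> 2 ^ g" for m
      using of_nat_mono[OF that, where 'a = real] by (simp add: Q_def)
    show "real (c * \<kappa>) \<le> Q" by (rule *) (use s_le ev(2) in linarith)
    show "real \<tau> \<le> Q" by (rule *) (use \<tau>N ev(5) in linarith)
    show "real c \<le> Q" "real (g * (N * 21 + 1) + 20) \<le> Q" by (rule *, rule ev)+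
  qed
  define V where "V = U\<^sup>2"
  have V: "1 \<le> V" using U(1) by (simp add: V_def)
  have \<tau>V: "2 ^ \<tau> \<le> 2 * V" using \<tau>(2) by (simp add: V_def)
  have \<kappa>V: "2 ^ \<kappa> \<le> 96 * V * Q ^ 4"
  proof -
    have "real (2 ^ \<kappa>) \<le> real (24 * (w * w) * (2 ^ g * 2 ^ g))" using \<kappa>_le by (rule of_nat_mono)
    also have "\<dots> = 24 * real (w * w) * (Q * Q)" by (simp add: Q_def)
    also have "\<dots> \<le> 24 * (4 * V * 4 ^ g) * (Q * Q)"
      using w2 Q by (intro mult_right_mono mult_left_mono) (simp_all add: V_def)
    also have "(4::real) ^ g = Q * Q" by (simp add: Q_def flip: power_mult_distrib)
    finally show ?thesis by (simp add: power4_eq_xxxx mult_ac)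
  qed
  have Qp: "Q ^ i \<le> Q ^ 5" if "i \<le> 5" for i using Q(1) that by (intro power_increasing)
  have Vmono: "q \<le> V * q" if "0 \<le> q" for q using mult_right_mono[OF V that] by simp
  have VQ: "Q ^ i \<le> V * Q ^ 5" if "i \<le> 5" for i
    by (rule order_trans[OF Qp[OF that] Vmono]) (use Q in simp)
  have V2: "V * Q ^ 2 \<le> V * Q ^ 5"
    by (rule mult_left_mono[OF Qp]) (use V in simp_all)
  have VQ0: "0 \<le> V * Q ^ 5" using V Q by simp
  have bound: "real (max r Z) \<le> V * Q ^ 17"
  proof -
    \<comment> \<open>The exponent 17 consists of 5 from the size bounds and 12 to absorb the
      constant \<open>4096 = 2 ^ 12\<close> by means of \<open>2 \<le> Q\<close>.\<close>
    have Q17: "4096 * Q ^ 5 \<le> Q ^ 17"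
    proof -
      have "(2::real) ^ 12 * Q ^ 5 \<le> Q ^ 12 * Q ^ 5"
        using Q by (intro mult_right_mono power_mono) simp_all
      then show ?thesis by (simp flip: power_add)
    qed
    have "real r \<le> 4096 * V * Q ^ 5"
    proof -
      have "real r = 2 ^ \<tau> * real (c * \<kappa>) * Q + real \<tau> * real (c * \<kappa>) * Q" by (simp add: r_def Q_def)
      also have "\<dots> \<le> 2 * V * Q * Q + Q * Q * Q"
        using sQ \<tau>Q \<tau>V Q V by (intro add_mono mult_mono) simp_all
      also have "\<dots> = 2 * (V * Q ^ 2) + Q ^ 3" by (simp add: power2_eq_square power3_eq_cube)
      also have "\<dots> \<le> 2 * (V * Q ^ 5) + V * Q ^ 5"
        using V2 VQ[of 3] by linarith
      also have "\<dots> \<le> 4096 * (V * Q ^ 5)" using VQ0 by linarith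
      finally show ?thesis by simp
    qed
    moreover have "real Z \<le> 4096 * V * Q ^ 5"
    proof -
      have "real Z = real (c * \<kappa>) * (real \<tau> * (real (c * \<kappa>) * (real (g * (N * 21 + 1) + 20) + 5 * Q) + 1)
          + real (g * (N * 21 + 1)) + 5 * (2 ^ \<tau> * Q)) + (real c * (5 * 2 ^ \<kappa> + 20) + 1)"
        by (simp add: Z_def Q_def power_add algebra_simps)
      also have "\<dots> \<le> Q * (Q * (Q * (Q + 5 * Q) + 1) + Q + 5 * (2 * V * Q)) + (Q * (5 * (96 * V * Q ^ 4) + 20) + 1)"
        using sQ \<tau>Q cQ hQ \<tau>V \<kappa>V Q V by (intro add_mono mult_mono) simp_all
      also have "\<dots> = 6 * Q ^ 4 + 2 * Q ^ 2 + 10 * (V * Q ^ 2) + 480 * (V * Q ^ 5) + 20 * Q ^ 1 + Q ^ 0"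
        by (simp add: algebra_simps power2_eq_square power_numeral_reduce)
      also have "\<dots> \<le> 6 * (V * Q ^ 5) + 2 * (V * Q ^ 5) + 10 * (V * Q ^ 5) + 480 * (V * Q ^ 5) + 20 * (V * Q ^ 5) + V * Q ^ 5"
        using V2 VQ[of 4] VQ[of 2] VQ[of 1] VQ[of 0] by linarith
      also have "\<dots> \<le> 4096 * (V * Q ^ 5)" using VQ0 by linarith
      finally show ?thesis by simp
    qed
    ultimately have "real (max r Z) \<le> V * (4096 * Q ^ 5)" by simp
    also have "\<dots> \<le> V * Q ^ 17" using Q17 V by (intro mult_left_mono) simp_all
    finally show ?thesis .
  qed
  have "V * Q ^ 17 = real l powr (2/3) * 2 ^ (17 * g)"
    by (simp only: V_def U(3) Q_def power_mult[symmetric] mult.commute[of g])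
  with bound R have "real (max r Z) \<le> real R" by linarith
  then have "r \<le> R" "Z \<le> R" by simp_all
  then show ?thesis using prg_exists_pad[OF G(1,2) _ _ _ err] G(3) by blast
qed

section \<open>Eventual inequalities between the parameters\<close>

lemma eventually_poly_le_power:
  fixes p :: "real poly"
  shows "\<exists>A. \<forall>\<^sub>F n in sequentially. poly p (real n) \<le> real n ^ A"
proof (induction p)
  case 0
  then show ?case by (intro exI[of _ 0]) simp
next
  case (pCons a p)
  then obtain A where A: "\<forall>\<^sub>F n in sequentially. poly p (real n) \<le> real n ^ A" by blast
  have "\<forall>\<^sub>F n in sequentially. \<bar>a\<bar> + 1 \<le> real n"
    using filterlim_real_sequentially by (rule filterlim_at_top[THEN iffD1, rule_format])
  with A have "\<forall>\<^sub>F n in sequentially. poly (pCons a p) (real n) \<le> real n ^ (A + 2)"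
  proof eventually_elim
    case (elim n)
    have n1: "1 \<le> real n" using elim(2) abs_ge_zero[of a] by linarith
    have "poly (pCons a p) (real n) \<le> \<bar>a\<bar> * 1 + real n * real n ^ A"
      using mult_left_mono[OF elim(1), of "real n"] abs_ge_self[of a] by simp
    also have "\<dots> \<le> \<bar>a\<bar> * real n ^ (A + 1) + real n ^ (A + 1)"
      by (intro add_mono mult_left_mono one_le_power n1) simp_all
    also have "\<dots> = (\<bar>a\<bar> + 1) * real n ^ (A + 1)" by (simp add: algebra_simps)
    also have "\<dots> \<le> real n * real n ^ (A + 1)" using elim(2) by (rule mult_right_mono) simp
    finally show ?case by simp
  qed
  then show ?case by blast
qed

lemma eventually_inverse_poly:
  assumes "inverse_poly_bounded \<epsilon>"
  shows "\<exists>A. \<forall>\<^sub>F n in sequentially. 1 / real n ^ A \<le> \<epsilon> n" "0 \<le> \<epsilon> n"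
proof -
  obtain p :: "real poly" where p: "\<And>n. 0 < poly p (real n)" "\<And>n. 1 / poly p (real n) \<le> \<epsilon> n"
    using assms unfolding inverse_poly_bounded_def by blast
  obtain A where A: "\<forall>\<^sub>F n in sequentially. poly p (real n) \<le> real n ^ A"
    using eventually_poly_le_power[of p] by blast
  have "\<forall>\<^sub>F n in sequentially. 1 / real n ^ A \<le> \<epsilon> n"
    using A eventually_gt_at_top[of 0]
  proof eventually_elim
    case (elim n)
    then have "1 / real n ^ A \<le> 1 / poly p (real n)"
      using p(1)[of n] by (intro divide_left_mono) simp_all
    then show ?case using p(2)[of n] by linarith
  qed
  then show "\<exists>A. \<forall>\<^sub>F n in sequentially. 1 / real n ^ A \<le> \<epsilon> n" by blast
  have "0 \<le> 1 / poly p (real n)" using p(1)[of n] by simp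
  then show "0 \<le> \<epsilon> n" using p(2)[of n] by linarith
qed

lemma filterlim_ceillog2: "filterlim ceillog2 at_top sequentially"
  unfolding filterlim_at_top
proof
  fix Z
  show "\<forall>\<^sub>F n in sequentially. Z \<le> ceillog2 n"
    using eventually_ge_at_top[of "2 ^ Z :: nat"]
  proof eventually_elim
    case (elim n)
    then have "ceillog2 (2 ^ Z) \<le> ceillog2 n" by (rule ceillog2_mono)
    then show ?case by simp
  qed
qed

text \<open>With \<open>N = ceillog2 n\<close>, every exponential side condition of
  \<open>prg_exists_core\<close> reduces to this comparison, its other side being at most a constant
  times the square of \<open>N\<close>.\<close>

lemma eventually_square_le_power:
  fixes D B :: nat
  assumes "1 \<le> B"
  shows "\<forall>\<^sub>F N in sequentially. D * N\<^sup>2 \<le> 2 ^ (N div B + 1)"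
proof -
  have "\<forall>\<^sub>F m in sequentially. real D * (real B * (real m + 1))\<^sup>2 \<le> 2 powr (real m + 1)"
  proof -
    define C where "C = real D * (real B)\<^sup>2 + 1"
    have "0 < C" by (simp add: C_def add_nonneg_pos)
    then have "\<forall>\<^sub>F m in sequentially. C * (real m + 1)\<^sup>2 \<le> 2 powr (real m + 1)"
      by real_asymp
    then show ?thesis
    proof eventually_elim
      case (elim m)
      have "real D * (real B * (real m + 1))\<^sup>2 = real D * (real B)\<^sup>2 * (real m + 1)\<^sup>2"
        by (simp only: power_mult_distrib mult.assoc)
      also have "\<dots> \<le> C * (real m + 1)\<^sup>2" by (rule mult_right_mono) (simp_all add: C_def)
      finally show ?case using elim by linarith
    qed
  qed
  moreover have "filterlim (\<lambda>N. N div B) at_top sequentially"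
    unfolding filterlim_at_top
  proof
    fix Z
    show "\<forall>\<^sub>F N in sequentially. Z \<le> N div B"
      using eventually_ge_at_top[of "Z * B"]
      by eventually_elim (use assms in \<open>simp add: less_eq_div_iff_mult_less_eq\<close>)
  qed
  ultimately have "\<forall>\<^sub>F N in sequentially. real D * (real B * (real (N div B) + 1))\<^sup>2 \<le> 2 powr (real (N div B) + 1)"
    by (rule eventually_compose_filterlim)
  then show ?thesis
  proof eventually_elim
    case (elim N)
    have "N \<le> B * (N div B + 1)"
      using dividend_less_div_times[of B N] assms by (simp add: algebra_simps)
    then have "real N \<le> real (B * (N div B + 1))" by (rule of_nat_mono)
    then have "real N \<le> real B * (real (N div B) + 1)"
      by (simp only: of_nat_mult of_nat_add of_nat_1)
    then have "real D * (real N)\<^sup>2 \<le> real D * (real B * (real (N div B) + 1))\<^sup>2"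
      by (intro mult_left_mono power_mono) simp_all
    also note elim
    also have "2 powr (real (N div B) + 1) = real (2 ^ (N div B + 1))"
      by (simp add: powr_add powr_realpow)
    finally have "real (D * N\<^sup>2) \<le> real (2 ^ (N div B + 1))" by simp
    then show ?case by (simp only: of_nat_le_iff)
  qed
qed

text \<open>A fixed excess \<open>\<eta>\<close> in the exponent pays for the factor
  \<open>2 ^ (17 * g)\<close>: this is about \<open>n powr (17 / B)\<close>, while
  \<open>l powr \<eta>\<close> is at least \<open>n powr (c0 * \<eta>)\<close>, so a constant
  \<open>B\<close> suffices.\<close>

lemma eventually_prg_exists:
  fixes l :: "nat \<Rightarrow> nat" and \<epsilon> :: "nat \<Rightarrow> real"
  assumes c0: "0 < c0" "\<forall>\<^sub>F n in sequentially. real n powr c0 \<le> real (l n)"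
    and A: "\<forall>\<^sub>F n in sequentially. 1 / real n ^ A \<le> \<epsilon> n" and \<eta>: "0 < \<eta>"
  shows "\<forall>\<^sub>F n in sequentially. prg_exists n (l n) (\<epsilon> n) (nat \<lfloor>real (l n) powr (2/3 + \<eta>)\<rfloor>)"
proof -
  \<comment> \<open>Makes \<open>17 / B\<close> at most half of \<open>c0 * \<eta>\<close>; the
    other half absorbs constant factors.\<close>
  define B where "B = nat \<lceil>34 / (c0 * \<eta>)\<rceil> + 1"
  have B: "1 \<le> B" "17 / real B \<le> c0 * \<eta> / 2"
  proof -
    have "0 < real B" by (simp add: B_def)
    have X: "0 < c0 * \<eta>" using c0(1) \<eta> by simp
    have "34 / (c0 * \<eta>) \<le> real B" unfolding B_def by linarith
    then have "34 \<le> real B * (c0 * \<eta>)" by (simp only: pos_divide_le_eq[OF X])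
    then show "17 / real B \<le> c0 * \<eta> / 2"
      by (simp only: pos_divide_le_eq[OF \<open>0 < real B\<close>]) (simp add: mult.commute)
  qed (simp add: B_def)
  define k where "k = B * (A + 2)"
  define c where "c = 2 * k"
  define a where "a = B * (17 * c + 2)"
  define g where "g = (\<lambda>N. N div B + 1)"
  define x where "x = (\<lambda>N. a * N + 2 ^ a)"
  define y where "y = (\<lambda>N::nat. 2 * N + 2)"
  \<comment> \<open>Dominates every coefficient on the polynomial sides, so that one quadratic bound
    serves them all.\<close>
  define D where "D = 17 * c + c + k * k * a + 2 + ((a + 2 ^ a) * k + (a + 2 ^ a + 12) * 2 ^ k + 1) + 64"
  \<comment> \<open>At \<open>B = 1\<close> the exponent is \<open>N + 1\<close>; doubling
    \<open>D\<close> cancels the surplus factor two.\<close>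
  have D2: "\<forall>\<^sub>F N in sequentially. D * N\<^sup>2 \<le> 2 ^ N"
    using eventually_square_le_power[of 1 "2 * D"] by (simp add: mult.assoc)
  have params: "\<forall>\<^sub>F N in sequentially. 17 * c * N \<le> 2 ^ N \<and> 17 * c * N \<le> 2 ^ g N \<and> c \<le> 2 ^ g N \<and>
      k * k * a \<le> g N \<and> N + 1 \<le> 2 ^ g N \<and> x N * k + (x N + 3 * y N) * 2 ^ k + 1 \<le> 2 ^ g N \<and>
      g N * (N * 21 + 1) + 20 \<le> 2 ^ g N"
    using D2 eventually_square_le_power[OF B(1), of D] eventually_ge_at_top[of "B * (k * k * a) + 1"]
  proof eventually_elim
    case (elim N)
    have N1: "1 \<le> N" using elim(3) by simp
    have sq: "N \<le> N\<^sup>2" "1 \<le> N\<^sup>2" using N1 by (simp_all add: power2_eq_square)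
    have le: "m \<le> 2 ^ g N" if "m \<le> D * N\<^sup>2" for m
      using that elim(2) unfolding g_def by (rule order_trans)
    have 1: "17 * c * N \<le> D * N\<^sup>2" by (intro mult_le_mono sq) (simp add: D_def)
    have 2: "c * 1 \<le> D * N\<^sup>2" by (intro mult_le_mono sq) (simp add: D_def)
    have "N + 1 \<le> 2 * N" using N1 by simp
    also have "\<dots> \<le> D * N\<^sup>2" by (intro mult_le_mono sq) (simp add: D_def)
    finally have 3: "N + 1 \<le> D * N\<^sup>2" .
    have xN: "x N \<le> (a + 2 ^ a) * N" using N1 by (simp add: x_def algebra_simps)
    have yN: "3 * y N \<le> 12 * N" using N1 by (simp add: y_def)
    have "x N * k + (x N + 3 * y N) * 2 ^ k + 1
        \<le> (a + 2 ^ a) * N * k + ((a + 2 ^ a) * N + 12 * N) * 2 ^ k + N"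
      by (intro add_mono mult_le_mono xN yN N1) simp_all
    also have "\<dots> = ((a + 2 ^ a) * k + (a + 2 ^ a + 12) * 2 ^ k + 1) * N" by (simp add: algebra_simps)
    also have "\<dots> \<le> D * N\<^sup>2" by (intro mult_le_mono sq) (simp add: D_def)
    finally have 4: "x N * k + (x N + 3 * y N) * 2 ^ k + 1 \<le> D * N\<^sup>2" .
    have "N div B \<le> N" by (rule div_le_dividend)
    then have "g N \<le> 2 * N" using N1 unfolding g_def by linarith
    then have "g N * (N * 21 + 1) + 20 \<le> 2 * N * (22 * N) + 20 * N\<^sup>2"
      using N1 sq by (intro add_mono mult_le_mono) simp_all
    also have "\<dots> = 64 * N\<^sup>2" by (simp add: power2_eq_square)
    also have "\<dots> \<le> D * N\<^sup>2" by (rule mult_le_mono1) (simp add: D_def)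
    finally have 5: "g N * (N * 21 + 1) + 20 \<le> D * N\<^sup>2" .
    have "B * (k * k * a) \<le> N" using elim(3) by simp
    then have "k * k * a \<le> N div B"
      using B(1) by (simp add: less_eq_div_iff_mult_less_eq mult.commute)
    then have 6: "k * k * a \<le> g N" by (simp add: g_def)
    have 7: "17 * c * N \<le> 2 ^ N" using 1 elim(1) by (rule order_trans)
    show ?case using 6 7 le[OF 1] le[OF 2] le[OF 3] le[OF 4] le[OF 5] by simp
  qed
  have params_n: "\<forall>\<^sub>F n in sequentially. (\<lambda>N. 17 * c * N \<le> 2 ^ N \<and> 17 * c * N \<le> 2 ^ g N \<and> c \<le> 2 ^ g N \<and>
      k * k * a \<le> g N \<and> N + 1 \<le> 2 ^ g N \<and> x N * k + (x N + 3 * y N) * 2 ^ k + 1 \<le> 2 ^ g N \<and>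
      g N * (N * 21 + 1) + 20 \<le> 2 ^ g N) (ceillog2 n)"
    by (rule eventually_compose_filterlim[OF params filterlim_ceillog2])
  \<comment> \<open>The base \<open>2 * n\<close> comes from \<open>2 ^ ceillog2 n < 2 * n\<close>,
    and the summand 1 pays for rounding the length down.\<close>
  have big1: "\<forall>\<^sub>F n in sequentially. 2 ^ 17 * (2 * real n) powr (17 / real B) + 1 \<le> real n powr (c0 * \<eta>)"
  proof -
    define q where "q = c0 * \<eta> / 2"
    have q: "0 < q" using c0 \<eta> by (simp add: q_def)
    have "\<forall>\<^sub>F n in sequentially. 2 ^ 17 * (2 * real n) powr q + 1 \<le> real n powr (2 * q)"
      using q by real_asymp
    with eventually_ge_at_top[of 1] show ?thesis
    proof eventually_elim
      case (elim n)
      have "(2 * real n) powr (17 / real B) \<le> (2 * real n) powr q"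
        using B(2) elim(1) by (intro powr_mono) (simp_all add: q_def)
      with elim(2) show ?case by (simp add: q_def)
    qed
  qed
  have big2: "\<forall>\<^sub>F n in sequentially. 10 * real n + 6 \<le> real n * real n powr (3/2 * \<eta>)"
    using \<eta> by real_asymp
  show ?thesis
    using c0(2) A params_n big1 big2 eventually_ge_at_top[of 4]
  proof eventually_elim
    case (elim n)
    define L where "L = real (l n)"
    define R where "R = nat \<lfloor>L powr (2/3 + \<eta>)\<rfloor>"
    have n4: "4 \<le> n" by (rule elim)
    have "1 \<le> real n powr c0" using n4 c0 by (intro ge_one_powr_ge_zero) simp_all
    then have L1: "1 \<le> L" using elim(1) by (simp add: L_def)
    have R: "L powr (2/3) * L powr \<eta> - 1 \<le> real R"
      unfolding R_def powr_add[symmetric] by linarith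
    have "0 \<le> 1 / real n ^ A" by simp
    then have e0: "0 \<le> \<epsilon> n" using elim(2) by linarith
    show "prg_exists n (l n) (\<epsilon> n) (nat \<lfloor>real (l n) powr (2/3 + \<eta>)\<rfloor>)"
    proof (cases "L \<le> real n powr (3/2)")
      case False
      then have L: "real n powr (3/2) \<le> L" by simp
      have "real n = (real n powr (3/2)) powr (2/3)" using n4 by (simp add: powr_powr)
      also have "\<dots> \<le> L powr (2/3)" using L by (intro powr_mono2) simp_all
      finally have 1: "real n \<le> L powr (2/3)" .
      have "real n powr (3/2 * \<eta>) = (real n powr (3/2)) powr \<eta>" by (simp add: powr_powr)
      also have "\<dots> \<le> L powr \<eta>" using L \<eta> by (intro powr_mono2) simp_all
      finally have 2: "real n powr (3/2 * \<eta>) \<le> L powr \<eta>" .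
      have "10 * real n + 6 \<le> L powr (2/3) * L powr \<eta>"
        using elim(5) mult_mono[OF 1 2] by simp
      then have "10 * real n + 5 \<le> real R" using R by linarith
      then have "10 * n + 5 \<le> R" by linarith
      then show ?thesis using prg_exists_identity[OF e0] by (simp add: R_def L_def)
    next
      case True
      define N where "N = ceillog2 n"
      have par: "17 * c * N \<le> 2 ^ N" "17 * c * N \<le> 2 ^ g N" "c \<le> 2 ^ g N" "k * k * a \<le> g N" "N + 1 \<le> 2 ^ g N"
        "x N * k + (x N + 3 * y N) * 2 ^ k + 1 \<le> 2 ^ g N" "g N * (N * 21 + 1) + 20 \<le> 2 ^ g N"
        using elim(3) by (simp_all add: N_def)
      have "2 ^ N < 2 * n" unfolding N_def using n4 by (intro two_power_ceillog2_gt) simp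
      then have N2: "(2::real) ^ N \<le> 2 * real n"
        using of_nat_less_iff[of "2 ^ N" "2 * n", where 'a = real] by simp
      have "(2::real) ^ (17 * g N) = 2 ^ 17 * 2 powr (17 * real (N div B))"
        by (simp add: g_def power_add powr_realpow[symmetric] distrib_left)
      also have "\<dots> \<le> 2 ^ 17 * 2 powr (real N * (17 / real B))"
      proof -
        have "real (N div B) \<le> real N / real B" by (rule of_nat_div_le_of_nat)
        then have "17 * real (N div B) \<le> 17 * (real N / real B)" by (rule mult_left_mono) simp
        then have "17 * real (N div B) \<le> real N * (17 / real B)" by (simp add: mult.commute)
        then show ?thesis by (intro mult_left_mono powr_mono) simp_all
      qed
      also have "2 powr (real N * (17 / real B)) = (2 ^ N) powr (17 / real B)"
        by (subst powr_realpow[symmetric]) (simp_all only: powr_powr zero_less_numeral)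
      also have "\<dots> \<le> (2 * real n) powr (17 / real B)" using N2 by (intro powr_mono2) simp_all
      finally have g17: "(2::real) ^ (17 * g N) \<le> 2 ^ 17 * (2 * real n) powr (17 / real B)" by simp
      have "real n powr (c0 * \<eta>) = (real n powr c0) powr \<eta>" by (simp add: powr_powr)
      also have "\<dots> \<le> L powr \<eta>" using elim(1) \<eta> by (intro powr_mono2) (simp_all add: L_def)
      finally have L\<eta>: "2 ^ (17 * g N) + 1 \<le> L powr \<eta>" using g17 elim(4) by linarith
      have V: "1 \<le> L powr (2/3)" using L1 by (intro ge_one_powr_ge_zero) simp_all
      have "L powr (2/3) * 2 ^ (17 * g N) + 1 \<le> L powr (2/3) * (2 ^ (17 * g N) + 1)"
        using V by (simp add: algebra_simps)
      also have "\<dots> \<le> L powr (2/3) * L powr \<eta>" using L\<eta> by (intro mult_left_mono) simp_all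
      finally have RR: "L powr (2/3) * 2 ^ (17 * g N) \<le> real R" using R by linarith
      show ?thesis
        unfolding L_def[symmetric] R_def[symmetric]
      proof (rule prg_exists_core[where A = A and B = B])
        show "1 \<le> l n" using L1 by (simp add: L_def)
      qed (use B(1) n4 True elim(2) par RR in \<open>simp_all only: L_def N_def g_def k_def c_def a_def x_def y_def\<close>)
    qed
  qed
qed

theorem theorem18:
  fixes l :: "nat \<Rightarrow> nat" and \<epsilon> :: "nat \<Rightarrow> real"
  assumes "poly_large l"
    and "inverse_poly_bounded \<epsilon>"
  shows "\<exists>(r :: nat \<Rightarrow> nat) (s :: nat \<Rightarrow> nat) (G :: nat \<Rightarrow> bool list \<Rightarrow> bool list).
           power_up_to_o1 (2/3) l r \<and>
           power_up_to_o1 (2/3) l s \<and>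
           (\<forall>n. G n ` bitstrings (r n) \<subseteq> bitstrings n \<and>
                fools (\<epsilon> n) (r n) n (G n) (comparator_class n (l n)) \<and>
                (\<forall>z\<in>bitstrings (r n). \<exists>D. circuit_size D \<le> s n \<and> computes_bits n D (G n z)))"
proof -
  obtain c0 where c0: "0 < c0" "\<forall>\<^sub>F n in sequentially. real n powr c0 \<le> real (l n)"
    using assms(1) unfolding poly_large_def by blast
  obtain A where A: "\<forall>\<^sub>F n in sequentially. 1 / real n ^ A \<le> \<epsilon> n"
    using eventually_inverse_poly(1)[OF assms(2)] by blast
  \<comment> \<open>Since \<open>power_up_to_o1\<close> asks for an equality, the length also needs
    a lower bound of exponent 2/3; the first conjunct builds it into the choice.\<close>
  define P where "P = (\<lambda>n R. nat \<lceil>real (l n) powr (2/3)\<rceil> \<le> R \<and> prg_exists n (l n) (\<epsilon> n) R)"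
  text \<open>Each exponent \<open>2/3 + \<eta>\<close> is eventually admissible, so the least admissible length has exponent \<open>2/3 + o(1)\<close>.\<close>
  define r where "r = (\<lambda>n. LEAST R. P n R)"
  \<comment> \<open>The identity generator is a witness for every \<open>n\<close>, also below all
    asymptotic thresholds.\<close>
  have "P n (max (nat \<lceil>real (l n) powr (2/3)\<rceil>) (10 * n + 5))" for n
    unfolding P_def using eventually_inverse_poly(2)[OF assms(2), of n]
    by (intro conjI prg_exists_identity) simp_all
  then have r: "P n (r n)" for n unfolding r_def by (rule LeastI)
  have lim: "filterlim (\<lambda>n. real (l n)) at_top sequentially"
  proof (rule filterlim_at_top_mono[OF _ c0(2)])
    show "filterlim (\<lambda>n. real n powr c0) at_top sequentially" using c0(1) by real_asymp
  qed
  have big: "\<forall>\<^sub>F n in sequentially. z \<le> real (l n)" for z :: real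
    using lim by (rule filterlim_at_top[THEN iffD1, rule_format])
  define \<delta> where "\<delta> = (\<lambda>n. log (real (l n)) (real (r n)) - 2/3)"
  have upper: "\<forall>\<^sub>F n in sequentially. real (r n) \<le> real (l n) powr (2/3 + \<eta>)" if "0 < \<eta>" for \<eta>
    using eventually_prg_exists[OF c0 A that] big[of 1] big[of "2 powr (1 / \<eta>)"]
  proof eventually_elim
    case (elim n)
    define L where "L = real (l n)"
    have V: "1 \<le> L powr (2/3)" using elim(2) by (intro ge_one_powr_ge_zero) (simp_all add: L_def)
    \<comment> \<open>Once \<open>L powr \<eta>\<close> is at least 2, the two powers differ by at
      least 1, so the ceiling of the smaller is at most the floor of the larger.\<close>
    have "2 = (2 powr (1 / \<eta>)) powr \<eta>" using that by (simp add: powr_powr)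
    also have "\<dots> \<le> L powr \<eta>" using elim(3) that by (intro powr_mono2) (simp_all add: L_def)
    finally have "L powr (2/3) * 2 \<le> L powr (2/3) * L powr \<eta>" by (intro mult_left_mono) simp_all
    then have "L powr (2/3) + 1 \<le> L powr (2/3 + \<eta>)" using V by (simp add: powr_add)
    then have "nat \<lceil>L powr (2/3)\<rceil> \<le> nat \<lfloor>L powr (2/3 + \<eta>)\<rfloor>" by linarith
    then have "P n (nat \<lfloor>L powr (2/3 + \<eta>)\<rfloor>)" using elim(1) by (simp add: P_def L_def)
    then have "r n \<le> nat \<lfloor>L powr (2/3 + \<eta>)\<rfloor>" unfolding r_def by (rule Least_le)
    moreover have "real (nat \<lfloor>L powr (2/3 + \<eta>)\<rfloor>) \<le> L powr (2/3 + \<eta>)" by simp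
    ultimately show ?case unfolding L_def[symmetric] by linarith
  qed
  have lower: "real (l n) powr (2/3) \<le> real (r n)" for n
    using r[of n] unfolding P_def by linarith
  have "(\<delta> \<longlongrightarrow> 0) sequentially"
  proof (rule tendstoI)
    fix e :: real assume "0 < e"
    then have e2: "0 < e / 2" by simp
    show "\<forall>\<^sub>F n in sequentially. dist (\<delta> n) 0 < e"
      using upper[OF e2] big[of 2]
    proof eventually_elim
      case (elim n)
      have L: "1 < real (l n)" using elim(2) by simp
      have pos: "0 < real (r n)"
        using lower[of n] L powr_gt_zero[of "real (l n)" "2/3"] by linarith
      have "2/3 \<le> log (real (l n)) (real (r n))"
        by (subst le_log_iff[OF L pos]) (rule lower)
      moreover have "log (real (l n)) (real (r n)) \<le> 2/3 + e / 2"
        by (subst log_le_iff[OF L pos]) (rule elim(1))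
      ultimately show ?case using \<open>0 < e\<close> by (simp add: \<delta>_def dist_real_def)
    qed
  qed
  then have "\<delta> \<in> o(\<lambda>_. 1)" by (intro smalloI_tendsto) simp_all
  moreover have "\<forall>\<^sub>F n in sequentially. real (r n) = real (l n) powr (2/3 + \<delta> n)"
    using big[of 2]
  proof eventually_elim
    case (elim n)
    have "0 < real (r n)"
      using lower[of n] elim powr_gt_zero[of "real (l n)" "2/3"] by linarith
    then show ?case using elim by (simp add: \<delta>_def)
  qed
  ultimately have pw: "power_up_to_o1 (2/3) l r" unfolding power_up_to_o1_def by blast
  have "\<forall>n. \<exists>G. G ` bitstrings (r n) \<subseteq> bitstrings n \<and> fools (\<epsilon> n) (r n) n G (comparator_class n (l n)) \<and>
     (\<forall>z\<in>bitstrings (r n). \<exists>D. circuit_size D \<le> r n \<and> computes_bits n D (G z))"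
    using r unfolding P_def prg_exists_def by blast
  from choice[OF this] obtain G where G: "\<forall>n. G n ` bitstrings (r n) \<subseteq> bitstrings n \<and>
      fools (\<epsilon> n) (r n) n (G n) (comparator_class n (l n)) \<and>
      (\<forall>z\<in>bitstrings (r n). \<exists>D. circuit_size D \<le> r n \<and> computes_bits n D (G n z))"
    by (rule exE)
  \<comment> \<open>The same \<open>r\<close> is the witness for the seed length and for the circuit
    size.\<close>
  show ?thesis
    by (intro exI[of _ r] exI[of _ G] conjI pw G)
qed

end
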